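(* Let $F$ be a field of characteristic $p>0$ with $p$-degree $\mathrm{pdeg}(F)\leq 1$. Then for each proper integral $F$-scheme $Y$, with generic point $\eta\in Y$, we have $\mathrm{edim}(\mathscr{O}_{Y,\eta}/F)\leq 1$.
   Context: The $p$-degree $\mathrm{pdeg}(F)$ is the dimension of the $F$-vector space $\Omega^1_{F/\mathbb{Z}}=\Omega^1_{F/F^p}$; if finite it is the integer $n$ with $[F:F^p]=p^n$. For a local Artin ring $A$ with maximal ideal $\mathfrak{m}_A$ and residue field $\kappa$, the embedding dimension is $\mathrm{edim}(A)=\dim_\kappa(\mathfrak{m}_A/\mathfrak{m}_A^2)$. If $A$ is a local $F$-algebra that is essentially of finite type and of Krull dimension zero, then $A\otimes_FF^{\mathrm{perf}}$ is again a local Artin ring, where $F^{\mathrm{perf}}$ is the perfect closure of $F$, and one sets $\mathrm{edim}(A/F)=\mathrm{edim}(A\otimes_FF^{\mathrm{perf}})$. For $A=\mathscr{O}_{Y,\eta}$ this is called the geometric generic embedding dimension of $Y$. *)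

theory Defs
  imports
    "HOL-Algebra.QuotRing"
    "HOL-Algebra.IntRing"
    "HOL-Algebra.Ideal_Product"
    "HOL-Algebra.Generated_Rings"
    "HOL-Analysis.Abstract_Topology"
    "HOL-Library.Poly_Mapping"
    "HOL-Library.Multiset"
    "HOL-Library.Extended_Nat"
    "Jordan_Normal_Form.Missing_VectorSpace"
begin

section \<open>Commutative algebra\<close>

definition ring_char :: "'a ring \<Rightarrow> nat" where
  "ring_char R = Gcd {n. [n] \<cdot>\<^bsub>R\<^esub> \<one>\<^bsub>R\<^esub> = \<zero>\<^bsub>R\<^esub>}"

definition local_ring :: "'a ring \<Rightarrow> bool" where
  "local_ring A \<longleftrightarrow> cring A \<and> (\<exists>!I. maximalideal I A)"

definition max_ideal :: "'a ring \<Rightarrow> 'a set" where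
  "max_ideal A = (THE I. maximalideal I A)"

definition vdim :: "'k ring \<Rightarrow> ('k, 'v) module \<Rightarrow> enat" where
  "vdim K V = (if vectorspace.fin_dim K V then enat (vectorspace.dim K V) else \<infinity>)"

definition finite_type_hom :: "'a ring \<Rightarrow> 'b ring \<Rightarrow> ('a \<Rightarrow> 'b) \<Rightarrow> bool" where
  "finite_type_hom A B \<phi> \<longleftrightarrow> \<phi> \<in> ring_hom A B \<and>
     (\<exists>E. finite E \<and> E \<subseteq> carrier B \<and> generate_ring B (\<phi> ` carrier A \<union> E) = carrier B)"

subsection \<open>Kaehler differentials and the p-degree\<close>

definition quot_module :: "('a, 'v) module \<Rightarrow> 'v set \<Rightarrow> ('a, 'v set) module" where
  "quot_module M N =
     \<lparr>carrier = a_rcosets\<^bsub>M\<^esub> N, mult = (\<lambda>X Y. N), one = N, zero = N, add = set_add M,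
      smult = (\<lambda>a X. \<Union>x\<in>X. N +>\<^bsub>M\<^esub> (a \<odot>\<^bsub>M\<^esub> x))\<rparr>"

definition free_module :: "'a ring \<Rightarrow> 'x set \<Rightarrow> ('a, 'x \<Rightarrow> 'a) module" where
  "free_module R S = (ring.func_space R S)
     \<lparr>carrier := {f \<in> S \<rightarrow>\<^sub>E carrier R. finite {x \<in> S. f x \<noteq> \<zero>\<^bsub>R\<^esub>}}\<rparr>"

definition free_gen :: "'a ring \<Rightarrow> 'x set \<Rightarrow> 'x \<Rightarrow> 'x \<Rightarrow> 'a" where
  "free_gen R S x = (\<lambda>y\<in>S. if y = x then \<one>\<^bsub>R\<^esub> else \<zero>\<^bsub>R\<^esub>)"

definition kaehler_relations :: "'a ring \<Rightarrow> ('a \<Rightarrow> 'b) \<Rightarrow> 'b ring \<Rightarrow> ('b \<Rightarrow> 'b) set" where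
  "kaehler_relations A \<phi> B =
     (let M = free_module B (carrier B); d = free_gen B (carrier B) in
        {d (x \<oplus>\<^bsub>B\<^esub> y) \<ominus>\<^bsub>M\<^esub> (d x \<oplus>\<^bsub>M\<^esub> d y) | x y. x \<in> carrier B \<and> y \<in> carrier B} \<union>
        {d (x \<otimes>\<^bsub>B\<^esub> y) \<ominus>\<^bsub>M\<^esub> (x \<odot>\<^bsub>M\<^esub> d y \<oplus>\<^bsub>M\<^esub> y \<odot>\<^bsub>M\<^esub> d x) | x y. x \<in> carrier B \<and> y \<in> carrier B} \<union>
        {d (\<phi> a) | a. a \<in> carrier A})"

definition kaehler_module :: "'a ring \<Rightarrow> ('a \<Rightarrow> 'b) \<Rightarrow> 'b ring \<Rightarrow> ('b, ('b \<Rightarrow> 'b) set) module" where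
  "kaehler_module A \<phi> B =
     (let M = free_module B (carrier B) in
        quot_module M (module.span B M (kaehler_relations A \<phi> B)))"

definition pdeg :: "'f ring \<Rightarrow> enat" where
  "pdeg F = vdim F (kaehler_module \<Z> (\<lambda>n. [n] \<cdot>\<^bsub>F\<^esub> \<one>\<^bsub>F\<^esub>) F)"

subsection \<open>Tensor products\<close>

text \<open>The ring \<open>A \<otimes>\<^sub>C B\<close> of two \<open>C\<close>-algebras is the quotient of the monoid ring
  \<open>\<int>[A \<times> B]\<close> of the multiplicative monoid \<open>A \<times> B\<close> by the bilinearity relations.
  The subgroup these relations generate is already an ideal of the monoid ring, so the additive
  group is the usual one.\<close>

definition formal_tensors :: "'a ring \<Rightarrow> 'b ring \<Rightarrow> (('a \<times> 'b) \<Rightarrow>\<^sub>0 int) ring" where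
  "formal_tensors A B =
     \<lparr>carrier = {c. Poly_Mapping.keys c \<subseteq> carrier A \<times> carrier B},
      mult = (\<lambda>c d. frag_extend (\<lambda>(a, b). frag_extend
                 (\<lambda>(a', b'). frag_of (a \<otimes>\<^bsub>A\<^esub> a', b \<otimes>\<^bsub>B\<^esub> b')) d) c),
      one = frag_of (\<one>\<^bsub>A\<^esub>, \<one>\<^bsub>B\<^esub>), zero = 0, add = (+)\<rparr>"

definition tensor_relations ::
    "'c ring \<Rightarrow> ('c \<Rightarrow> 'a) \<Rightarrow> 'a ring \<Rightarrow> ('c \<Rightarrow> 'b) \<Rightarrow> 'b ring \<Rightarrow> (('a \<times> 'b) \<Rightarrow>\<^sub>0 int) set" where
  "tensor_relations C \<alpha> A \<beta> B =
     {frag_of (a \<oplus>\<^bsub>A\<^esub> a', b) - frag_of (a, b) - frag_of (a', b) | a a' b.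
        a \<in> carrier A \<and> a' \<in> carrier A \<and> b \<in> carrier B} \<union>
     {frag_of (a, b \<oplus>\<^bsub>B\<^esub> b') - frag_of (a, b) - frag_of (a, b') | a b b'.
        a \<in> carrier A \<and> b \<in> carrier B \<and> b' \<in> carrier B} \<union>
     {frag_of (\<alpha> c \<otimes>\<^bsub>A\<^esub> a, b) - frag_of (a, \<beta> c \<otimes>\<^bsub>B\<^esub> b) | a b c.
        a \<in> carrier A \<and> b \<in> carrier B \<and> c \<in> carrier C}"

definition tensor_ideal ::
    "'c ring \<Rightarrow> ('c \<Rightarrow> 'a) \<Rightarrow> 'a ring \<Rightarrow> ('c \<Rightarrow> 'b) \<Rightarrow> 'b ring \<Rightarrow> (('a \<times> 'b) \<Rightarrow>\<^sub>0 int) set" where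
  "tensor_ideal C \<alpha> A \<beta> B = genideal (formal_tensors A B) (tensor_relations C \<alpha> A \<beta> B)"

definition tensor_ring ::
    "'c ring \<Rightarrow> ('c \<Rightarrow> 'a) \<Rightarrow> 'a ring \<Rightarrow> ('c \<Rightarrow> 'b) \<Rightarrow> 'b ring \<Rightarrow> (('a \<times> 'b) \<Rightarrow>\<^sub>0 int) set ring" where
  "tensor_ring C \<alpha> A \<beta> B = formal_tensors A B Quot tensor_ideal C \<alpha> A \<beta> B"

definition tensor_class ::
    "'c ring \<Rightarrow> ('c \<Rightarrow> 'a) \<Rightarrow> 'a ring \<Rightarrow> ('c \<Rightarrow> 'b) \<Rightarrow> 'b ring \<Rightarrow>
     (('a \<times> 'b) \<Rightarrow>\<^sub>0 int) \<Rightarrow> (('a \<times> 'b) \<Rightarrow>\<^sub>0 int) set" where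
  "tensor_class C \<alpha> A \<beta> B c = tensor_ideal C \<alpha> A \<beta> B +>\<^bsub>formal_tensors A B\<^esub> c"

subsection \<open>Perfect closure and embedding dimension\<close>

text \<open>For a field of characteristic \<open>p > 0\<close> the perfect closure is the direct limit of
  \<open>F \<rightarrow> F \<rightarrow> \<dots>\<close> along the Frobenius; the class of \<open>(x, n)\<close> is the element \<open>x\<^bsup>1/p\<^sup>n\<^esup>\<close>.\<close>

definition perf_elem :: "'f ring \<Rightarrow> 'f \<Rightarrow> nat \<Rightarrow> ('f \<times> nat) set" where
  "perf_elem F x n = {(y, m). y \<in> carrier F \<and>
     x [^]\<^bsub>F\<^esub> (ring_char F ^ m) = y [^]\<^bsub>F\<^esub> (ring_char F ^ n)}"

definition perf_closure :: "'f ring \<Rightarrow> ('f \<times> nat) set ring" where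
  "perf_closure F = (let p = ring_char F in
     \<lparr>carrier = {perf_elem F x n | x n. x \<in> carrier F},
      mult = (\<lambda>X Y. \<Union>(x, n)\<in>X. \<Union>(y, m)\<in>Y.
                perf_elem F (x [^]\<^bsub>F\<^esub> (p ^ m) \<otimes>\<^bsub>F\<^esub> y [^]\<^bsub>F\<^esub> (p ^ n)) (n + m)),
      one = perf_elem F \<one>\<^bsub>F\<^esub> 0,
      zero = perf_elem F \<zero>\<^bsub>F\<^esub> 0,
      add = (\<lambda>X Y. \<Union>(x, n)\<in>X. \<Union>(y, m)\<in>Y.
                perf_elem F (x [^]\<^bsub>F\<^esub> (p ^ m) \<oplus>\<^bsub>F\<^esub> y [^]\<^bsub>F\<^esub> (p ^ n)) (n + m))\<rparr>)"

definition perf_embed :: "'f ring \<Rightarrow> 'f \<Rightarrow> ('f \<times> nat) set" where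
  "perf_embed F x = perf_elem F x 0"

definition cotangent_space :: "'a ring \<Rightarrow> ('a set, 'a set) module" where
  "cotangent_space A = (let I = max_ideal A; I2 = ideal_prod A I I in
     \<lparr>carrier = (\<lambda>x. I2 +>\<^bsub>A\<^esub> x) ` I, mult = (\<lambda>X Y. I2), one = I2, zero = I2, add = set_add A,
      smult = (\<lambda>C X. \<Union>r\<in>C. \<Union>x\<in>X. I2 +>\<^bsub>A\<^esub> (r \<otimes>\<^bsub>A\<^esub> x))\<rparr>)"

definition edim :: "'a ring \<Rightarrow> enat" where
  "edim A = vdim (A Quot max_ideal A) (cotangent_space A)"

definition edim_over :: "'f ring \<Rightarrow> ('f \<Rightarrow> 'a) \<Rightarrow> 'a ring \<Rightarrow> enat" where
  "edim_over F \<alpha> A = edim (tensor_ring F \<alpha> A (perf_embed F) (perf_closure F))"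

subsection \<open>Localization\<close>

definition frac :: "'a ring \<Rightarrow> 'a set \<Rightarrow> 'a \<Rightarrow> 'a \<Rightarrow> ('a \<times> 'a) set" where
  "frac R S a s = {(b, t). b \<in> carrier R \<and> t \<in> S \<and>
     (\<exists>u\<in>S. u \<otimes>\<^bsub>R\<^esub> (a \<otimes>\<^bsub>R\<^esub> t) = u \<otimes>\<^bsub>R\<^esub> (b \<otimes>\<^bsub>R\<^esub> s))}"

definition localization :: "'a ring \<Rightarrow> 'a set \<Rightarrow> ('a \<times> 'a) set ring" where
  "localization R S =
     \<lparr>carrier = {frac R S a s | a s. a \<in> carrier R \<and> s \<in> S},
      mult = (\<lambda>X Y. \<Union>(a, s)\<in>X. \<Union>(b, t)\<in>Y. frac R S (a \<otimes>\<^bsub>R\<^esub> b) (s \<otimes>\<^bsub>R\<^esub> t)),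
      one = frac R S \<one>\<^bsub>R\<^esub> \<one>\<^bsub>R\<^esub>,
      zero = frac R S \<zero>\<^bsub>R\<^esub> \<one>\<^bsub>R\<^esub>,
      add = (\<lambda>X Y. \<Union>(a, s)\<in>X. \<Union>(b, t)\<in>Y.
               frac R S (a \<otimes>\<^bsub>R\<^esub> t \<oplus>\<^bsub>R\<^esub> b \<otimes>\<^bsub>R\<^esub> s) (s \<otimes>\<^bsub>R\<^esub> t))\<rparr>"

abbreviation frac_at :: "'a ring \<Rightarrow> 'a set \<Rightarrow> 'a \<Rightarrow> 'a \<Rightarrow> ('a \<times> 'a) set" where
  "frac_at R P \<equiv> frac R (carrier R - P)"

abbreviation local_at :: "'a ring \<Rightarrow> 'a set \<Rightarrow> ('a \<times> 'a) set ring" where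
  "local_at R P \<equiv> localization R (carrier R - P)"

section \<open>Locally ringed spaces\<close>

text \<open>A space with a presheaf of rings; the values of \<open>sect\<close> and \<open>res\<close> on non-open sets carry
  no meaning.\<close>

record ('a, 'b) rspace =
  tops :: "'a topology"
  sect :: "'a set \<Rightarrow> 'b ring"
  res :: "'a set \<Rightarrow> 'a set \<Rightarrow> 'b \<Rightarrow> 'b"

abbreviation is_open :: "('a, 'b) rspace \<Rightarrow> 'a set \<Rightarrow> bool" where
  "is_open X U \<equiv> openin (tops X) U"

abbreviation points :: "('a, 'b) rspace \<Rightarrow> 'a set" where
  "points X \<equiv> topspace (tops X)"

definition ringed_space :: "('a, 'b) rspace \<Rightarrow> bool" where
  "ringed_space X \<longleftrightarrow>
     (\<forall>U. is_open X U \<longrightarrow> cring (sect X U)) \<and>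
     (\<forall>U V. is_open X U \<and> is_open X V \<and> V \<subseteq> U \<longrightarrow> res X U V \<in> ring_hom (sect X U) (sect X V)) \<and>
     (\<forall>U. is_open X U \<longrightarrow> (\<forall>s\<in>carrier (sect X U). res X U U s = s)) \<and>
     (\<forall>U V W. is_open X U \<and> is_open X V \<and> is_open X W \<and> W \<subseteq> V \<and> V \<subseteq> U \<longrightarrow>
        (\<forall>s\<in>carrier (sect X U). res X V W (res X U V s) = res X U W s)) \<and>
     (\<forall>\<U>. (\<forall>U\<in>\<U>. is_open X U) \<longrightarrow>
        (\<forall>s\<in>carrier (sect X (\<Union>\<U>)). \<forall>t\<in>carrier (sect X (\<Union>\<U>)).
           (\<forall>U\<in>\<U>. res X (\<Union>\<U>) U s = res X (\<Union>\<U>) U t) \<longrightarrow> s = t) \<and>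
        (\<forall>\<sigma>. (\<forall>U\<in>\<U>. \<sigma> U \<in> carrier (sect X U)) \<and>
             (\<forall>U\<in>\<U>. \<forall>V\<in>\<U>. res X U (U \<inter> V) (\<sigma> U) = res X V (U \<inter> V) (\<sigma> V)) \<longrightarrow>
             (\<exists>s\<in>carrier (sect X (\<Union>\<U>)). \<forall>U\<in>\<U>. res X (\<Union>\<U>) U s = \<sigma> U)))"

definition germ :: "('a, 'b) rspace \<Rightarrow> 'a \<Rightarrow> 'a set \<Rightarrow> 'b \<Rightarrow> ('a set \<times> 'b) set" where
  "germ X x U s = {(V, t). is_open X V \<and> x \<in> V \<and> t \<in> carrier (sect X V) \<and>
     (\<exists>W. is_open X W \<and> x \<in> W \<and> W \<subseteq> U \<inter> V \<and> res X U W s = res X V W t)}"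

definition stalk :: "('a, 'b) rspace \<Rightarrow> 'a \<Rightarrow> ('a set \<times> 'b) set ring" where
  "stalk X x =
     \<lparr>carrier = {germ X x U s | U s. is_open X U \<and> x \<in> U \<and> s \<in> carrier (sect X U)},
      mult = (\<lambda>g h. \<Union>(U, s)\<in>g. \<Union>(V, t)\<in>h.
        germ X x (U \<inter> V) (res X U (U \<inter> V) s \<otimes>\<^bsub>sect X (U \<inter> V)\<^esub> res X V (U \<inter> V) t)),
      one = germ X x (points X) \<one>\<^bsub>sect X (points X)\<^esub>,
      zero = germ X x (points X) \<zero>\<^bsub>sect X (points X)\<^esub>,
      add = (\<lambda>g h. \<Union>(U, s)\<in>g. \<Union>(V, t)\<in>h.
        germ X x (U \<inter> V) (res X U (U \<inter> V) s \<oplus>\<^bsub>sect X (U \<inter> V)\<^esub> res X V (U \<inter> V) t))\<rparr>"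

definition locally_ringed_space :: "('a, 'b) rspace \<Rightarrow> bool" where
  "locally_ringed_space X \<longleftrightarrow> ringed_space X \<and> (\<forall>x\<in>points X. local_ring (stalk X x))"

definition open_sub :: "('a, 'b) rspace \<Rightarrow> 'a set \<Rightarrow> ('a, 'b) rspace" where
  "open_sub X U = X\<lparr>tops := subtopology (tops X) U\<rparr>"

subsection \<open>Morphisms\<close>

text \<open>A morphism \<open>X \<rightarrow> Y\<close> is a map of points together with ring maps from the sections of \<open>Y\<close>
  over each open \<open>V\<close> to the sections of \<open>X\<close> over its preimage.\<close>

type_synonym ('a, 'b, 'c, 'd) rmap = "('a \<Rightarrow> 'c) \<times> ('c set \<Rightarrow> 'd \<Rightarrow> 'b)"

definition preim :: "('a, 'b) rspace \<Rightarrow> ('a, 'b, 'c, 'd) rmap \<Rightarrow> 'c set \<Rightarrow> 'a set" where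
  "preim X f V = {x \<in> points X. fst f x \<in> V}"

definition stalk_map ::
    "('a, 'b) rspace \<Rightarrow> ('a, 'b, 'c, 'd) rmap \<Rightarrow> 'a \<Rightarrow> ('c set \<times> 'd) set \<Rightarrow> ('a set \<times> 'b) set" where
  "stalk_map X f x g = (\<Union>(V, s)\<in>g. germ X x (preim X f V) (snd f V s))"

definition lrs_morphism ::
    "('a, 'b) rspace \<Rightarrow> ('c, 'd) rspace \<Rightarrow> ('a, 'b, 'c, 'd) rmap \<Rightarrow> bool" where
  "lrs_morphism X Y f \<longleftrightarrow>
     continuous_map (tops X) (tops Y) (fst f) \<and>
     (\<forall>V. is_open Y V \<longrightarrow> snd f V \<in> ring_hom (sect Y V) (sect X (preim X f V))) \<and>
     (\<forall>V W. is_open Y V \<and> is_open Y W \<and> W \<subseteq> V \<longrightarrow>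
        (\<forall>s\<in>carrier (sect Y V).
           res X (preim X f V) (preim X f W) (snd f V s) = snd f W (res Y V W s))) \<and>
     (\<forall>x\<in>points X. \<forall>g\<in>max_ideal (stalk Y (fst f x)). stalk_map X f x g \<in> max_ideal (stalk X x))"

definition rmap_id :: "('a, 'b, 'a, 'b) rmap" where
  "rmap_id = (\<lambda>x. x, \<lambda>U s. s)"

definition rmap_comp ::
    "('c, 'd) rspace \<Rightarrow> ('c, 'd, 'e, 'g) rmap \<Rightarrow> ('a, 'b, 'c, 'd) rmap \<Rightarrow> ('a, 'b, 'e, 'g) rmap" where
  "rmap_comp Y h f = (\<lambda>x. fst h (fst f x), \<lambda>W s. snd f (preim Y h W) (snd h W s))"

definition rmap_eq ::
    "('a, 'b) rspace \<Rightarrow> ('c, 'd) rspace \<Rightarrow> ('a, 'b, 'c, 'd) rmap \<Rightarrow> ('a, 'b, 'c, 'd) rmap \<Rightarrow> bool" where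
  "rmap_eq X Y f h \<longleftrightarrow> (\<forall>x\<in>points X. fst f x = fst h x) \<and>
     (\<forall>V. is_open Y V \<longrightarrow> (\<forall>s\<in>carrier (sect Y V). snd f V s = snd h V s))"

definition lrs_iso :: "('a, 'b) rspace \<Rightarrow> ('c, 'd) rspace \<Rightarrow> bool" where
  "lrs_iso X Y \<longleftrightarrow> (\<exists>f h. lrs_morphism X Y f \<and> lrs_morphism Y X h \<and>
     rmap_eq X X (rmap_comp Y h f) rmap_id \<and> rmap_eq Y Y (rmap_comp X f h) rmap_id)"

definition closed_immersion ::
    "('a, 'b) rspace \<Rightarrow> ('c, 'd) rspace \<Rightarrow> ('a, 'b, 'c, 'd) rmap \<Rightarrow> bool" where
  "closed_immersion X Y f \<longleftrightarrow> lrs_morphism X Y f \<and>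
     embedding_map (tops X) (tops Y) (fst f) \<and> closedin (tops Y) (fst f ` points X) \<and>
     (\<forall>V t y. is_open Y V \<and> t \<in> carrier (sect X (preim X f V)) \<and> y \<in> V \<longrightarrow>
        (\<exists>W s. is_open Y W \<and> y \<in> W \<and> W \<subseteq> V \<and> s \<in> carrier (sect Y W) \<and>
               snd f W s = res X (preim X f V) (preim X f W) t))"

section \<open>Schemes\<close>

text \<open>Ring of functions on \<open>W\<close> with values in the rings \<open>R w\<close>, with carrier \<open>C\<close>.\<close>

definition fun_ring :: "'x set \<Rightarrow> ('x \<Rightarrow> 'y ring) \<Rightarrow> ('x \<Rightarrow> 'y) set \<Rightarrow> ('x \<Rightarrow> 'y) ring" where
  "fun_ring W R C =
     \<lparr>carrier = C,
      mult = (\<lambda>\<sigma> \<tau>. \<lambda>w\<in>W. \<sigma> w \<otimes>\<^bsub>R w\<^esub> \<tau> w), one = (\<lambda>w\<in>W. \<one>\<^bsub>R w\<^esub>),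
      zero = (\<lambda>w\<in>W. \<zero>\<^bsub>R w\<^esub>), add = (\<lambda>\<sigma> \<tau>. \<lambda>w\<in>W. \<sigma> w \<oplus>\<^bsub>R w\<^esub> \<tau> w)\<rparr>"

type_synonym 'r spec_sect = "'r set \<Rightarrow> ('r \<times> 'r) set"

definition spec_topology :: "'r ring \<Rightarrow> 'r set topology" where
  "spec_topology R = topology_generated_by ((\<lambda>a. {P. primeideal P R \<and> a \<notin> P}) ` carrier R)"

definition spec_sections :: "'r ring \<Rightarrow> 'r set set \<Rightarrow> 'r spec_sect set" where
  "spec_sections R U =
     {\<sigma> \<in> (\<Pi>\<^sub>E P\<in>U. carrier (local_at R P)).
        \<forall>P\<in>U. \<exists>V a s. openin (spec_topology R) V \<and> P \<in> V \<and> V \<subseteq> U \<and> a \<in> carrier R \<and> s \<in> carrier R \<and>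
           (\<forall>Q\<in>V. s \<notin> Q \<and> \<sigma> Q = frac_at R Q a s)}"

definition Spec :: "'r ring \<Rightarrow> ('r set, 'r spec_sect) rspace" where
  "Spec R = \<lparr>tops = spec_topology R,
     sect = (\<lambda>U. fun_ring U (local_at R) (spec_sections R U)),
     res = (\<lambda>U V \<sigma>. restrict \<sigma> V)\<rparr>"

text \<open>An affine scheme is isomorphic to the spectrum of its ring of global sections, so this is
  equivalent to being isomorphic to the spectrum of some ring.\<close>

definition affine_open :: "('a, 'b) rspace \<Rightarrow> 'a set \<Rightarrow> bool" where
  "affine_open X U \<longleftrightarrow> is_open X U \<and> lrs_iso (open_sub X U) (Spec (sect X U))"

definition scheme :: "('a, 'b) rspace \<Rightarrow> bool" where
  "scheme X \<longleftrightarrow> locally_ringed_space X \<and> (\<forall>x\<in>points X. \<exists>U. affine_open X U \<and> x \<in> U)"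

definition integral_scheme :: "('a, 'b) rspace \<Rightarrow> bool" where
  "integral_scheme X \<longleftrightarrow> scheme X \<and> points X \<noteq> {} \<and>
     (\<forall>U. is_open X U \<and> U \<noteq> {} \<longrightarrow> domain (sect X U))"

definition generic_point :: "('a, 'b) rspace \<Rightarrow> 'a \<Rightarrow> bool" where
  "generic_point X \<eta> \<longleftrightarrow> \<eta> \<in> points X \<and> tops X closure_of {\<eta>} = points X"

subsection \<open>Fibre products\<close>

text \<open>The fibre product of \<open>f : X \<rightarrow> S\<close> and \<open>g : Z \<rightarrow> S\<close> in the category of locally ringed spaces,
  in the explicit construction of Gillam (\<open>Localization of ringed spaces\<close>); for schemes this is
  the fibre product of schemes.  A point is a triple \<open>(x, z, Q)\<close> where \<open>x\<close> and \<open>z\<close> have the same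
  image \<open>s\<close> in \<open>S\<close> and \<open>Q\<close> is a prime of the tensor product of the stalks at \<open>x\<close> and \<open>z\<close> over the
  stalk at \<open>s\<close> lying over both maximal ideals; the stalk at this point is the localization at \<open>Q\<close>.
  In \<open>fp_value\<close> a formal sum of tensors of sections over \<open>U\<close> and \<open>V\<close> is evaluated at
  \<open>(x, z)\<close>.\<close>

type_synonym ('a, 'b, 'c, 'd) fp_tensor = "((('a set \<times> 'b) set \<times> ('c set \<times> 'd) set) \<Rightarrow>\<^sub>0 int) set"
type_synonym ('a, 'b, 'c, 'd) fp_point = "'a \<times> 'c \<times> ('a, 'b, 'c, 'd) fp_tensor set"
type_synonym ('a, 'b, 'c, 'd) fp_sect =
  "('a, 'b, 'c, 'd) fp_point \<Rightarrow> (('a, 'b, 'c, 'd) fp_tensor \<times> ('a, 'b, 'c, 'd) fp_tensor) set"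

context
  fixes X :: "('a, 'b) rspace" and Z :: "('c, 'd) rspace" and S :: "('e, 'g) rspace"
    and f :: "('a, 'b, 'e, 'g) rmap" and g :: "('c, 'd, 'e, 'g) rmap"
begin

definition fp_ring :: "'a \<Rightarrow> 'c \<Rightarrow> ('a, 'b, 'c, 'd) fp_tensor ring" where
  "fp_ring x z = tensor_ring (stalk S (fst f x)) (stalk_map X f x) (stalk X x)
                                                 (stalk_map Z g z) (stalk Z z)"

definition fp_class ::
    "'a \<Rightarrow> 'c \<Rightarrow> ((('a set \<times> 'b) set \<times> ('c set \<times> 'd) set) \<Rightarrow>\<^sub>0 int) \<Rightarrow> ('a, 'b, 'c, 'd) fp_tensor" where
  "fp_class x z = tensor_class (stalk S (fst f x)) (stalk_map X f x) (stalk X x)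
                                                   (stalk_map Z g z) (stalk Z z)"

definition fp_value ::
    "'a set \<Rightarrow> 'c set \<Rightarrow> (('b \<times> 'd) \<Rightarrow>\<^sub>0 int) \<Rightarrow> 'a \<Rightarrow> 'c \<Rightarrow> ('a, 'b, 'c, 'd) fp_tensor" where
  "fp_value U V c x z =
     fp_class x z (frag_extend (\<lambda>(s, t). frag_of (germ X x U s, germ Z z V t)) c)"

definition fp_points :: "('a, 'b, 'c, 'd) fp_point set" where
  "fp_points = {(x, z, Q). x \<in> points X \<and> z \<in> points Z \<and> fst f x = fst g z \<and>
     primeideal Q (fp_ring x z) \<and>
     {a \<in> carrier (stalk X x). fp_class x z (frag_of (a, \<one>\<^bsub>stalk Z z\<^esub>)) \<in> Q} = max_ideal (stalk X x) \<and>
     {b \<in> carrier (stalk Z z). fp_class x z (frag_of (\<one>\<^bsub>stalk X x\<^esub>, b)) \<in> Q} = max_ideal (stalk Z z)}"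

definition fp_topology :: "('a, 'b, 'c, 'd) fp_point topology" where
  "fp_topology = topology_generated_by
     {{(x, z, Q) \<in> fp_points. x \<in> U \<and> z \<in> V \<and> fp_value U V c x z \<notin> Q} | U V c.
        is_open X U \<and> is_open Z V \<and> c \<in> carrier (formal_tensors (sect X U) (sect Z V))}"

definition fp_local ::
    "('a, 'b, 'c, 'd) fp_point \<Rightarrow> (('a, 'b, 'c, 'd) fp_tensor \<times> ('a, 'b, 'c, 'd) fp_tensor) set ring" where
  "fp_local = (\<lambda>(x, z, Q). local_at (fp_ring x z) Q)"

definition fp_sections :: "('a, 'b, 'c, 'd) fp_point set \<Rightarrow> ('a, 'b, 'c, 'd) fp_sect set" where
  "fp_sections W =
     {\<sigma> \<in> (\<Pi>\<^sub>E w\<in>W. carrier (fp_local w)).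
        \<forall>w\<in>W. \<exists>N U V c e. openin fp_topology N \<and> w \<in> N \<and> N \<subseteq> W \<and> is_open X U \<and> is_open Z V \<and>
           c \<in> carrier (formal_tensors (sect X U) (sect Z V)) \<and>
           e \<in> carrier (formal_tensors (sect X U) (sect Z V)) \<and>
           (\<forall>(x, z, Q)\<in>N. x \<in> U \<and> z \<in> V \<and> fp_value U V e x z \<notin> Q \<and>
              \<sigma> (x, z, Q) = frac_at (fp_ring x z) Q (fp_value U V c x z) (fp_value U V e x z))}"

definition fibre_product :: "(('a, 'b, 'c, 'd) fp_point, ('a, 'b, 'c, 'd) fp_sect) rspace" where
  "fibre_product = \<lparr>tops = fp_topology,
     sect = (\<lambda>W. fun_ring W fp_local (fp_sections W)),
     res = (\<lambda>W W' \<sigma>. restrict \<sigma> W')\<rparr>"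

definition fp_pr1 :: "(('a, 'b, 'c, 'd) fp_point, ('a, 'b, 'c, 'd) fp_sect, 'a, 'b) rmap" where
  "fp_pr1 = (\<lambda>(x, z, Q). x,
     \<lambda>U s. \<lambda>(x, z, Q) \<in> {(x, z, Q) \<in> fp_points. x \<in> U}.
       frac_at (fp_ring x z) Q (fp_class x z (frag_of (germ X x U s, \<one>\<^bsub>stalk Z z\<^esub>))) \<one>\<^bsub>fp_ring x z\<^esub>)"

definition fp_pr2 :: "(('a, 'b, 'c, 'd) fp_point, ('a, 'b, 'c, 'd) fp_sect, 'c, 'd) rmap" where
  "fp_pr2 = (\<lambda>(x, z, Q). z,
     \<lambda>V t. \<lambda>(x, z, Q) \<in> {(x, z, Q) \<in> fp_points. z \<in> V}.
       frac_at (fp_ring x z) Q (fp_class x z (frag_of (\<one>\<^bsub>stalk X x\<^esub>, germ Z z V t))) \<one>\<^bsub>fp_ring x z\<^esub>)"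

end

subsection \<open>Proper morphisms\<close>

definition locally_of_finite_type ::
    "('a, 'b) rspace \<Rightarrow> ('c, 'd) rspace \<Rightarrow> ('a, 'b, 'c, 'd) rmap \<Rightarrow> bool" where
  "locally_of_finite_type X S f \<longleftrightarrow> (\<forall>x\<in>points X. \<exists>U V.
     affine_open X U \<and> x \<in> U \<and> affine_open S V \<and> fst f ` U \<subseteq> V \<and>
     finite_type_hom (sect S V) (sect X U) (\<lambda>s. res X (preim X f V) U (snd f V s)))"

definition quasi_compact_morphism ::
    "('a, 'b) rspace \<Rightarrow> ('c, 'd) rspace \<Rightarrow> ('a, 'b, 'c, 'd) rmap \<Rightarrow> bool" where
  "quasi_compact_morphism X S f \<longleftrightarrow>
     (\<forall>V. is_open S V \<and> compactin (tops S) V \<longrightarrow> compactin (tops X) (preim X f V))"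

definition separated_morphism ::
    "('a, 'b) rspace \<Rightarrow> ('c, 'd) rspace \<Rightarrow> ('a, 'b, 'c, 'd) rmap \<Rightarrow> bool" where
  "separated_morphism X S f \<longleftrightarrow> (\<exists>\<delta>.
     lrs_morphism X (fibre_product X X S f f) \<delta> \<and>
     rmap_eq X X (rmap_comp (fibre_product X X S f f) (fp_pr1 X X S f f) \<delta>) rmap_id \<and>
     rmap_eq X X (rmap_comp (fibre_product X X S f f) (fp_pr2 X X S f f) \<delta>) rmap_id \<and>
     closed_immersion X (fibre_product X X S f f) \<delta>)"

text \<open>HOL cannot quantify over schemes on all types, so the base changes range over the schemes
  \<open>Z \<rightarrow> S\<close> on the types of spectra of rings with elements in \<open>nat multiset \<Rightarrow> 'd\<close>.  These types
  accommodate every affine space over an affine open \<open>V\<close> of \<open>S\<close> (polynomials over \<open>sect S V\<close> as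
  coefficient functions on monomials), and for quasi-compact \<open>f\<close> closedness of the base changes to
  those already implies closedness of all base changes.\<close>

definition universally_closed ::
    "('a, 'b) rspace \<Rightarrow> ('c, 'd) rspace \<Rightarrow> ('a, 'b, 'c, 'd) rmap \<Rightarrow> bool" where
  "universally_closed X S f \<longleftrightarrow>
     (\<forall>(Z :: ((nat multiset \<Rightarrow> 'd) set, (nat multiset \<Rightarrow> 'd) spec_sect) rspace) g.
        scheme Z \<and> lrs_morphism Z S g \<longrightarrow>
        closed_map (tops (fibre_product X Z S f g)) (tops Z) (fst (fp_pr2 X Z S f g)))"

definition proper_morphism ::
    "('a, 'b) rspace \<Rightarrow> ('c, 'd) rspace \<Rightarrow> ('a, 'b, 'c, 'd) rmap \<Rightarrow> bool" where
  "proper_morphism X S f \<longleftrightarrow> lrs_morphism X S f \<and> separated_morphism X S f \<and>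
     locally_of_finite_type X S f \<and> quasi_compact_morphism X S f \<and> universally_closed X S f"

subsection \<open>Stalks of schemes over a field as algebras\<close>

definition spec_const :: "'r ring \<Rightarrow> 'r \<Rightarrow> 'r spec_sect" where
  "spec_const R a = (\<lambda>P\<in>points (Spec R). frac_at R P a \<one>\<^bsub>R\<^esub>)"

definition stalk_structure_map ::
    "'f ring \<Rightarrow> ('a, 'b) rspace \<Rightarrow> ('a, 'b, 'f set, 'f spec_sect) rmap \<Rightarrow> 'a \<Rightarrow> 'f \<Rightarrow> ('a set \<times> 'b) set" where
  "stalk_structure_map F Y \<pi> y a = germ Y y (points Y) (snd \<pi> (points (Spec F)) (spec_const F a))"

end

theory Submission
  imports Defs "HOL-Algebra.Finite_Extensions"
begin

text \<open>
  The stalk \<open>K\<close> at the generic point is a field, and the bound holds for every extension field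
  \<open>K\<close> of \<open>F\<close>.  If \<open>\<Omega>\<close> is spanned by \<open>dt\<close>, then \<open>F = F\<^sup>p(t)\<close>: for \<open>u\<close> outside \<open>F\<^sup>p(t)\<close>, a subring
  containing \<open>F\<^sup>p(t)\<close> and maximal without \<open>u\<close> carries the derivation \<open>d/du\<close>, which kills \<open>dt\<close> but not
  \<open>du\<close>.  Hence \<open>F\<^bsup>perf\<^esup>\<close> is generated over \<open>F\<close> by the elements \<open>t\<^bsub>j\<^esub> = t\<^bsup>1/p\<^sup>j\<^esup>\<close>, and
  \<open>K \<otimes> F\<^bsup>perf\<^esup>\<close> is the union of the rings \<open>K[X]/(X\<^bsup>q\<^esup> - t)\<close> with \<open>q\<close> a power of \<open>p\<close>.  If \<open>s \<in> K\<close> is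
  a \<open>p\<^sup>j\<close>-th root of \<open>t\<close> that is not a \<open>p\<close>-th power, then \<open>X\<^bsup>q\<^esup> - s\<close> is irreducible over \<open>K\<close>, so that
  the maximal ideal is generated by \<open>t\<^bsub>j\<^esub> - s\<close>.  If there is no such \<open>s\<close>, the maximal ideal equals its
  square.
\<close>

section \<open>Rings of prime characteristic\<close>

text \<open>The tensor product is never identified with a union of quotients of polynomial rings; it
  is controlled through Frobenius powers. Every element has a \<open>p^n\<close>-th power in the
  image of \<open>K\<close>, so it is nilpotent or a unit, and the nilpotent elements form the only
  maximal ideal. Irreducibility of \<open>X^q - s\<close> enters as linear independence: the powers
  \<open>s^i\<close> with \<open>i < q\<close> are independent over the subfield of
  \<open>q\<close>-th powers of \<open>K\<close>. A nilpotent combination of powers of a root of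
  \<open>t\<close>, raised to a large power of \<open>p\<close>, becomes such a relation among the
  \<open>s^i\<close>, so its coefficients vanish. Both this independence and the derivation
  \<open>d/du\<close> rest on one fact: an element outside a subfield that contains all
  \<open>p\<close>-th powers has degree exactly \<open>p\<close> over it. For \<open>d/du\<close>,
  Zorn's lemma replaces the choice of a p-basis: a subring containing all \<open>p\<close>-th powers
  is automatically a field, and if it is maximal without \<open>u\<close>, then adjoining
  \<open>u\<close> gives the whole field, with basis \<open>1, u, ..., u^(p-1)\<close>.\<close>

lemma (in cring) binomial:
  assumes x: "x \<in> carrier R" and y: "y \<in> carrier R"
  shows "(x \<oplus> y) [^] n = (\<Oplus>k\<in>{..n}. [(n choose k)] \<cdot>\<^bsub>R\<^esub> (x [^] k \<otimes> y [^] (n - k)))"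
proof (induction n)
  case 0
  then show ?case using x y by simp
next
  case (Suc n)
  let ?t = "\<lambda>k. x [^] k \<otimes> y [^] (n - k)"
  let ?S = "\<lambda>k. x [^] Suc k \<otimes> y [^] (n - k)"
  have X: "(\<Oplus>k\<in>{..n}. [(n choose k)] \<cdot>\<^bsub>R\<^esub> ?t k) \<otimes> x = (\<Oplus>k\<in>{..n}. [(n choose k)] \<cdot>\<^bsub>R\<^esub> ?S k)"
    using x y by (subst finsum_ldistr) (auto simp: add_pow_ldistr add_pow_rdistr m_ac intro!: finsum_cong')
  have "(\<Oplus>k\<in>{..n}. [(n choose k)] \<cdot>\<^bsub>R\<^esub> ?t k) \<otimes> y
      = (\<Oplus>k\<in>{..n}. [(n choose k)] \<cdot>\<^bsub>R\<^esub> (x [^] k \<otimes> y [^] (Suc n - k)))"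
    using x y by (subst finsum_ldistr) (auto simp: add_pow_ldistr add_pow_rdistr m_ac Suc_diff_le intro!: finsum_cong')
  \<comment> \<open>The term \<open>k = Suc n\<close> may be added because its binomial coefficient
    is zero. Splitting off \<open>k = 0\<close> then shifts the index, so that the sum lines up with
    the one for \<open>x\<close> and Pascal's rule applies termwise.\<close>
  also have "\<dots> = (\<Oplus>k\<in>{..Suc n}. [(n choose k)] \<cdot>\<^bsub>R\<^esub> (x [^] k \<otimes> y [^] (Suc n - k)))"
    using x y by (subst finsum_Suc) (auto simp: binomial_eq_0)
  also have "\<dots> = (\<Oplus>k\<in>{..n}. [(n choose Suc k)] \<cdot>\<^bsub>R\<^esub> ?S k) \<oplus> y [^] Suc n"
    using x y by (subst finsum_Suc2) auto
  finally have Y: "(\<Oplus>k\<in>{..n}. [(n choose k)] \<cdot>\<^bsub>R\<^esub> ?t k) \<otimes> y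
      = (\<Oplus>k\<in>{..n}. [(n choose Suc k)] \<cdot>\<^bsub>R\<^esub> ?S k) \<oplus> y [^] Suc n" .
  have "(x \<oplus> y) [^] Suc n
      = (\<Oplus>k\<in>{..n}. [(n choose k)] \<cdot>\<^bsub>R\<^esub> ?t k) \<otimes> x \<oplus> (\<Oplus>k\<in>{..n}. [(n choose k)] \<cdot>\<^bsub>R\<^esub> ?t k) \<otimes> y"
    using x y Suc by (simp add: r_distr)
  also have "\<dots> = ((\<Oplus>k\<in>{..n}. [(n choose k)] \<cdot>\<^bsub>R\<^esub> ?S k) \<oplus> (\<Oplus>k\<in>{..n}. [(n choose Suc k)] \<cdot>\<^bsub>R\<^esub> ?S k)) \<oplus> y [^] Suc n"
    unfolding X Y using x y by (subst a_assoc) auto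
  also have "\<dots> = (\<Oplus>k\<in>{..n}. [(Suc n choose Suc k)] \<cdot>\<^bsub>R\<^esub> ?S k) \<oplus> y [^] Suc n"
    using x y by (subst finsum_addf[symmetric]) (auto simp: add.nat_pow_mult intro!: finsum_cong')
  also have "\<dots> = (\<Oplus>k\<in>{..Suc n}. [(Suc n choose k)] \<cdot>\<^bsub>R\<^esub> (x [^] k \<otimes> y [^] (Suc n - k)))"
    using x y by (subst finsum_Suc2) auto
  finally show ?case .
qed

text \<open>The zero ring is allowed. Thus the property passes along every ring homomorphism, and
  the Frobenius calculus is available in the tensor product before it is known to be
  nonzero.\<close>

locale char_p_ring = cring R for R (structure) + fixes p :: nat
  assumes prime_p: "Factorial_Ring.prime p" and char_p: "[p] \<cdot>\<^bsub>R\<^esub> \<one> = \<zero>"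
begin

lemma p_pos: "0 < p" using prime_p prime_gt_0_nat by auto

lemma p_mult_zero: assumes "x \<in> carrier R" shows "[(p * n)] \<cdot>\<^bsub>R\<^esub> x = \<zero>"
proof -
  have "[(p * n)] \<cdot>\<^bsub>R\<^esub> x = ([p] \<cdot>\<^bsub>R\<^esub> \<one>) \<otimes> ([n] \<cdot>\<^bsub>R\<^esub> x)"
    using assms by (simp add: add_pow_ldistr add.nat_pow_pow mult.commute)
  then show ?thesis using assms char_p by simp
qed

text \<open>Only the two outer terms of the binomial expansion survive, since \<open>p\<close>
  divides the inner coefficients.\<close>

lemma frobenius_add1:
  assumes x: "x \<in> carrier R" and y: "y \<in> carrier R"
  shows "(x \<oplus> y) [^] p = x [^] p \<oplus> y [^] p"
proof -
  let ?f = "\<lambda>k. [(p choose k)] \<cdot>\<^bsub>R\<^esub> (x [^] k \<otimes> y [^] (p - k))"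
  have z: "?f k = \<zero>" if "k \<in> {..p} - {0, p}" for k
  proof -
    have "p dvd (p choose k)" using that prime_p by (intro dvd_choose_prime) auto
    then show ?thesis using x y p_mult_zero by auto
  qed
  have "(x \<oplus> y) [^] p = (\<Oplus>k\<in>{..p}. ?f k)" by (rule binomial[OF x y])
  also have "\<dots> = (\<Oplus>k\<in>{0, p}. ?f k)"
    by (rule add.finprod_mono_neutral_cong_right) (use z x y in auto)
  also have "\<dots> = x [^] p \<oplus> y [^] p"
    using x y p_pos by (simp add: a_comm)
  finally show ?thesis .
qed

lemma frobenius_add:
  assumes x: "x \<in> carrier R" and y: "y \<in> carrier R"
  shows "(x \<oplus> y) [^] (p ^ n) = x [^] (p ^ n) \<oplus> y [^] (p ^ n)"
proof (induction n)
  case (Suc n)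
  have "(x \<oplus> y) [^] (p ^ Suc n) = ((x \<oplus> y) [^] (p ^ n)) [^] p"
    using x y by (simp add: nat_pow_pow mult.commute)
  also have "\<dots> = (x [^] (p ^ n)) [^] p \<oplus> (y [^] (p ^ n)) [^] p"
    using x y Suc frobenius_add1 by simp
  finally show ?case using x y by (simp add: nat_pow_pow mult.commute)
qed (use x y in simp)

lemma frobenius_zero: "\<zero> [^] (p ^ n) = \<zero>"
  using p_pos by (simp add: nat_pow_zero)

text \<open>Derived from additivity at \<open>x\<close> and its negative, so that the parity of
  \<open>p\<close> never has to be discussed.\<close>

lemma frobenius_minus:
  assumes x: "x \<in> carrier R"
  shows "(\<ominus> x) [^] (p ^ n) = \<ominus> (x [^] (p ^ n))"
  using frobenius_add[OF x a_inv_closed[OF x], of n] x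
  by (metis a_inv_closed frobenius_zero minus_equality nat_pow_closed r_neg a_comm)

lemma frobenius_diff:
  assumes x: "x \<in> carrier R" and y: "y \<in> carrier R"
  shows "(x \<ominus> y) [^] (p ^ n) = x [^] (p ^ n) \<ominus> y [^] (p ^ n)"
  using assms by (simp add: a_minus_def frobenius_add frobenius_minus)

lemma frobenius_finsum:
  assumes "finite A" "f \<in> A \<rightarrow> carrier R"
  shows "(\<Oplus>i\<in>A. f i) [^] (p ^ n) = (\<Oplus>i\<in>A. f i [^] (p ^ n))"
  using assms
proof (induction A rule: finite_induct)
  case empty
  then show ?case by (simp add: frobenius_zero)
next
  case (insert a A)
  then show ?case
    by (subst finsum_insert; (subst finsum_insert)?) (auto simp: frobenius_add Pi_iff)
qed

end

lemma char_p_ring_hom: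
  assumes "char_p_ring R p" "cring S" "h \<in> ring_hom R S"
  shows "char_p_ring S p"
proof -
  interpret R: char_p_ring R p by fact
  interpret S: cring S by fact
  interpret h: ring_hom_ring R S h
    using assms by (intro ring_hom_ringI2 R.ring_axioms S.ring_axioms)
  have "h ([n] \<cdot>\<^bsub>R\<^esub> x) = [n] \<cdot>\<^bsub>S\<^esub> h x" if "x \<in> carrier R" for n :: nat and x
    using that by (induction n) auto
  from this[of "\<one>\<^bsub>R\<^esub>" p] have "[p] \<cdot>\<^bsub>S\<^esub> \<one>\<^bsub>S\<^esub> = \<zero>\<^bsub>S\<^esub>"
    using R.char_p by simp
  then show ?thesis
    by (intro char_p_ring.intro S.is_cring char_p_ring_axioms.intro R.prime_p)
qed

text \<open>Only the carrier of \<open>univ_poly R K\<close> depends on \<open>K\<close>; product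
  and unit do not. Hence a power formed over the subfield is also the power formed over the whole
  field.\<close>

lemma nat_pow_univ_poly_consistent:
  "x [^]\<^bsub>univ_poly R K\<^esub> (n :: nat) = x [^]\<^bsub>univ_poly R L\<^esub> n"
  by (simp add: nat_pow_def univ_poly_def)

locale char_p_field = field R + char_p_ring R p for R (structure) and p
begin

lemma frobenius_eq_zero_iff:
  assumes "x \<in> carrier R" shows "x [^] (p ^ n) = \<zero> \<longleftrightarrow> x = \<zero>"
proof
  have "x [^] m = \<zero> \<Longrightarrow> x = \<zero>" for m :: nat
    using assms by (induction m) (auto dest: integral)
  then show "x [^] (p ^ n) = \<zero> \<Longrightarrow> x = \<zero>" by blast
qed (use frobenius_zero in simp)

lemma frobenius_inj:
  assumes "x \<in> carrier R" "y \<in> carrier R" "x [^] (p ^ n) = y [^] (p ^ n)"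
  shows "x = y"
proof -
  have "(x \<ominus> y) [^] (p ^ n) = \<zero>"
    using assms by (simp add: frobenius_diff r_right_minus_eq)
  then have "x \<ominus> y = \<zero>" using assms frobenius_eq_zero_iff by blast
  then show ?thesis using assms by simp
qed

end

text \<open>The polynomial \<open>X\<^sup>p - u\<^sup>p\<close> factors as \<open>f\<^sup>k g\<close> over \<open>K\<close> with \<open>f\<close> the minimal polynomial of \<open>u\<close>
  and \<open>g(u) \<noteq> 0\<close>.  Over the big field it is \<open>(X - u)\<^sup>p\<close>, so \<open>g\<close> is constant and
  \<open>p = k \<cdot> deg f\<close>.\<close>

lemma (in char_p_field) degree_Irr_eq_p:
  assumes K: "subfield K R" and pow: "\<And>x. x \<in> carrier R \<Longrightarrow> x [^] p \<in> K"
    and u: "u \<in> carrier R" and uK: "u \<notin> K"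
  shows "(algebraic over K) u" "degree (Irr K u) = p"
proof -
  let ?P = "poly_ring R" and ?K = "K[X]"
  have Ks: "subring K R" using K by (rule subfieldE)
  interpret UP: domain ?P by (rule univ_poly_is_domain[OF carrier_is_subring])
  interpret UK: domain ?K by (rule univ_poly_is_domain[OF Ks])
  interpret P: char_p_ring ?P p
    using canonical_embedding_is_hom[OF carrier_is_subring]
    by (intro char_p_ring_hom[OF char_p_ring_axioms UP.is_cring, of poly_of_const]) simp
  define a where "a = \<ominus> (u [^] p)"
  have aK: "a \<in> K" unfolding a_def using Ks pow[OF u] by (simp add: subringE(5))
  have aR: "a \<in> carrier R" unfolding a_def using u by simp
  define V where "V = [\<one>, \<ominus> u]"
  have V: "V \<in> carrier ?P" unfolding V_def univ_poly_carrier[symmetric] polynomial_def using u by auto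
  have V_eq: "V = X \<oplus>\<^bsub>?P\<^esub> poly_of_const (\<ominus> u)"
    using u unfolding V_def var_def poly_of_const_def univ_poly_add by (auto simp: Let_def)
  define Q where "Q = X [^]\<^bsub>?K\<^esub> p \<oplus>\<^bsub>?K\<^esub> poly_of_const a"
  have XK: "X \<in> carrier ?K" and XP: "X \<in> carrier ?P" using var_closed Ks carrier_is_subring by auto
  have cK: "poly_of_const c \<in> carrier ?K" if "c \<in> K" for c
    using canonical_embedding_is_hom[OF Ks] that ring_hom_memE(1) by fastforce
  have cP: "poly_of_const c \<in> carrier ?P" if "c \<in> carrier R" for c
    using canonical_embedding_is_hom[OF carrier_is_subring] that ring_hom_memE(1) by fastforce
  have QK: "Q \<in> carrier ?K" unfolding Q_def using XK cK[OF aK] by simp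
  have cpow: "poly_of_const c [^]\<^bsub>?P\<^esub> n = poly_of_const (c [^] n)" if "c \<in> carrier R" for c and n :: nat
  proof (induction n)
    case 0
    then show ?case using ring_hom_one[OF canonical_embedding_is_hom[OF carrier_is_subring]] by simp
  next
    case (Suc n)
    then show ?case using ring_hom_mult[OF canonical_embedding_is_hom[OF carrier_is_subring]] that by simp
  qed
  have minus_pow: "(\<ominus> u) [^] p = a" unfolding a_def using frobenius_minus[OF u, of 1] by simp
  have "V [^]\<^bsub>?P\<^esub> p = X [^]\<^bsub>?P\<^esub> p \<oplus>\<^bsub>?P\<^esub> poly_of_const (\<ominus> u) [^]\<^bsub>?P\<^esub> p"
    unfolding V_eq using P.frobenius_add1[OF XP cP] u by simp
  also have "\<dots> = Q"
    unfolding Q_def using cpow[of "\<ominus> u" p] u minus_pow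
    by (simp add: nat_pow_univ_poly_consistent[where K = K and L = "carrier R"] univ_poly_add)
  finally have VQ: "V [^]\<^bsub>?P\<^esub> p = Q" .
  have degQ: "degree Q = p"
    using polynomial_pow_degree[OF V, of p] unfolding VQ by (simp add: V_def)
  then have Q0: "Q \<noteq> []" using p_pos by auto
  interpret ev: ring_hom_ring ?K R "\<lambda>q. eval q u" by (rule eval_ring_hom[OF Ks u])
  interpret evP: ring_hom_ring ?P R "\<lambda>q. eval q u" by (rule eval_ring_hom[OF carrier_is_subring u])
  have "eval V u = \<zero>" unfolding V_def using u by (simp add: r_neg)
  then have Qu: "eval Q u = \<zero>"
    unfolding VQ[symmetric] using V p_pos by (simp add: evP.hom_nat_pow nat_pow_zero)
  show alg: "(algebraic over K) u" by (rule algebraicI[OF QK Q0 Qu])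
  define f where "f = Irr K u"
  note f = IrrE[OF K u alg, folded f_def]
  have f0: "f \<noteq> []" using pirreducibleE(1)[OF Ks f(1,2)] .
  have fnz: "f \<noteq> \<zero>\<^bsub>?K\<^esub>" using f0 by (simp add: univ_poly_zero)
  have df: "degree f \<ge> 1"
  proof (rule ccontr)
    assume "\<not> degree f \<ge> 1"
    then obtain c where c: "f = [c]" using f0 by (cases f; cases "tl f") auto
    then have "eval f u = \<one>" using f(3) u by simp
    then show False using f(4) by simp
  qed
  \<comment> \<open>The exponents \<open>k\<close> for which \<open>f^k\<close> divides
    \<open>Q\<close>. They are bounded by \<open>p\<close> because \<open>f\<close> has positive
    degree, so there is a largest one; its cofactor \<open>g\<close> is not divisible by
    \<open>f\<close> and therefore does not vanish at \<open>u\<close>.\<close>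
  define S where "S = {k :: nat. \<exists>g \<in> carrier ?K. Q = f [^]\<^bsub>?K\<^esub> k \<otimes>\<^bsub>?K\<^esub> g}"
  have degmult: "degree (x \<otimes>\<^bsub>?K\<^esub> y) = degree x + degree y"
    if "x \<in> carrier ?K" "y \<in> carrier ?K" "x \<otimes>\<^bsub>?K\<^esub> y \<noteq> []" for x y
    using that poly_mult_degree_eq[OF Ks] UK.l_null UK.r_null
    by (auto simp: univ_poly_mult univ_poly_carrier univ_poly_zero split: if_splits)
  have deg: "p = k * degree f + degree g" if "g \<in> carrier ?K" "Q = f [^]\<^bsub>?K\<^esub> k \<otimes>\<^bsub>?K\<^esub> g" for k :: nat and g
    using degmult[of "f [^]\<^bsub>?K\<^esub> k" g] that f(1) degQ Q0 subring_polynomial_pow_degree[OF Ks f(1), of k]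
    by auto
  have fin: "finite S"
  proof (rule finite_subset)
    have "k \<le> p" if "k \<in> S" for k
    proof -
      obtain g where "g \<in> carrier ?K" "Q = f [^]\<^bsub>?K\<^esub> k \<otimes>\<^bsub>?K\<^esub> g" using \<open>k \<in> S\<close> unfolding S_def by auto
      then have "p = k * degree f + degree g" by (rule deg)
      moreover have "k \<le> k * degree f" using df by (cases "degree f") auto
      ultimately show ?thesis by linarith
    qed
    then show "S \<subseteq> {..p}" by auto
  qed simp
  have "0 \<in> S" unfolding S_def using QK by auto
  then have kS: "Max S \<in> S" using fin Max_in by blast
  define k where "k = Max S"
  obtain g where g: "g \<in> carrier ?K" "Q = f [^]\<^bsub>?K\<^esub> k \<otimes>\<^bsub>?K\<^esub> g" using kS unfolding S_def k_def by auto
  have gu: "eval g u \<noteq> \<zero>"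
  proof
    assume "eval g u = \<zero>"
    then have "f pdivides g" unfolding f_def by (rule Irr_minimal[OF K u alg g(1)])
    then have "f divides\<^bsub>?K\<^esub> g" using pdivides_iff_shell[OF K f(1) g(1)] by simp
    then obtain h where h: "h \<in> carrier ?K" "g = f \<otimes>\<^bsub>?K\<^esub> h" unfolding factor_def by auto
    have "Q = f [^]\<^bsub>?K\<^esub> Suc k \<otimes>\<^bsub>?K\<^esub> h"
      unfolding g(2) h(2) using UK.m_assoc[OF UK.nat_pow_closed[OF f(1), of k] f(1) h(1)]
      by (simp only: UK.nat_pow_Suc)
    then have "Suc k \<in> S" unfolding S_def using h by blast
    then show False using Max_ge[OF fin, of "Suc k"] k_def by simp
  qed
  have g0: "g \<noteq> []" using gu by auto
  have gP: "g \<in> carrier ?P" and fP: "f \<in> carrier ?P"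
    using carrier_polynomial_shell[OF Ks] g f by auto
  have Vg: "\<not> V pdivides g"
  proof
    assume "V pdivides g"
    then have "is_root g u" using pdivides_imp_is_root[OF g0 u] unfolding V_def by simp
    then show False using gu unfolding is_root_def by simp
  qed
  have fk_eq: "f [^]\<^bsub>?K\<^esub> k = f [^]\<^bsub>?P\<^esub> k" by (rule nat_pow_univ_poly_consistent)
  have VQ': "V [^]\<^bsub>?P\<^esub> p = g \<otimes>\<^bsub>?P\<^esub> f [^]\<^bsub>?P\<^esub> k"
    using g UK.m_comm[OF UK.nat_pow_closed[OF f(1), of k] g(1)] unfolding VQ fk_eq
    by (simp add: univ_poly_mult)
  have fk: "f [^]\<^bsub>?P\<^esub> k \<in> carrier ?P" using fP by simp
  have irr: "pirreducible (carrier R) V"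
    by (rule degree_one_imp_pirreducible[OF carrier_is_subfield V]) (simp add: V_def)
  have "V [^]\<^bsub>?P\<^esub> p pdivides (g \<otimes>\<^bsub>?P\<^esub> f [^]\<^bsub>?P\<^esub> k)"
    unfolding VQ'[symmetric] pdivides_def using V by (intro UP.divides_refl) simp
  \<comment> \<open>The irreducible \<open>V\<close> does not divide \<open>g\<close>, so all
    \<open>p\<close> factors \<open>V\<close> go into \<open>f^k\<close>. This gives
    \<open>p \<le> k * degree f\<close>, and comparison with
    \<open>p = k * degree f + degree g\<close> leaves nothing for \<open>g\<close>.\<close>
  then have dvd: "V [^]\<^bsub>?P\<^esub> p pdivides (f [^]\<^bsub>?P\<^esub> k)"
    using pirreducible_pow_pdivides_iff[OF carrier_is_subfield V gP fk irr Vg, of p] by simp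
  have "p \<le> k * degree f"
  proof -
    have "f [^]\<^bsub>?P\<^esub> k \<noteq> []" using polynomial_pow_not_zero[OF fP f0] .
    then have "degree (V [^]\<^bsub>?P\<^esub> p) \<le> degree (f [^]\<^bsub>?P\<^esub> k)"
      using pdivides_imp_degree_le[OF carrier_is_subring _ fk _ dvd] V by simp
    then show ?thesis using polynomial_pow_degree[OF V, of p] polynomial_pow_degree[OF fP, of k]
      by (simp add: V_def)
  qed
  then have "p = k * degree f" using deg[OF g] by linarith
  then have "degree f = 1 \<or> degree f = p"
    using prime_p by (metis dvd_triv_right prime_nat_iff)
  moreover have "degree f \<noteq> 1"
  proof
    assume "degree f = 1"
    then obtain c d where cd: "f = [c, d]" by (cases f; cases "tl f"; cases "tl (tl f)") auto
    have c: "c = \<one>" using f(3) cd by simp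
    have d: "d \<in> K" using f(1) cd unfolding univ_poly_carrier[symmetric] polynomial_def by simp
    then have dR: "d \<in> carrier R" using subringE(1)[OF Ks] by auto
    have "u \<oplus> d = \<zero>" using f(4) cd c u dR by simp
    then have "u = \<ominus> d" using u dR by (metis add.inv_equality)
    then show False using uK d subringE(5)[OF Ks] by simp
  qed
  ultimately show "degree (Irr K u) = p" unfolding f_def by simp
qed

section \<open>Sums over initial segments and over digits\<close>

lemma (in ring) finsum_lessThan_Suc:
  assumes "f \<in> {..<Suc n} \<rightarrow> carrier R"
  shows "(\<Oplus>i\<in>{..<Suc n}. f i) = (\<Oplus>i\<in>{..<n}. f i) \<oplus> f n"
  using assms unfolding lessThan_Suc by (subst finsum_insert) (auto simp: Pi_iff a_comm finsum_closed)

lemma (in ring) finsum_add_lessThan: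
  fixes m n :: nat
  assumes "f \<in> {..<m + n} \<rightarrow> carrier R"
  shows "(\<Oplus>i\<in>{..<m + n}. f i) = (\<Oplus>i\<in>{..<m}. f i) \<oplus> (\<Oplus>i\<in>{..<n}. f (m + i))"
  using assms
proof (induction n)
  case (Suc n)
  have "(\<Oplus>i\<in>{..<m + Suc n}. f i) = (\<Oplus>i\<in>{..<m + n}. f i) \<oplus> f (m + n)"
    using finsum_lessThan_Suc[of f "m + n"] Suc.prems by simp
  also have "(\<Oplus>i\<in>{..<m + n}. f i) = (\<Oplus>i\<in>{..<m}. f i) \<oplus> (\<Oplus>i\<in>{..<n}. f (m + i))"
    using Suc by (auto simp: Pi_iff)
  also have "\<dots> \<oplus> f (m + n) = (\<Oplus>i\<in>{..<m}. f i) \<oplus> ((\<Oplus>i\<in>{..<n}. f (m + i)) \<oplus> f (m + n))"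
    using Suc.prems by (intro a_assoc finsum_closed) (auto simp: Pi_iff)
  also have "(\<Oplus>i\<in>{..<n}. f (m + i)) \<oplus> f (m + n) = (\<Oplus>i\<in>{..<Suc n}. f (m + i))"
    using Suc.prems by (intro finsum_lessThan_Suc[symmetric]) (auto simp: Pi_iff)
  finally show ?case .
qed (simp add: Pi_iff)

text \<open>Division with remainder by \<open>m\<close>, with remainder \<open>i\<close> and
  quotient \<open>j\<close>. For \<open>m = p\<close> it separates the lowest digit of an exponent
  in base \<open>p\<close> from the others.\<close>

lemma (in ring) finsum_mult_lessThan:
  fixes m n :: nat
  assumes "f \<in> {..<m * n} \<rightarrow> carrier R"
  shows "(\<Oplus>i\<in>{..<m * n}. f i) = (\<Oplus>i\<in>{..<m}. \<Oplus>j\<in>{..<n}. f (i + m * j))"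
  using assms
proof (induction n)
  case (Suc n)
  have *: "i + m * j < m * Suc n" if "i < m" "j < Suc n" for i j
  proof -
    have "i + m * j < m * (j + 1)" using that by simp
    also have "\<dots> \<le> m * Suc n" using that by (intro mult_left_mono) auto
    finally show ?thesis .
  qed
  then have f: "f (i + m * j) \<in> carrier R" if "i < m" "j < Suc n" for i j
    using Suc.prems that by auto
  have "(\<Oplus>i\<in>{..<m * Suc n}. f i) = (\<Oplus>i\<in>{..<m * n}. f i) \<oplus> (\<Oplus>i\<in>{..<m}. f (m * n + i))"
    using finsum_add_lessThan[of f "m * n" m] Suc.prems by (simp add: add.commute)
  also have "(\<Oplus>i\<in>{..<m * n}. f i) = (\<Oplus>i\<in>{..<m}. \<Oplus>j\<in>{..<n}. f (i + m * j))"
    using Suc by (auto simp: Pi_iff)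
  also have "\<dots> \<oplus> (\<Oplus>i\<in>{..<m}. f (m * n + i))
      = (\<Oplus>i\<in>{..<m}. (\<Oplus>j\<in>{..<n}. f (i + m * j)) \<oplus> f (i + m * n))"
    using f by (subst finsum_addf) (auto simp: add.commute intro!: finsum_closed)
  also have "\<dots> = (\<Oplus>i\<in>{..<m}. \<Oplus>j\<in>{..<Suc n}. f (i + m * j))"
    using f by (intro finsum_cong') (auto intro!: finsum_lessThan_Suc[symmetric] finsum_closed)
  finally show ?case .
qed simp

section \<open>Subfields that contain all \<open>p\<close>-th powers\<close>

context char_p_field
begin

text \<open>Inverses come for free: the inverse of \<open>k\<close> is \<open>k^(p-1)\<close> times
  the \<open>p\<close>-th power of that inverse, and both factors lie in \<open>M\<close>.\<close>

lemma subfield_of_pth_powers: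
  assumes M: "subring M R" and pow: "\<And>x. x \<in> carrier R \<Longrightarrow> x [^] p \<in> M"
  shows "subfield M R"
proof (rule subfieldI'[OF M])
  fix k assume k: "k \<in> M - {\<zero>}"
  then have kR: "k \<in> carrier R" "k \<noteq> \<zero>" using subringE(1)[OF M] by auto
  then have kU: "k \<in> Units R" using field_Units by auto
  have powM: "k [^] (n :: nat) \<in> M" for n
    using k by (induction n) (auto intro: subringE[OF M])
  have "inv k = k [^] (p - 1) \<otimes> (inv k) [^] p"
  proof -
    have "(inv k) [^] p = (inv k) [^] (p - 1) \<otimes> inv k"
      using p_pos by (metis Suc_diff_1 nat_pow_Suc)
    moreover have "k [^] (p - 1) \<otimes> (inv k) [^] (p - 1) = \<one>"
      using kU kR by (metis Units_inv_closed Units_r_inv nat_pow_distrib nat_pow_one)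
    ultimately show ?thesis
      using kU kR by (simp add: m_assoc[symmetric])
  qed
  moreover have "k [^] (p - 1) \<otimes> (inv k) [^] p \<in> M"
    using kU by (intro subringE(6)[OF M] powM pow) simp
  ultimately show "inv k \<in> M" by (simp only:)
qed

lemma pth_powers_subfield: "subfield ((\<lambda>x. x [^] p) ` carrier R) R"
proof (rule subfield_of_pth_powers[OF subringI])
  show "(\<lambda>x. x [^] p) ` carrier R \<subseteq> carrier R" by auto
  show "\<one> \<in> (\<lambda>x. x [^] p) ` carrier R" by (rule image_eqI[of _ _ \<one>]) auto
  fix h assume "h \<in> (\<lambda>x. x [^] p) ` carrier R"
  then obtain x where x: "x \<in> carrier R" "h = x [^] p" by auto
  show "\<ominus> h \<in> (\<lambda>x. x [^] p) ` carrier R"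
    using x frobenius_minus[of x 1] by (intro image_eqI[of _ _ "\<ominus> x"]) auto
next
  fix h1 h2 assume "h1 \<in> (\<lambda>x. x [^] p) ` carrier R" "h2 \<in> (\<lambda>x. x [^] p) ` carrier R"
  then obtain x y where x: "x \<in> carrier R" "h1 = x [^] p" "y \<in> carrier R" "h2 = y [^] p" by auto
  show "h1 \<otimes> h2 \<in> (\<lambda>x. x [^] p) ` carrier R"
    using x by (intro image_eqI[of _ _ "x \<otimes> y"]) (auto simp: nat_pow_distrib)
  show "h1 \<oplus> h2 \<in> (\<lambda>x. x [^] p) ` carrier R"
    using x by (intro image_eqI[of _ _ "x \<oplus> y"]) (auto simp: frobenius_add1)
qed auto

text \<open>Polynomials are coefficient lists with the leading coefficient in front, hence the
  reversal.\<close>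

lemma eval_rev_map:
  assumes "u \<in> carrier R" "m \<in> {..<n} \<rightarrow> carrier R"
  shows "eval (rev (map m [0..<n])) u = (\<Oplus>i\<in>{..<n}. m i \<otimes> u [^] i)"
  using assms(2)
proof (induction n)
  case (Suc n)
  have "eval (rev (map m [0..<Suc n])) u = m n \<otimes> u [^] n \<oplus> eval (rev (map m [0..<n])) u"
    by simp
  also have "\<dots> = (\<Oplus>i\<in>{..<n}. m i \<otimes> u [^] i) \<oplus> m n \<otimes> u [^] n"
    using Suc assms(1) by (subst a_comm) (auto intro!: finsum_closed simp: Pi_iff)
  also have "\<dots> = (\<Oplus>i\<in>{..<Suc n}. m i \<otimes> u [^] i)"
    using Suc assms(1) by (intro finsum_lessThan_Suc[symmetric]) (auto simp: Pi_iff)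
  finally show ?case .
qed simp

context
  fixes K u
  assumes K: "subfield K R" and pow: "\<And>x. x \<in> carrier R \<Longrightarrow> x [^] p \<in> K"
    and u: "u \<in> carrier R" and uK: "u \<notin> K"
begin

text \<open>A nontrivial relation would be a polynomial of degree below \<open>p\<close> that
  vanishes at \<open>u\<close>, whereas the minimal polynomial of \<open>u\<close> has degree
  \<open>p\<close>.\<close>

lemma powers_independent:
  assumes m: "\<And>i. i < p \<Longrightarrow> m i \<in> K" and z: "(\<Oplus>i\<in>{..<p}. m i \<otimes> u [^] i) = \<zero>" and i: "i < p"
  shows "m i = \<zero>"
proof -
  note Irr = degree_Irr_eq_p[OF K pow u uK]
  have mR: "m \<in> {..<p} \<rightarrow> carrier R" using m subringE(1)[OF subfieldE(1)[OF K]] by auto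
  let ?Ks = "rev (map m [0..<p])"
  have "combine ?Ks (exp_base u (length ?Ks)) = \<zero>"
    unfolding combine_eq_eval eval_rev_map[OF u mR] by (rule z)
  moreover have "independent K (exp_base u p)"
    using exp_base_independent[OF K u Irr(1)] Irr(2) by metis
  ultimately have "set (take (length (exp_base u p)) ?Ks) \<subseteq> {\<zero>}" using m
    by (intro independent_imp_trivial_combine[OF K]) auto
  then show ?thesis using i by (auto simp: exp_base_def image_subset_iff)
qed

lemma simple_extension_eq_combinations:
  assumes "x \<in> simple_extension K u"
  obtains m where "\<And>i. i < p \<Longrightarrow> m i \<in> K" "x = (\<Oplus>i\<in>{..<p}. m i \<otimes> u [^] i)"
proof -
  note Irr = degree_Irr_eq_p[OF K pow u uK]
  have "x \<in> Span K (exp_base u p)" using Span_exp_base[OF K u Irr(1)] assms Irr(2) by simp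
  then obtain Ks where Ks: "length Ks = p" "set Ks \<subseteq> K" "x = combine Ks (exp_base u p)"
    unfolding Span_eq_combine_set_length_version[OF K exp_base_closed[OF u]]
    by (auto simp: exp_base_def)
  define m where "m i = rev Ks ! i" for i
  have mK: "m i \<in> K" if "i < p" for i
    using that Ks nth_mem[of i "rev Ks"] unfolding m_def by auto
  have "Ks = rev (map m [0..<p])"
    using map_nth[of "rev Ks"] Ks(1) unfolding m_def by (simp add: rev_swap)
  then have "x = eval (rev (map m [0..<p])) u"
    using Ks combine_eq_eval[of Ks u] by simp
  also have "\<dots> = (\<Oplus>i\<in>{..<p}. m i \<otimes> u [^] i)"
    using mK subringE(1)[OF subfieldE(1)[OF K]] by (intro eval_rev_map[OF u]) auto
  finally show thesis using that mK by blast
qed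

text \<open>The powers of \<open>u\<close> are \<open>p\<close> independent elements of the
  extension by \<open>v\<close>, which has dimension \<open>p\<close>, so they span it. This is the
  exchange property needed for maximal subrings.\<close>

lemma simple_extension_eqI:
  assumes v: "v \<in> carrier R" "v \<notin> K" "u \<in> simple_extension K v"
  shows "simple_extension K u = simple_extension K v"
proof -
  note Iu = degree_Irr_eq_p[OF K pow u uK] and Iv = degree_Irr_eq_p[OF K pow v(1,2)]
  note Ks = subfieldE(1)[OF K]
  have sub: "subring (simple_extension K v) R" by (rule simple_extension_is_subring[OF Ks v(1)])
  have "u [^] i \<in> simple_extension K v" for i :: nat
    using v(3) subringE(3,6)[OF sub] by (induction i) auto
  then have "set (exp_base u p) \<subseteq> simple_extension K v" unfolding exp_base_def by auto
  then have "Span K (exp_base u p) = simple_extension K v"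
    using independent_length_eq_dimension[OF K dimension_simple_extension[OF K v(1) Iv(1)]
        exp_base_independent[OF K u Iu(1)]] Iu(2) Iv(2)
    by (simp add: exp_base_def)
  then show ?thesis using Span_exp_base[OF K u Iu(1)] Iu(2) by simp
qed

end

text \<open>Writing an exponent as \<open>k + p * j\<close> and pulling one Frobenius out of the sum
  over \<open>j\<close> turns an expression in \<open>p^(r+1)\<close>-th powers into one in
  \<open>p\<close>-th powers whose bases are expressions in \<open>p^r\<close>-th powers. Both
  inductions on the exponent below run on this.\<close>

lemma iterated_powers_digits:
  assumes s: "s \<in> carrier R" and b: "\<And>i. i < p ^ Suc r \<Longrightarrow> b i \<in> carrier R"
  shows "(\<Oplus>i\<in>{..<p ^ Suc r}. b i [^] (p ^ Suc r) \<otimes> s [^] i)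
    = (\<Oplus>k\<in>{..<p}. (\<Oplus>j\<in>{..<p ^ r}. b (k + p * j) [^] (p ^ r) \<otimes> s [^] j) [^] p \<otimes> s [^] k)"
    and "\<And>k j. \<lbrakk>k < p; j < p ^ r\<rbrakk> \<Longrightarrow> b (k + p * j) \<in> carrier R"
proof -
  have less: "k + p * j < p ^ Suc r" if "k < p" "j < p ^ r" for k j
  proof -
    have "k + p * j < p * (j + 1)" using that by simp
    also have "\<dots> \<le> p * p ^ r" using that by (intro mult_left_mono) auto
    finally show ?thesis by simp
  qed
  then show bR: "b (k + p * j) \<in> carrier R" if "k < p" "j < p ^ r" for k j
    using b that by blast
  have "(\<Oplus>i\<in>{..<p ^ Suc r}. b i [^] (p ^ Suc r) \<otimes> s [^] i)
      = (\<Oplus>k\<in>{..<p}. \<Oplus>j\<in>{..<p ^ r}. b (k + p * j) [^] (p ^ Suc r) \<otimes> s [^] (k + p * j))"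
    using finsum_mult_lessThan[of "\<lambda>i. b i [^] (p ^ Suc r) \<otimes> s [^] i" p "p ^ r"] b s
    by (auto simp: Pi_iff)
  also have "\<dots> = (\<Oplus>k\<in>{..<p}. (\<Oplus>j\<in>{..<p ^ r}. b (k + p * j) [^] (p ^ r) \<otimes> s [^] j) [^] p \<otimes> s [^] k)"
  proof (intro finsum_cong')
    fix k assume "k \<in> {..<p}"
    then have k: "k < p" by simp
    let ?f = "\<lambda>j. b (k + p * j) [^] (p ^ r) \<otimes> s [^] j"
    have "(\<Oplus>j\<in>{..<p ^ r}. ?f j) [^] p \<otimes> s [^] k = (\<Oplus>j\<in>{..<p ^ r}. ?f j [^] p \<otimes> s [^] k)"
      using frobenius_finsum[of "{..<p ^ r}" ?f 1] bR[OF k] s by (simp add: finsum_ldistr Pi_iff)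
    also have "\<dots> = (\<Oplus>j\<in>{..<p ^ r}. b (k + p * j) [^] (p ^ Suc r) \<otimes> s [^] (k + p * j))"
    proof (intro finsum_cong')
      fix j assume "j \<in> {..<p ^ r}"
      then have bj: "b (k + p * j) \<in> carrier R" using bR[OF k] by simp
      have "?f j [^] p \<otimes> s [^] k = b (k + p * j) [^] (p ^ r * p) \<otimes> (s [^] (j * p) \<otimes> s [^] k)"
        using bj s by (simp add: nat_pow_distrib nat_pow_pow m_assoc)
      then show "?f j [^] p \<otimes> s [^] k = b (k + p * j) [^] (p ^ Suc r) \<otimes> s [^] (k + p * j)"
        using s by (simp add: nat_pow_mult mult.commute add.commute)
    qed (use bR[OF k] s in auto)
    finally show "(\<Oplus>j\<in>{..<p ^ r}. b (k + p * j) [^] (p ^ Suc r) \<otimes> s [^] (k + p * j))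
      = (\<Oplus>j\<in>{..<p ^ r}. ?f j) [^] p \<otimes> s [^] k" by simp
  qed (use bR s in \<open>auto intro!: finsum_closed\<close>)
  finally show "(\<Oplus>i\<in>{..<p ^ Suc r}. b i [^] (p ^ Suc r) \<otimes> s [^] i)
    = (\<Oplus>k\<in>{..<p}. (\<Oplus>j\<in>{..<p ^ r}. b (k + p * j) [^] (p ^ r) \<otimes> s [^] j) [^] p \<otimes> s [^] k)" .
qed

text \<open>After a Frobenius this says that \<open>X^q - s\<close> with \<open>q = p^r\<close> is
  irreducible. In the induction, the relation between the digits has \<open>p\<close>-th powers as
  coefficients, which vanish because \<open>s\<close> lies outside the subfield of
  \<open>p\<close>-th powers. Injectivity of the Frobenius removes the power and leaves relations of
  the same kind for \<open>r\<close>.\<close>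

lemma iterated_powers_independent:
  assumes s: "s \<in> carrier R" "s \<notin> (\<lambda>x. x [^] p) ` carrier R"
    and b: "\<And>i. i < p ^ r \<Longrightarrow> b i \<in> carrier R"
    and z: "(\<Oplus>i\<in>{..<p ^ r}. b i [^] (p ^ r) \<otimes> s [^] i) = \<zero>" and i: "i < p ^ r"
  shows "b i = \<zero>"
  using b z i
proof (induction r arbitrary: b i)
  case 0
  then show ?case using s by (simp add: Pi_iff lessThan_Suc)
next
  case (Suc r)
  have bR: "b (k + p * j) \<in> carrier R" if "k < p" "j < p ^ r" for k j
    using iterated_powers_digits(2)[of s r b] s(1) Suc.prems(1) that by blast
  define c where "c k = (\<Oplus>j\<in>{..<p ^ r}. b (k + p * j) [^] (p ^ r) \<otimes> s [^] j)" for k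
  have c: "c k \<in> carrier R" if "k < p" for k
    unfolding c_def using bR that s by (intro finsum_closed) auto
  have z: "(\<Oplus>k\<in>{..<p}. c k [^] p \<otimes> s [^] k) = \<zero>"
    using iterated_powers_digits(1)[OF s(1) Suc.prems(1)] Suc.prems(2) unfolding c_def by simp
  have "c k [^] p = \<zero>" if "k < p" for k
    by (rule powers_independent[OF pth_powers_subfield _ s _ z that]) (use c in auto)
  then have c0: "c k = \<zero>" if "k < p" for k
    using frobenius_eq_zero_iff[of "c k" 1] c that by simp
  have k: "i mod p < p" using p_pos by simp
  have j: "i div p < p ^ r" using Suc.prems(3) by (simp add: less_mult_imp_div_less mult.commute)
  have "b (i mod p + p * (i div p)) = \<zero>"
    using Suc.IH[of "\<lambda>j. b (i mod p + p * j)" "i div p"] bR[OF k] c0[OF k] j unfolding c_def by auto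
  then show ?case by simp
qed

text \<open>Each coefficient of an expansion with \<open>p\<close>-th powers is itself expanded with
  \<open>p^n\<close>-th powers; the digit formula merges the two levels.\<close>

lemma iterated_powers_span:
  assumes t: "t \<in> carrier R"
    and span: "\<And>x. x \<in> carrier R \<Longrightarrow> \<exists>c. (\<forall>i<p. c i \<in> carrier R) \<and> x = (\<Oplus>i\<in>{..<p}. c i [^] p \<otimes> t [^] i)"
    and x: "x \<in> carrier R"
  shows "\<exists>c. (\<forall>i<p ^ n. c i \<in> carrier R) \<and> x = (\<Oplus>i\<in>{..<p ^ n}. c i [^] (p ^ n) \<otimes> t [^] i)"
  using x
proof (induction n arbitrary: x)
  case 0
  then show ?case by (intro exI[of _ "\<lambda>i. x"]) (simp add: lessThan_Suc)
next
  case (Suc n)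
  obtain d where d: "\<And>k. k < p \<Longrightarrow> d k \<in> carrier R" "x = (\<Oplus>i\<in>{..<p}. d i [^] p \<otimes> t [^] i)"
    using span[OF Suc.prems] by auto
  have "\<forall>k. \<exists>e. k < p \<longrightarrow> (\<forall>j<p ^ n. e j \<in> carrier R) \<and> d k = (\<Oplus>j\<in>{..<p ^ n}. e j [^] (p ^ n) \<otimes> t [^] j)"
    using Suc.IH d(1) by blast
  then obtain e where e: "\<And>k j. k < p \<Longrightarrow> j < p ^ n \<Longrightarrow> e k j \<in> carrier R"
      "\<And>k. k < p \<Longrightarrow> d k = (\<Oplus>j\<in>{..<p ^ n}. e k j [^] (p ^ n) \<otimes> t [^] j)"
    by metis
  \<comment> \<open>The lowest digit selects the outer coefficient, the remaining digits select the
    term of its expansion.\<close>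
  define c where "c i = e (i mod p) (i div p)" for i
  have cR: "c i \<in> carrier R" if "i < p ^ Suc n" for i
    unfolding c_def using that p_pos by (intro e(1)) (auto simp: less_mult_imp_div_less mult.commute)
  have "(\<Oplus>i\<in>{..<p ^ Suc n}. c i [^] (p ^ Suc n) \<otimes> t [^] i)
      = (\<Oplus>k\<in>{..<p}. (\<Oplus>j\<in>{..<p ^ n}. c (k + p * j) [^] (p ^ n) \<otimes> t [^] j) [^] p \<otimes> t [^] k)"
    by (rule iterated_powers_digits(1)[OF t cR])
  also have "\<dots> = (\<Oplus>k\<in>{..<p}. d k [^] p \<otimes> t [^] k)"
    using d(1) t by (intro finsum_cong') (auto simp: c_def e(2)[symmetric])
  finally show ?case using d(2) cR by metis
qed

end

section \<open>Derivations\<close>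

lemma (in abelian_monoid) finsum_induct:
  assumes "finite A" and f: "\<And>i. i \<in> A \<Longrightarrow> f i \<in> carrier G" and P: "\<And>i. i \<in> A \<Longrightarrow> P (f i)"
    and "P \<zero>" and add: "\<And>x y. \<lbrakk>x \<in> carrier G; y \<in> carrier G; P x; P y\<rbrakk> \<Longrightarrow> P (x \<oplus> y)"
  shows "P (\<Oplus>i\<in>A. f i)"
  using assms(1) f P
proof (induction A rule: finite_induct)
  case empty
  then show ?case using \<open>P \<zero>\<close> by simp
next
  case (insert a A)
  then show ?case by (subst finsum_insert) (auto intro!: add finsum_closed)
qed

text \<open>These are the derivations over the integers: additivity and the Leibniz rule already
  force the multiples of the unit to be killed, as \<open>derivation_int\<close> shows. They match
  the Kaehler relations over \<open>\<Z>\<close>.\<close>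

definition derivation :: "('a, 'b) ring_scheme \<Rightarrow> ('a \<Rightarrow> 'a) \<Rightarrow> bool" where
  "derivation R D \<longleftrightarrow> D \<in> carrier R \<rightarrow> carrier R \<and>
     (\<forall>x\<in>carrier R. \<forall>y\<in>carrier R. D (x \<oplus>\<^bsub>R\<^esub> y) = D x \<oplus>\<^bsub>R\<^esub> D y) \<and>
     (\<forall>x\<in>carrier R. \<forall>y\<in>carrier R. D (x \<otimes>\<^bsub>R\<^esub> y) = x \<otimes>\<^bsub>R\<^esub> D y \<oplus>\<^bsub>R\<^esub> y \<otimes>\<^bsub>R\<^esub> D x)"

context char_p_field
begin

context
  fixes K u
  assumes K: "subfield K R" and pow: "\<And>x. x \<in> carrier R \<Longrightarrow> x [^] p \<in> K"
    and u: "u \<in> carrier R" and uK: "u \<notin> K" and gen: "simple_extension K u = carrier R"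
begin

text \<open>The choice is immaterial below \<open>p\<close>, because the powers of \<open>u\<close>
  are independent over \<open>K\<close>.\<close>

definition coeffs :: "'a \<Rightarrow> nat \<Rightarrow> 'a" where
  "coeffs x = (SOME m. (\<forall>i<p. m i \<in> K) \<and> x = (\<Oplus>i\<in>{..<p}. m i \<otimes> u [^] i))"

text \<open>The formal derivative \<open>d/du\<close> with respect to the basis of powers of
  \<open>u\<close>. At \<open>i = 0\<close> the exponent is truncated, but the term carries the
  factor zero.\<close>

definition diff :: "'a \<Rightarrow> 'a" where
  "diff x = (\<Oplus>i\<in>{..<p}. [i] \<cdot>\<^bsub>R\<^esub> (coeffs x i \<otimes> u [^] (i - 1)))"

lemma K_carrier: "x \<in> K \<Longrightarrow> x \<in> carrier R"
  using subringE(1)[OF subfieldE(1)[OF K]] by auto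

lemma coeffs:
  assumes "x \<in> carrier R"
  shows "i < p \<Longrightarrow> coeffs x i \<in> K" "x = (\<Oplus>i\<in>{..<p}. coeffs x i \<otimes> u [^] i)"
proof -
  have "\<exists>m. (\<forall>i<p. m i \<in> K) \<and> x = (\<Oplus>i\<in>{..<p}. m i \<otimes> u [^] i)"
    using simple_extension_eq_combinations[OF K pow u uK, of x] assms gen by metis
  from someI_ex[OF this]
  show "i < p \<Longrightarrow> coeffs x i \<in> K" "x = (\<Oplus>i\<in>{..<p}. coeffs x i \<otimes> u [^] i)"
    unfolding coeffs_def by blast+
qed

lemma coeffs_unique:
  assumes m: "\<And>i. i < p \<Longrightarrow> m i \<in> K" and i: "i < p"
  shows "coeffs (\<Oplus>i\<in>{..<p}. m i \<otimes> u [^] i) i = m i"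
proof -
  let ?x = "\<Oplus>i\<in>{..<p}. m i \<otimes> u [^] i"
  have x: "?x \<in> carrier R" using m u K_carrier by (intro finsum_closed) auto
  note c = coeffs[OF x]
  have cm: "coeffs ?x i \<in> carrier R" "m i \<in> carrier R" if "i < p" for i
    using c(1) m K_carrier that by auto
  have "(\<Oplus>i\<in>{..<p}. (coeffs ?x i \<oplus> \<ominus> \<one> \<otimes> m i) \<otimes> u [^] i)
    = (\<Oplus>i\<in>{..<p}. coeffs ?x i \<otimes> u [^] i \<oplus> \<ominus> \<one> \<otimes> (m i \<otimes> u [^] i))"
    using cm u by (intro finsum_cong') (auto simp: l_distr m_assoc)
  also have "\<dots> = ?x \<oplus> \<ominus> \<one> \<otimes> ?x"
    using cm u c(2) by (subst finsum_addf) (auto simp: finsum_rdistr Pi_iff)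
  also have "\<dots> = \<zero>" using x by (simp add: l_minus r_neg)
  finally have "coeffs ?x i \<oplus> \<ominus> \<one> \<otimes> m i = \<zero>"
    using c(1) m i subringE[OF subfieldE(1)[OF K]]
    by (intro powers_independent[OF K pow u uK, of "\<lambda>i. coeffs ?x i \<oplus> \<ominus> \<one> \<otimes> m i"]) auto
  then have "coeffs ?x i \<ominus> m i = \<zero>" using cm[OF i] by (simp add: l_minus a_minus_def)
  then show ?thesis using cm[OF i] by simp
qed

lemma diff_combination:
  assumes m: "\<And>i. i < p \<Longrightarrow> m i \<in> K"
  shows "diff (\<Oplus>i\<in>{..<p}. m i \<otimes> u [^] i) = (\<Oplus>i\<in>{..<p}. [i] \<cdot>\<^bsub>R\<^esub> (m i \<otimes> u [^] (i - 1)))"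
  unfolding diff_def using coeffs_unique[OF m] m K_carrier u
  by (intro finsum_cong') auto

lemma diff_closed: "x \<in> carrier R \<Longrightarrow> diff x \<in> carrier R"
  unfolding diff_def using coeffs(1) K_carrier u by (intro finsum_closed) auto

lemma diff_add:
  assumes x: "x \<in> carrier R" and y: "y \<in> carrier R"
  shows "diff (x \<oplus> y) = diff x \<oplus> diff y"
proof -
  note cx = coeffs[OF x] and cy = coeffs[OF y]
  have c: "coeffs x i \<in> carrier R" "coeffs y i \<in> carrier R" if "i < p" for i
    using cx(1) cy(1) K_carrier that by auto
  have "x \<oplus> y = (\<Oplus>i\<in>{..<p}. (coeffs x i \<oplus> coeffs y i) \<otimes> u [^] i)"
  proof -
    have "(\<Oplus>i\<in>{..<p}. (coeffs x i \<oplus> coeffs y i) \<otimes> u [^] i)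
      = (\<Oplus>i\<in>{..<p}. coeffs x i \<otimes> u [^] i \<oplus> coeffs y i \<otimes> u [^] i)"
      using c u by (intro finsum_cong') (auto simp: l_distr)
    also have "\<dots> = x \<oplus> y"
      using c u by (subst finsum_addf) (auto simp: cx(2)[symmetric] cy(2)[symmetric])
    finally show ?thesis ..
  qed
  then have "diff (x \<oplus> y) = (\<Oplus>i\<in>{..<p}. [i] \<cdot>\<^bsub>R\<^esub> ((coeffs x i \<oplus> coeffs y i) \<otimes> u [^] (i - 1)))"
    using diff_combination[of "\<lambda>i. coeffs x i \<oplus> coeffs y i"] cx(1) cy(1)
      subringE(7)[OF subfieldE(1)[OF K]] by simp
  also have "\<dots> = (\<Oplus>i\<in>{..<p}. [i] \<cdot>\<^bsub>R\<^esub> (coeffs x i \<otimes> u [^] (i - 1)) \<oplus> [i] \<cdot>\<^bsub>R\<^esub> (coeffs y i \<otimes> u [^] (i - 1)))"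
    using c u by (intro finsum_cong') (auto simp: l_distr add.nat_pow_distrib)
  also have "\<dots> = diff x \<oplus> diff y"
    unfolding diff_def using c u by (subst finsum_addf) auto
  finally show ?thesis .
qed

lemma diff_monomial_less:
  assumes a: "a \<in> K" and k: "k < p"
  shows "diff (a \<otimes> u [^] k) = [k] \<cdot>\<^bsub>R\<^esub> (a \<otimes> u [^] (k - 1))"
proof -
  have z: "\<zero> \<in> K" using subringE(2)[OF subfieldE(1)[OF K]] .
  let ?m = "\<lambda>i. if i = k then a else \<zero>"
  have single: "(\<Oplus>i\<in>{..<p}. f i) = f k"
    if "f k \<in> carrier R" "\<And>i. i \<noteq> k \<Longrightarrow> f i = \<zero>" for f
  proof -
    have "(\<Oplus>i\<in>{..<p}. f i) = (\<Oplus>i\<in>{k}. f i)"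
      using that k by (intro add.finprod_mono_neutral_cong_right) (auto, metis zero_closed)
    then show ?thesis using that by simp
  qed
  have "diff (\<Oplus>i\<in>{..<p}. ?m i \<otimes> u [^] i) = (\<Oplus>i\<in>{..<p}. [i] \<cdot>\<^bsub>R\<^esub> (?m i \<otimes> u [^] (i - 1)))"
    using a z by (intro diff_combination) auto
  moreover have "(\<Oplus>i\<in>{..<p}. ?m i \<otimes> u [^] i) = a \<otimes> u [^] k"
    using a u K_carrier by (subst single) auto
  moreover have "(\<Oplus>i\<in>{..<p}. [i] \<cdot>\<^bsub>R\<^esub> (?m i \<otimes> u [^] (i - 1))) = [k] \<cdot>\<^bsub>R\<^esub> (a \<otimes> u [^] (k - 1))"
    using a u K_carrier by (subst single) auto
  ultimately show ?thesis by simp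
qed

text \<open>Products of basis monomials leave the range of exponents below \<open>p\<close>, so the
  Leibniz rule needs all exponents. The excess \<open>u^(p*l)\<close> lies in \<open>K\<close> and
  counts as a constant, and the factors \<open>k\<close> and \<open>k mod p\<close> agree since
  multiples of \<open>p\<close> vanish.\<close>

lemma diff_monomial:
  fixes k :: nat
  assumes a: "a \<in> K"
  shows "diff (a \<otimes> u [^] k) = [k] \<cdot>\<^bsub>R\<^esub> (a \<otimes> u [^] (k - 1))"
proof -
  define i l where "i = k mod p" and "l = k div p"
  have k: "k = p * l + i" "i < p" unfolding i_def l_def using p_pos by auto
  have aR: "a \<in> carrier R" using a K_carrier by simp
  have ul: "(u [^] l) [^] p \<in> K" using pow u by simp
  then have b: "a \<otimes> (u [^] l) [^] p \<in> K" using subringE(6)[OF subfieldE(1)[OF K] a] by simp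
  have e: "(u [^] l) [^] p \<otimes> u [^] j = u [^] (p * l + j)" for j :: nat
    using u by (simp add: nat_pow_pow nat_pow_mult mult.commute)
  have "a \<otimes> u [^] k = (a \<otimes> (u [^] l) [^] p) \<otimes> u [^] i"
    using aR u by (simp add: m_assoc e k(1))
  then have "diff (a \<otimes> u [^] k) = [i] \<cdot>\<^bsub>R\<^esub> ((a \<otimes> (u [^] l) [^] p) \<otimes> u [^] (i - 1))"
    using diff_monomial_less[OF b k(2)] by simp
  also have "\<dots> = [i] \<cdot>\<^bsub>R\<^esub> (a \<otimes> u [^] (p * l + (i - 1)))"
    using aR u by (simp add: m_assoc e)
  also have "\<dots> = [i] \<cdot>\<^bsub>R\<^esub> (a \<otimes> u [^] (k - 1))"
    using k(1) by (cases "i = 0") auto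
  also have "\<dots> = [k] \<cdot>\<^bsub>R\<^esub> (a \<otimes> u [^] (k - 1))"
    unfolding k(1) using aR u p_mult_zero[of "a \<otimes> u [^] (p * l + i - 1)" l]
    by (simp add: add.nat_pow_mult[symmetric])
  finally show ?thesis .
qed

lemma diff_Leibniz_monomial:
  fixes k l :: nat
  assumes a: "a \<in> K" and b: "b \<in> K"
  shows "diff ((a \<otimes> u [^] k) \<otimes> (b \<otimes> u [^] l))
    = (a \<otimes> u [^] k) \<otimes> diff (b \<otimes> u [^] l) \<oplus> (b \<otimes> u [^] l) \<otimes> diff (a \<otimes> u [^] k)"
proof -
  have R: "a \<in> carrier R" "b \<in> carrier R" using a b K_carrier by auto
  have ab: "a \<otimes> b \<in> K" using subringE(6)[OF subfieldE(1)[OF K] a b] .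
  let ?z = "(a \<otimes> b) \<otimes> u [^] (k + l - 1)"
  have e: "u [^] k \<otimes> u [^] (l - 1) = u [^] (k + l - 1)" if "l \<noteq> 0" for k l :: nat
    using that u by (simp add: nat_pow_mult)
  have "(a \<otimes> u [^] k) \<otimes> (b \<otimes> u [^] l) = (a \<otimes> b) \<otimes> u [^] (k + l)"
    using R u by (simp add: nat_pow_mult[symmetric] m_ac)
  then have "diff ((a \<otimes> u [^] k) \<otimes> (b \<otimes> u [^] l)) = [(k + l)] \<cdot>\<^bsub>R\<^esub> ?z"
    using diff_monomial[OF ab] by simp
  also have "\<dots> = [l] \<cdot>\<^bsub>R\<^esub> ?z \<oplus> [k] \<cdot>\<^bsub>R\<^esub> ?z"
    using R u by (simp add: add.nat_pow_mult add.commute)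
  also have "[l] \<cdot>\<^bsub>R\<^esub> ?z = (a \<otimes> u [^] k) \<otimes> diff (b \<otimes> u [^] l)"
  \<comment> \<open>For \<open>l = 0\<close> both sides vanish; otherwise \<open>l - 1\<close> is a
    true predecessor and the exponents add up. The same distinction recurs for
    \<open>k\<close>.\<close>
  proof (cases "l = 0")
    case False
    have "?z = (a \<otimes> u [^] k) \<otimes> (b \<otimes> u [^] (l - 1))"
      using R u e[OF False, of k, symmetric] by (simp add: m_ac)
    then show ?thesis using R u unfolding diff_monomial[OF b] by (simp add: add_pow_rdistr)
  qed (use R u diff_monomial[OF b, of l] in simp)
  also have "[k] \<cdot>\<^bsub>R\<^esub> ?z = (b \<otimes> u [^] l) \<otimes> diff (a \<otimes> u [^] k)"
  proof (cases "k = 0")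
    case False
    have "?z = (b \<otimes> u [^] l) \<otimes> (a \<otimes> u [^] (k - 1))"
      using R u e[OF False, of l, symmetric] by (simp add: m_ac add.commute)
    then show ?thesis using R u unfolding diff_monomial[OF a] by (simp add: add_pow_rdistr)
  qed (use R u diff_monomial[OF a, of k] in simp)
  finally show ?thesis .
qed

text \<open>Reduces the Leibniz rule, which is additive in each argument, to monomials. The zero
  element needs no case of its own: it is a monomial with coefficient zero.\<close>

lemma monomial_induct:
  assumes x: "x \<in> carrier R" and mono: "\<And>a k. a \<in> K \<Longrightarrow> P (a \<otimes> u [^] (k :: nat))"
    and add: "\<And>x y. \<lbrakk>x \<in> carrier R; y \<in> carrier R; P x; P y\<rbrakk> \<Longrightarrow> P (x \<oplus> y)"
  shows "P x"
proof -
  have "P (\<zero> \<otimes> u [^] (0 :: nat))" using subringE(2)[OF subfieldE(1)[OF K]] by (intro mono)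
  then have "P \<zero>" by simp
  then have "P (\<Oplus>i\<in>{..<p}. coeffs x i \<otimes> u [^] i)"
    using coeffs(1)[OF x] K_carrier u mono add
    by (intro finsum_induct[of "{..<p}" "\<lambda>i. coeffs x i \<otimes> u [^] i" P]) auto
  then show ?thesis using coeffs(2)[OF x] by simp
qed

lemma diff_Leibniz:
  assumes x: "x \<in> carrier R" and y: "y \<in> carrier R"
  shows "diff (x \<otimes> y) = x \<otimes> diff y \<oplus> y \<otimes> diff x"
proof -
  have mR: "a \<otimes> u [^] k \<in> carrier R" if "a \<in> K" for a and k :: nat using that u K_carrier by simp
  have *: "diff (x \<otimes> (b \<otimes> u [^] l)) = x \<otimes> diff (b \<otimes> u [^] l) \<oplus> (b \<otimes> u [^] l) \<otimes> diff x"
    if b: "b \<in> K" for b and l :: nat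
    using x
  proof (induction x rule: monomial_induct)
    case (2 a k)
    from 2(1) show ?case by (rule diff_Leibniz_monomial[OF _ b])
  next
    case (3 x x')
    then show ?case using mR[OF b, of l]
      by (simp add: l_distr r_distr diff_add diff_closed a_ac)
  qed (rule x)
  show ?thesis using y
  proof (induction y rule: monomial_induct)
    case (2 b l)
    from 2(1) show ?case by (rule *)
  next
    case (3 y y')
    then show ?case using x
      by (simp add: l_distr r_distr diff_add diff_closed a_ac)
  qed (rule y)
qed

lemma derivation_diff: "derivation R diff" "diff u = \<one>" "\<And>x. x \<in> K \<Longrightarrow> diff x = \<zero>"
proof -
  show "derivation R diff" unfolding derivation_def
    using diff_closed diff_add diff_Leibniz by auto
  show "diff u = \<one>" using diff_monomial[of \<one> 1] subringE(3)[OF subfieldE(1)[OF K]] u by simp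
  fix x assume "x \<in> K"
  then show "diff x = \<zero>" using diff_monomial[of x 0] K_carrier by simp
qed

end

text \<open>Zorn's lemma gives \<open>M\<close> maximal among the subrings that contain
  \<open>L\<close> and miss \<open>u\<close>. For \<open>v\<close> outside \<open>M\<close>,
  maximality puts \<open>u\<close> into the extension of \<open>M\<close> by \<open>v\<close>. Both
  extensions have degree \<open>p\<close> over the field \<open>M\<close>, so they coincide and
  \<open>v\<close> lies in the extension by \<open>u\<close>.\<close>

lemma exists_maximal_subring:
  assumes L: "subring L R" and pow: "\<And>x. x \<in> carrier R \<Longrightarrow> x [^] p \<in> L"
    and u: "u \<in> carrier R" and uL: "u \<notin> L"
  obtains M where "subring M R" "L \<subseteq> M" "u \<notin> M" "simple_extension M u = carrier R"
proof -
  define A where "A = {M. subring M R \<and> L \<subseteq> M \<and> u \<notin> M}"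
  have "A \<noteq> {}" using L uL unfolding A_def by auto
  moreover have "\<Union>C \<in> A" if C: "C \<noteq> {}" "subset.chain A C" for C
  proof -
    have CA: "M \<in> A" if "M \<in> C" for M using C that unfolding subset.chain_def by auto
    have tot: "M \<subseteq> N \<or> N \<subseteq> M" if "M \<in> C" "N \<in> C" for M N
      using C that unfolding subset_chain_def by auto
    have sub: "subring M R" if "M \<in> C" for M using CA[OF that] unfolding A_def by simp
    have two: "\<exists>M\<in>C. x \<in> M \<and> y \<in> M" if "x \<in> \<Union>C" "y \<in> \<Union>C" for x y
      using that tot by blast
    have "subring (\<Union>C) R"
    proof (rule subringI)
      show "\<Union>C \<subseteq> carrier R" using sub subringE(1) by blast
      show "\<one> \<in> \<Union>C" using C(1) sub subringE(3) by blast
      show "\<ominus> x \<in> \<Union>C" if "x \<in> \<Union>C" for x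
        using that subringE(5)[OF sub] by (meson UnionE UnionI)
      fix x y assume "x \<in> \<Union>C" "y \<in> \<Union>C"
      then obtain M where M: "M \<in> C" "x \<in> M" "y \<in> M" using two by metis
      show "x \<otimes> y \<in> \<Union>C" using subringE(6)[OF sub[OF M(1)] M(2,3)] M(1) by blast
      show "x \<oplus> y \<in> \<Union>C" using subringE(7)[OF sub[OF M(1)] M(2,3)] M(1) by blast
    qed
    then show ?thesis using CA C(1) unfolding A_def by blast
  qed
  ultimately obtain M where M: "M \<in> A" and max: "\<And>N. N \<in> A \<Longrightarrow> M \<subseteq> N \<Longrightarrow> N = M"
    using subset_Zorn_nonempty[of A] by metis
  then have Ms: "subring M R" "L \<subseteq> M" "u \<notin> M" unfolding A_def by auto
  have Mc: "M \<subseteq> carrier R" using subringE(1)[OF Ms(1)] .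
  have powM: "x [^] p \<in> M" if "x \<in> carrier R" for x using pow[OF that] Ms by auto
  have Mf: "subfield M R" by (rule subfield_of_pth_powers[OF Ms(1) powM])
  have "v \<in> simple_extension M u" if v: "v \<in> carrier R" for v
  proof (cases "v \<in> M")
    case True
    then show ?thesis using simple_extension_incl[OF Mc u] by auto
  next
    case False
    have vin: "v \<in> simple_extension M v" by (rule simple_extension_mem[OF Ms(1) v])
    have Min: "M \<subseteq> simple_extension M v" by (rule simple_extension_incl[OF Mc v])
    have "u \<in> simple_extension M v"
    proof (rule ccontr)
      assume "u \<notin> simple_extension M v"
      then have "simple_extension M v \<in> A"
        unfolding A_def using simple_extension_is_subring[OF Ms(1) v] Min Ms by auto
      then show False using max[OF _ Min] vin False by auto
    qed
    then show ?thesis using simple_extension_eqI[OF Mf powM u Ms(3) v False] vin by simp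
  qed
  moreover have "simple_extension M u \<subseteq> carrier R"
    using subringE(1)[OF simple_extension_is_subring[OF Ms(1) u]] .
  ultimately show thesis using that[OF Ms] by blast
qed

lemma exists_derivation:
  assumes L: "subring L R" and pow: "\<And>x. x \<in> carrier R \<Longrightarrow> x [^] p \<in> L"
    and u: "u \<in> carrier R" and uL: "u \<notin> L"
  obtains D where "derivation R D" "D u = \<one>" "\<And>x. x \<in> L \<Longrightarrow> D x = \<zero>"
proof -
  obtain M where M: "subring M R" "L \<subseteq> M" "u \<notin> M" "simple_extension M u = carrier R"
    using exists_maximal_subring[OF L pow u uL] by blast
  have powM: "x [^] p \<in> M" if "x \<in> carrier R" for x using pow[OF that] M by auto
  have Mf: "subfield M R" by (rule subfield_of_pth_powers[OF M(1) powM])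
  show thesis
    using derivation_diff[OF Mf powM u M(3,4)] M(2) by (intro that[of "diff M u"]) auto
qed

end

section \<open>Modules and the p-degree\<close>

text \<open>Every module axiom is an equation or an existence statement and descends along a
  surjection compatible with the operations. No structure is presupposed on \<open>Q\<close>, so the
  lemma serves the quotient module and the cotangent space, whose operations are defined on
  cosets.\<close>

lemma module_of_surjection:
  assumes M: "module R M" and S: "cring S"
    and h: "h ` carrier R = carrier S" "h \<in> ring_hom R S"
    and q: "q ` carrier M = carrier Q" "q \<zero>\<^bsub>M\<^esub> = \<zero>\<^bsub>Q\<^esub>"
      "\<And>x y. \<lbrakk>x \<in> carrier M; y \<in> carrier M\<rbrakk> \<Longrightarrow> q (x \<oplus>\<^bsub>M\<^esub> y) = q x \<oplus>\<^bsub>Q\<^esub> q y"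
      "\<And>a x. \<lbrakk>a \<in> carrier R; x \<in> carrier M\<rbrakk> \<Longrightarrow> q (a \<odot>\<^bsub>M\<^esub> x) = h a \<odot>\<^bsub>Q\<^esub> q x"
  shows "module S Q"
proof -
  interpret M: module R M by fact
  have Q: "\<exists>x\<in>carrier M. v = q x" if "v \<in> carrier Q" for v using that q(1) by blast
  have S': "\<exists>a\<in>carrier R. c = h a" if "c \<in> carrier S" for c using that h(1) by blast
  have qc: "q x \<in> carrier Q" if "x \<in> carrier M" for x using that q(1) by blast
  show ?thesis
  proof (rule moduleI[OF S abelian_groupI])
    show "\<zero>\<^bsub>Q\<^esub> \<in> carrier Q" using qc[OF M.zero_closed] q(2) by simp
  next
    fix v w assume vw: "v \<in> carrier Q" "w \<in> carrier Q"
    then obtain x y where x: "x \<in> carrier M" "v = q x" "y \<in> carrier M" "w = q y" using Q by metis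
    show "v \<oplus>\<^bsub>Q\<^esub> w \<in> carrier Q" using x q(3) qc by (metis M.a_closed)
    show "v \<oplus>\<^bsub>Q\<^esub> w = w \<oplus>\<^bsub>Q\<^esub> v" using x q(3) by (metis M.a_comm)
    fix c assume "c \<in> carrier S"
    then obtain a where a: "a \<in> carrier R" "c = h a" using S' by metis
    show "c \<odot>\<^bsub>Q\<^esub> (v \<oplus>\<^bsub>Q\<^esub> w) = c \<odot>\<^bsub>Q\<^esub> v \<oplus>\<^bsub>Q\<^esub> c \<odot>\<^bsub>Q\<^esub> w"
      using a x by (simp add: q(3,4)[symmetric] M.smult_r_distr)
  next
    fix v w z assume "v \<in> carrier Q" "w \<in> carrier Q" "z \<in> carrier Q"
    then obtain x y y' where x: "x \<in> carrier M" "v = q x" "y \<in> carrier M" "w = q y" "y' \<in> carrier M" "z = q y'"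
      using Q by metis
    then show "v \<oplus>\<^bsub>Q\<^esub> w \<oplus>\<^bsub>Q\<^esub> z = v \<oplus>\<^bsub>Q\<^esub> (w \<oplus>\<^bsub>Q\<^esub> z)"
      by (simp add: q(3)[symmetric] M.a_assoc)
  next
    fix v assume "v \<in> carrier Q"
    then obtain x where x: "x \<in> carrier M" "v = q x" using Q by metis
    show "\<zero>\<^bsub>Q\<^esub> \<oplus>\<^bsub>Q\<^esub> v = v" using x by (simp add: q(2,3)[symmetric])
    show "\<exists>y\<in>carrier Q. y \<oplus>\<^bsub>Q\<^esub> v = \<zero>\<^bsub>Q\<^esub>"
      using x by (intro bexI[of _ "q (\<ominus>\<^bsub>M\<^esub> x)"] qc) (simp_all add: q(2,3)[symmetric] M.l_neg)
    show "\<one>\<^bsub>S\<^esub> \<odot>\<^bsub>Q\<^esub> v = v"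
      using x q(4)[OF M.R.one_closed x(1)] ring_hom_one[OF h(2)] by simp
    fix c assume "c \<in> carrier S"
    then obtain a where a: "a \<in> carrier R" "c = h a" using S' by metis
    show "c \<odot>\<^bsub>Q\<^esub> v \<in> carrier Q" using a x qc[of "a \<odot>\<^bsub>M\<^esub> x"] by (simp add: q(4)[symmetric])
    fix d assume "d \<in> carrier S"
    then obtain b where b: "b \<in> carrier R" "d = h b" using S' by metis
    show "(c \<oplus>\<^bsub>S\<^esub> d) \<odot>\<^bsub>Q\<^esub> v = c \<odot>\<^bsub>Q\<^esub> v \<oplus>\<^bsub>Q\<^esub> d \<odot>\<^bsub>Q\<^esub> v"
      using a b x ring_hom_add[OF h(2) a(1) b(1)]
      by (simp add: q(3,4)[symmetric] M.smult_l_distr ring_hom_add[OF h(2), symmetric])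
    show "(c \<otimes>\<^bsub>S\<^esub> d) \<odot>\<^bsub>Q\<^esub> v = c \<odot>\<^bsub>Q\<^esub> (d \<odot>\<^bsub>Q\<^esub> v)"
      using a b x by (simp add: q(4)[symmetric] M.smult_assoc1 ring_hom_mult[OF h(2), symmetric])
  qed
qed

lemma vdim_le_1I:
  fixes K :: "'k ring" and V :: "('k, 'v) module"
  assumes V: "vectorspace K V" and w: "w \<in> carrier V" and gen: "\<And>v. v \<in> carrier V \<Longrightarrow> \<exists>c\<in>carrier K. v = c \<odot>\<^bsub>V\<^esub> w"
  shows "vdim K V \<le> 1"
proof -
  interpret vectorspace K V by fact
  have "span {w} = carrier V"
  proof (intro equalityI span_is_subset2 subsetI)
    fix v assume "v \<in> carrier V"
    then obtain c where c: "c \<in> carrier K" "v = c \<odot>\<^bsub>V\<^esub> w" using gen by auto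
    have "v = lincomb (\<lambda>_. c) {w}" unfolding lincomb_def using c w by simp
    then show "v \<in> span {w}" unfolding span_def using c by blast
  qed (use w in simp)
  then have A: "finite {w} \<and> card {w} = 1 \<and> {w} \<subseteq> carrier V \<and> span {w} = carrier V" using w by simp
  then have "fin_dim" unfolding fin_dim_def by blast
  moreover have "dim \<le> 1" unfolding dim_def by (rule Least_le) (use A in blast)
  ultimately show ?thesis unfolding vdim_def by (simp add: one_enat_def)
qed

lemma vdim_le_1D:
  fixes K :: "'k ring" and V :: "('k, 'v) module"
  assumes V: "vectorspace K V" and "vdim K V \<le> 1"
  obtains w where "w \<in> carrier V" "\<And>v. v \<in> carrier V \<Longrightarrow> \<exists>c\<in>carrier K. v = c \<odot>\<^bsub>V\<^esub> w"
proof -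
  interpret vectorspace K V by fact
  have fd: fin_dim and d: "dim \<le> 1"
    using assms(2) unfolding vdim_def by (auto simp: one_enat_def split: if_splits)
  have "\<exists>n A. finite A \<and> card A = n \<and> A \<subseteq> carrier V \<and> span A = carrier V"
    using fd unfolding fin_dim_def by blast
  then have "\<exists>A. finite A \<and> card A = dim \<and> A \<subseteq> carrier V \<and> span A = carrier V"
    unfolding dim_def by (rule LeastI_ex)
  then obtain A where A: "finite A" "card A \<le> 1" "A \<subseteq> carrier V" "span A = carrier V" using d by metis
  obtain w where w: "w \<in> carrier V" "A \<subseteq> {w}"
  \<comment> \<open>An empty spanning set is the case of dimension zero, where the zero vector
    serves as \<open>w\<close>.\<close>
  proof (cases "A = {}")
    case False
    then have "card A = 1" using A(1,2) by (simp add: le_Suc_eq)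
    then obtain w where "A = {w}" by (rule card_1_singletonE)
    then show thesis using that A(3) by simp
  qed (use that[OF M.zero_closed] in simp)
  show thesis
  proof (rule that[OF w(1)])
    fix v assume "v \<in> carrier V"
    then obtain a B where B: "B \<subseteq> A" "a \<in> B \<rightarrow> carrier K" "v = lincomb a B"
      using A(4) unfolding span_def by blast
    then consider "B = {}" | "B = {w}" using w by blast
    then show "\<exists>c\<in>carrier K. v = c \<odot>\<^bsub>V\<^esub> w"
    proof cases
      case 1
      then show ?thesis using B w by (intro bexI[of _ "\<zero>\<^bsub>K\<^esub>"]) (auto simp: lincomb_def)
    next
      case 2
      then show ?thesis using B w by (intro bexI[of _ "a w"]) (auto simp: lincomb_def)
    qed
  qed
qed

text \<open>Any nonzero vector spans a space of dimension at most one. This allows the generator of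
  the differentials to be chosen of the form \<open>dt\<close>.\<close>

lemma vdim_le_1_multiple:
  fixes K :: "'k ring" and V :: "('k, 'v) module"
  assumes V: "vectorspace K V" and "vdim K V \<le> 1" and v: "v \<in> carrier V" "v \<noteq> \<zero>\<^bsub>V\<^esub>" and u: "u \<in> carrier V"
  shows "\<exists>c\<in>carrier K. u = c \<odot>\<^bsub>V\<^esub> v"
proof -
  interpret vectorspace K V by fact
  obtain w where w: "w \<in> carrier V" "\<And>v. v \<in> carrier V \<Longrightarrow> \<exists>c\<in>carrier K. v = c \<odot>\<^bsub>V\<^esub> w"
    using vdim_le_1D[OF assms(1,2)] by blast
  obtain a where a: "a \<in> carrier K" "v = a \<odot>\<^bsub>V\<^esub> w" using w(2)[OF v(1)] by blast
  obtain b where b: "b \<in> carrier K" "u = b \<odot>\<^bsub>V\<^esub> w" using w(2)[OF u] by blast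
  have "a \<noteq> \<zero>\<^bsub>K\<^esub>" using a v w by auto
  then have aU: "a \<in> Units K" using a field_Units by auto
  then have "u = (b \<otimes>\<^bsub>K\<^esub> inv\<^bsub>K\<^esub> a) \<odot>\<^bsub>V\<^esub> v"
    using a b w by (simp add: smult_assoc1[symmetric] m_assoc)
  then show ?thesis using aU b by (intro bexI[of _ "b \<otimes>\<^bsub>K\<^esub> inv\<^bsub>K\<^esub> a"]) auto
qed

lemma quot_module:
  fixes R :: "'r ring" and M :: "('r, 'm) module" (structure)
  assumes M: "module R M" and N: "LinearCombinations.submodule R N M"
  shows "module R (quot_module M N)"
    and "\<And>x. x \<in> carrier M \<Longrightarrow> N +> x \<in> carrier (quot_module M N)"
    and "\<And>a x. \<lbrakk>a \<in> carrier R; x \<in> carrier M\<rbrakk> \<Longrightarrow>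
      a \<odot>\<^bsub>quot_module M N\<^esub> (N +> x) = N +> (a \<odot> x)"
    and "\<And>x y. \<lbrakk>x \<in> carrier M; y \<in> carrier M; N +> x = N +> y\<rbrakk> \<Longrightarrow> x \<ominus> y \<in> N"
proof -
  interpret module R M by fact
  have N': "N \<subseteq> carrier M" "\<zero> \<in> N" "\<And>v w. \<lbrakk>v \<in> N; w \<in> N\<rbrakk> \<Longrightarrow> v \<oplus> w \<in> N"
    "\<And>c v. \<lbrakk>c \<in> carrier R; v \<in> N\<rbrakk> \<Longrightarrow> c \<odot> v \<in> N"
    using N unfolding LinearCombinations.submodule_def by auto
  have minus: "\<ominus> v \<in> N" if "v \<in> N" for v
    using N'(4)[of "\<ominus>\<^bsub>R\<^esub> \<one>\<^bsub>R\<^esub>" v] that N'(1) by (simp add: smult_l_minus subsetD)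
  interpret N: abelian_subgroup N M
    by (rule abelian_subgroupI3[OF _ M.abelian_group_axioms], unfold_locales)
      (use N' minus in \<open>auto simp: a_inv_def[symmetric]\<close>)
  let ?Q = "quot_module M N"
  have sub: "subgroup N (add_monoid M)" by (rule N.a_subgroup)
  have cos: "N +> x = N +> y \<longleftrightarrow> x \<ominus> y \<in> N" if "x \<in> carrier M" "y \<in> carrier M" for x y
  proof
    assume "N +> x = N +> y"
    then have "x \<in> N +> y" using N.a_rcos_self[OF that(1)] by simp
    then obtain n where n: "n \<in> N" "x = n \<oplus> y" unfolding a_r_coset_def' by auto
    then have "x \<ominus> y = n" using that N'(1) by (simp add: a_minus_def M.a_assoc M.r_neg subsetD)
    then show "x \<ominus> y \<in> N" using n by simp
  next
    assume *: "x \<ominus> y \<in> N"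
    have "x = (x \<ominus> y) \<oplus> y" using that by (simp add: a_minus_def M.a_assoc M.l_neg)
    then have "x \<in> N +> y" using * unfolding a_r_coset_def' by blast
    then show "N +> x = N +> y" using N.a_repr_independence' that by metis
  qed
  show carr: "N +> x \<in> carrier ?Q" if "x \<in> carrier M" for x
    using that unfolding quot_module_def by (simp add: M.a_rcosetsI N'(1))
  show smult: "a \<odot>\<^bsub>?Q\<^esub> (N +> x) = N +> (a \<odot> x)" if "a \<in> carrier R" "x \<in> carrier M" for a x
  proof -
    \<comment> \<open>The scalar product in \<open>quot_module\<close> is a union over the
      representatives of a coset; it is again a coset because all members of this union
      coincide.\<close>
    have eq: "N +> (a \<odot> y) = N +> (a \<odot> x)" if y: "y \<in> N +> x" for y
    proof -
      obtain n where n: "n \<in> N" "y = n \<oplus> x" using y unfolding a_r_coset_def' by auto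
      then have nc: "n \<in> carrier M" using N' by auto
      have "a \<odot> y \<ominus> a \<odot> x = a \<odot> n"
        using n nc \<open>a \<in> carrier R\<close> \<open>x \<in> carrier M\<close>
        by (simp add: smult_r_distr a_minus_def M.a_assoc M.r_neg)
      then show ?thesis
        using n nc N'(4) \<open>a \<in> carrier R\<close> \<open>x \<in> carrier M\<close> by (subst cos) auto
    qed
    show ?thesis
      using UN_constant_eq[OF N.a_rcos_self[OF that(2)] ballI[OF eq]] unfolding quot_module_def by simp
  qed
  show "x \<ominus> y \<in> N" if "x \<in> carrier M" "y \<in> carrier M" "N +> x = N +> y" for x y
    using cos that by blast
  show "module R ?Q"
  proof (rule module_of_surjection[OF module_axioms R.is_cring, of "\<lambda>a. a" "\<lambda>x. N +> x"])
    show "(\<lambda>a. a) ` carrier R = carrier R" "(\<lambda>a. a) \<in> ring_hom R R"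
      by (auto simp: ring_hom_def)
    show "(+>) N ` carrier M = carrier ?Q" unfolding quot_module_def A_RCOSETS_def' by auto
    show "N +> \<zero> = \<zero>\<^bsub>?Q\<^esub>" unfolding quot_module_def using N.a_rcos_const[OF N'(2)] by simp
    show "N +> (x \<oplus> y) = (N +> x) \<oplus>\<^bsub>?Q\<^esub> (N +> y)" if "x \<in> carrier M" "y \<in> carrier M" for x y
      using N.a_rcos_sum[OF that] unfolding quot_module_def by simp
  qed (use smult in auto)
qed


section \<open>Free modules and their linear maps to the ring\<close>

lemma free_module:
  fixes R :: "'r ring" (structure) and S :: "'x set"
  assumes R: "cring R"
  shows "module R (free_module R S)"
proof -
  interpret R: cring R by fact
  let ?N = "{f \<in> S \<rightarrow>\<^sub>E carrier R. finite {x \<in> S. f x \<noteq> \<zero>}}"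
  have "LinearCombinations.submodule R ?N (R.func_space S)"
    unfolding LinearCombinations.submodule_def
  proof (intro conjI allI impI)
    show "module R (R.func_space S)" by (rule R.func_space_is_module)
    show "?N \<subseteq> carrier (R.func_space S)" unfolding R.func_space_def by auto
    show "\<zero>\<^bsub>R.func_space S\<^esub> \<in> ?N" unfolding R.func_space_def by auto
  next
    fix f g assume fg: "f \<in> ?N" "g \<in> ?N"
    have "finite {x \<in> S. f x \<oplus> g x \<noteq> \<zero>}"
      by (rule finite_subset[of _ "{x \<in> S. f x \<noteq> \<zero>} \<union> {x \<in> S. g x \<noteq> \<zero>}"]) (use fg in auto)
    moreover have "{x \<in> S. (\<lambda>v\<in>S. f v \<oplus> g v) x \<noteq> \<zero>} = {x \<in> S. f x \<oplus> g x \<noteq> \<zero>}" by auto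
    ultimately show "f \<oplus>\<^bsub>R.func_space S\<^esub> g \<in> ?N" using fg unfolding R.func_space_def by auto
  next
    fix c f assume c: "c \<in> carrier R" and f: "f \<in> ?N"
    have "finite {x \<in> S. c \<otimes> f x \<noteq> \<zero>}"
      by (rule finite_subset[of _ "{x \<in> S. f x \<noteq> \<zero>}"]) (use c f in auto)
    moreover have "{x \<in> S. (\<lambda>v\<in>S. c \<otimes> f v) x \<noteq> \<zero>} = {x \<in> S. c \<otimes> f x \<noteq> \<zero>}" by auto
    ultimately show "c \<odot>\<^bsub>R.func_space S\<^esub> f \<in> ?N" using c f unfolding R.func_space_def by auto
  qed
  then show ?thesis
    unfolding free_module_def
    by (rule module.submodule_is_module[OF R.func_space_is_module])
qed

text \<open>The linear form on the free module that takes the value \<open>D x\<close> on the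
  generator of \<open>x\<close>. For a derivation \<open>D\<close> it factors through the Kaehler
  differentials.\<close>

definition free_lift :: "'r ring \<Rightarrow> 'x set \<Rightarrow> ('x \<Rightarrow> 'r) \<Rightarrow> ('x \<Rightarrow> 'r) \<Rightarrow> 'r" where
  "free_lift R S D f = (\<Oplus>\<^bsub>R\<^esub>x\<in>{x\<in>S. f x \<noteq> \<zero>\<^bsub>R\<^esub>}. f x \<otimes>\<^bsub>R\<^esub> D x)"

context
  fixes R :: "'r ring" (structure) and S :: "'x set" and D :: "'x \<Rightarrow> 'r"
  assumes R: "cring R" and D: "D \<in> S \<rightarrow> carrier R"
begin

interpretation R: cring R by (rule R)
interpretation M: module R "free_module R S" by (rule free_module[OF R])

lemma free_module_carrier:
  "f \<in> carrier (free_module R S) \<longleftrightarrow> f \<in> S \<rightarrow>\<^sub>E carrier R \<and> finite {x \<in> S. f x \<noteq> \<zero>}"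
  unfolding free_module_def by simp

text \<open>The support changes under the module operations; summing over a common finite superset
  makes the values comparable.\<close>

lemma free_lift_superset:
  assumes "f \<in> carrier (free_module R S)" "finite T" "T \<subseteq> S" "{x \<in> S. f x \<noteq> \<zero>} \<subseteq> T"
  shows "free_lift R S D f = (\<Oplus>x\<in>T. f x \<otimes> D x)"
proof -
  have fD: "f x \<in> carrier R" "D x \<in> carrier R" if "x \<in> T" for x
    using that assms D free_module_carrier by auto
  show ?thesis
    unfolding free_lift_def
    by (rule R.add.finprod_mono_neutral_cong_left) (use assms fD in auto)
qed

lemma free_lift_closed: "f \<in> carrier (free_module R S) \<Longrightarrow> free_lift R S D f \<in> carrier R"
  unfolding free_lift_def using D free_module_carrier by (intro R.finsum_closed) auto

lemma free_lift_add:
  assumes f: "f \<in> carrier (free_module R S)" and g: "g \<in> carrier (free_module R S)"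
  shows "free_lift R S D (f \<oplus>\<^bsub>free_module R S\<^esub> g) = free_lift R S D f \<oplus> free_lift R S D g"
proof -
  let ?T = "{x \<in> S. f x \<noteq> \<zero>} \<union> {x \<in> S. g x \<noteq> \<zero>}"
  have T: "finite ?T" "?T \<subseteq> S" using f g free_module_carrier by auto
  have add: "(f \<oplus>\<^bsub>free_module R S\<^esub> g) x = f x \<oplus> g x" if "x \<in> S" for x
    using that unfolding free_module_def R.func_space_def by simp
  have fgD: "f x \<in> carrier R" "g x \<in> carrier R" "D x \<in> carrier R" if "x \<in> S" for x
    using that f g D free_module_carrier by auto
  have "free_lift R S D (f \<oplus>\<^bsub>free_module R S\<^esub> g)
      = (\<Oplus>x\<in>?T. (f \<oplus>\<^bsub>free_module R S\<^esub> g) x \<otimes> D x)"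
    using T add by (intro free_lift_superset M.M.a_closed f g) auto
  also have "\<dots> = (\<Oplus>x\<in>?T. f x \<otimes> D x \<oplus> g x \<otimes> D x)"
    using T(2) add fgD by (intro R.finsum_cong') (auto simp: R.l_distr)
  also have "\<dots> = (\<Oplus>x\<in>?T. f x \<otimes> D x) \<oplus> (\<Oplus>x\<in>?T. g x \<otimes> D x)"
    using T(2) fgD by (intro R.finsum_addf) auto
  also have "\<dots> = free_lift R S D f \<oplus> free_lift R S D g"
    using free_lift_superset[OF f T] free_lift_superset[OF g T] by auto
  finally show ?thesis .
qed

lemma free_lift_smult:
  assumes c: "c \<in> carrier R" and f: "f \<in> carrier (free_module R S)"
  shows "free_lift R S D (c \<odot>\<^bsub>free_module R S\<^esub> f) = c \<otimes> free_lift R S D f"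
proof -
  let ?T = "{x \<in> S. f x \<noteq> \<zero>}"
  have T: "finite ?T" "?T \<subseteq> S" using f free_module_carrier by auto
  have smult: "(c \<odot>\<^bsub>free_module R S\<^esub> f) x = c \<otimes> f x" if "x \<in> S" for x
    using that unfolding free_module_def R.func_space_def by simp
  have fD: "f x \<in> carrier R" "D x \<in> carrier R" if "x \<in> S" for x
    using that f D free_module_carrier by auto
  have "free_lift R S D (c \<odot>\<^bsub>free_module R S\<^esub> f) = (\<Oplus>x\<in>?T. (c \<odot>\<^bsub>free_module R S\<^esub> f) x \<otimes> D x)"
    using T smult c by (intro free_lift_superset M.smult_closed c f) auto
  also have "\<dots> = (\<Oplus>x\<in>?T. c \<otimes> (f x \<otimes> D x))"
    using smult c fD by (intro R.finsum_cong') (auto simp: R.m_assoc)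
  also have "\<dots> = c \<otimes> free_lift R S D f"
    unfolding free_lift_def using T c fD by (intro R.finsum_rdistr[symmetric]) auto
  finally show ?thesis .
qed

lemma free_gen_closed:
  assumes "x \<in> S" shows "free_gen R S x \<in> carrier (free_module R S)"
proof -
  have "{y \<in> S. free_gen R S x y \<noteq> \<zero>} \<subseteq> {x}" unfolding free_gen_def by auto
  then have "finite {y \<in> S. free_gen R S x y \<noteq> \<zero>}" by (rule finite_subset) simp
  then show ?thesis unfolding free_module_carrier by (auto simp: free_gen_def)
qed

lemma free_lift_gen:
  assumes "x \<in> S" shows "free_lift R S D (free_gen R S x) = D x"
proof -
  have "free_lift R S D (free_gen R S x) = (\<Oplus>y\<in>{x}. free_gen R S x y \<otimes> D y)"
    using assms by (intro free_lift_superset free_gen_closed) (auto simp: free_gen_def)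
  then show ?thesis using assms D by (auto simp: free_gen_def Pi_iff)
qed

lemma free_lift_zero: "free_lift R S D \<zero>\<^bsub>free_module R S\<^esub> = \<zero>"
  using free_lift_smult[OF R.zero_closed M.M.zero_closed] free_lift_closed[OF M.M.zero_closed] by simp

lemma free_lift_diff:
  assumes f: "f \<in> carrier (free_module R S)" and g: "g \<in> carrier (free_module R S)"
  shows "free_lift R S D (f \<ominus>\<^bsub>free_module R S\<^esub> g) = free_lift R S D f \<ominus> free_lift R S D g"
proof -
  have "free_lift R S D f = free_lift R S D ((f \<ominus>\<^bsub>free_module R S\<^esub> g) \<oplus>\<^bsub>free_module R S\<^esub> g)"
    using f g by (simp add: a_minus_def M.M.a_assoc M.M.l_neg)
  also have "\<dots> = free_lift R S D (f \<ominus>\<^bsub>free_module R S\<^esub> g) \<oplus> free_lift R S D g"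
    using f g by (intro free_lift_add) auto
  finally show ?thesis
    using free_lift_closed f g by (simp add: a_minus_def R.a_assoc R.r_neg)
qed

lemma free_lift_span:
  assumes E: "E \<subseteq> carrier (free_module R S)" and z: "\<And>f. f \<in> E \<Longrightarrow> free_lift R S D f = \<zero>"
    and f: "f \<in> M.span E"
  shows "free_lift R S D f = \<zero>"
proof -
  let ?N = "{f \<in> carrier (free_module R S). free_lift R S D f = \<zero>}"
  have "LinearCombinations.submodule R ?N (free_module R S)"
    unfolding LinearCombinations.submodule_def
    using M.module_axioms free_lift_add free_lift_smult free_lift_zero by auto
  then have "M.span E \<subseteq> ?N" using E z by (intro M.span_is_subset) auto
  then show ?thesis using f by auto
qed

end


lemma (in ring) derivation_int:
  fixes n :: int
  assumes D: "derivation R D"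
  shows "D ([n] \<cdot>\<^bsub>R\<^esub> \<one>) = \<zero>"
proof -
  have Dc: "D x \<in> carrier R" if "x \<in> carrier R" for x using D that unfolding derivation_def by auto
  have Da: "D (x \<oplus> y) = D x \<oplus> D y" if "x \<in> carrier R" "y \<in> carrier R" for x y
    using D that unfolding derivation_def by auto
  have Dm: "D (x \<otimes> y) = x \<otimes> D y \<oplus> y \<otimes> D x" if "x \<in> carrier R" "y \<in> carrier R" for x y
    using D that unfolding derivation_def by auto
  have z: "D \<zero> = \<zero>" using Da[of \<zero> \<zero>] Dc[of \<zero>] by (metis add.l_cancel_one' zero_closed r_zero)
  have o: "D \<one> = \<zero>" using Dm[of \<one> \<one>] Dc[of \<one>] by (metis add.l_cancel_one' one_closed l_one)
  have nat: "D ([k] \<cdot>\<^bsub>R\<^esub> \<one>) = \<zero>" for k :: nat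
    by (induction k) (simp_all add: z o Da)
  have neg: "D (\<ominus> x) = \<ominus> D x" if "x \<in> carrier R" for x
    using Da[of "\<ominus> x" x] that Dc by (simp add: z l_neg minus_equality)
  show ?thesis
  proof (cases "0 \<le> n")
    case True
    then show ?thesis using nat by (simp add: add_pow_int_ge)
  next
    case False
    then show ?thesis using nat neg by (simp add: add_pow_int_lt)
  qed
qed

text \<open>Derivations act as linear forms on differentials: from \<open>du = c dt\<close> follows
  \<open>D u = c * D t\<close> for every derivation \<open>D\<close>. An element \<open>u\<close>
  outside the subfield generated by \<open>t\<close> and the \<open>p\<close>-th powers would admit
  a \<open>D\<close> with \<open>D t = 0\<close> and \<open>D u = 1\<close>.\<close>

lemma pdeg_le_1_generator:
  fixes R :: "'f ring" (structure)
  assumes R: "char_p_field R p" and pdeg: "pdeg R \<le> 1"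
  obtains t where "t \<in> carrier R"
    "\<And>x. x \<in> carrier R \<Longrightarrow> \<exists>c. (\<forall>i<p. c i \<in> carrier R) \<and> x = (\<Oplus>i\<in>{..<p}. c i [^] p \<otimes> t [^] i)"
proof -
  interpret R: char_p_field R p by (rule R)
  let ?M = "free_module R (carrier R)" and ?d = "free_gen R (carrier R)"
  let ?\<phi> = "\<lambda>n :: int. [n] \<cdot>\<^bsub>R\<^esub> \<one>"
  interpret M: module R ?M by (rule free_module[OF R.is_cring])
  define E where "E = kaehler_relations \<Z> ?\<phi> R"
  define N where "N = M.span E"
  let ?Q = "quot_module ?M N"
  have d: "?d x \<in> carrier ?M" if "x \<in> carrier R" for x
    by (rule free_gen_closed[OF R.is_cring _ that]) auto
  have EM: "E \<subseteq> carrier ?M"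
    unfolding E_def kaehler_relations_def Let_def using d by (auto intro!: d)
  have N: "LinearCombinations.submodule R N ?M" unfolding N_def by (rule M.span_is_submodule[OF EM])
  note Q = quot_module[OF M.module_axioms N]
  have vs: "vectorspace R ?Q" using Q(1) by (intro vectorspace.intro R.field_axioms)
  have vd: "vdim R ?Q \<le> 1"
    using pdeg unfolding pdeg_def kaehler_module_def Let_def N_def E_def .
  \<comment> \<open>The half of the universal property of the differentials that is needed: the
    linear form of a derivation kills all Kaehler relations.\<close>
  have lift0: "free_lift R (carrier R) D f = \<zero>" if D: "derivation R D" and f: "f \<in> N" for D f
  proof (rule free_lift_span[OF R.is_cring _ EM _ f[unfolded N_def]])
    have Dc: "D x \<in> carrier R" if "x \<in> carrier R" for x using D that unfolding derivation_def by auto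
    have Da: "D (x \<oplus> y) = D x \<oplus> D y" if "x \<in> carrier R" "y \<in> carrier R" for x y
      using D that unfolding derivation_def by auto
    have Dm: "D (x \<otimes> y) = x \<otimes> D y \<oplus> y \<otimes> D x" if "x \<in> carrier R" "y \<in> carrier R" for x y
      using D that unfolding derivation_def by auto
    show DR: "D \<in> carrier R \<rightarrow> carrier R" using Dc by auto
    note lift = free_lift_diff[OF R.is_cring DR] free_lift_add[OF R.is_cring DR]
      free_lift_smult[OF R.is_cring DR] free_lift_gen[OF R.is_cring DR]
    fix f assume "f \<in> E"
    then consider
        x y where "x \<in> carrier R" "y \<in> carrier R"
          "f = ?d (x \<oplus> y) \<ominus>\<^bsub>?M\<^esub> (?d x \<oplus>\<^bsub>?M\<^esub> ?d y)"
      | x y where "x \<in> carrier R" "y \<in> carrier R"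
          "f = ?d (x \<otimes> y) \<ominus>\<^bsub>?M\<^esub> (x \<odot>\<^bsub>?M\<^esub> ?d y \<oplus>\<^bsub>?M\<^esub> y \<odot>\<^bsub>?M\<^esub> ?d x)"
      | n where "f = ?d (?\<phi> n)"
      unfolding E_def kaehler_relations_def Let_def by blast
    then show "free_lift R (carrier R) D f = \<zero>"
    proof cases
      case 1
      then show ?thesis using d Dc Da by (simp add: lift)
    next
      case 2
      then show ?thesis using d Dc Dm by (simp add: lift)
    next
      case 3
      then show ?thesis using R.derivation_int[OF D, of n] by (simp add: lift)
    qed
  qed
  have "\<exists>t\<in>carrier R. \<forall>u\<in>carrier R. \<exists>c\<in>carrier R. ?d u \<ominus>\<^bsub>?M\<^esub> c \<odot>\<^bsub>?M\<^esub> ?d t \<in> N"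
  \<comment> \<open>If all differentials vanish, any \<open>t\<close> works with \<open>c\<close>
    zero, and the unit is taken. Otherwise some \<open>dt\<close> is nonzero and spans, as the
    dimension is at most one.\<close>
  proof (cases "\<forall>t\<in>carrier R. N +>\<^bsub>?M\<^esub> ?d t = N +>\<^bsub>?M\<^esub> \<zero>\<^bsub>?M\<^esub>")
    case True
    have "?d u \<ominus>\<^bsub>?M\<^esub> \<zero> \<odot>\<^bsub>?M\<^esub> ?d \<one> \<in> N" if u: "u \<in> carrier R" for u
      using Q(4)[OF d[OF u] M.M.zero_closed] True u d by simp
    then show ?thesis by (intro bexI[of _ "\<one>"] ballI bexI[of _ "\<zero>"]) auto
  next
    case False
    then obtain t where t: "t \<in> carrier R" "N +>\<^bsub>?M\<^esub> ?d t \<noteq> N +>\<^bsub>?M\<^esub> \<zero>\<^bsub>?M\<^esub>" by auto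
    interpret Qm: module R ?Q by (rule Q(1))
    have "\<zero>\<^bsub>?Q\<^esub> = N +>\<^bsub>?M\<^esub> \<zero>\<^bsub>?M\<^esub>"
      using Q(3)[OF R.zero_closed M.M.zero_closed] Q(2)[OF M.M.zero_closed] by simp
    then have t0: "N +>\<^bsub>?M\<^esub> ?d t \<noteq> \<zero>\<^bsub>?Q\<^esub>" using t by simp
    have "\<exists>c\<in>carrier R. ?d u \<ominus>\<^bsub>?M\<^esub> c \<odot>\<^bsub>?M\<^esub> ?d t \<in> N" if u: "u \<in> carrier R" for u
    proof -
      obtain c where c: "c \<in> carrier R" "N +>\<^bsub>?M\<^esub> ?d u = c \<odot>\<^bsub>?Q\<^esub> (N +>\<^bsub>?M\<^esub> ?d t)"
        using vdim_le_1_multiple[OF vs vd Q(2)[OF d[OF t(1)]] t0 Q(2)[OF d[OF u]]] by blast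
      then have "?d u \<ominus>\<^bsub>?M\<^esub> c \<odot>\<^bsub>?M\<^esub> ?d t \<in> N"
        using Q(3)[OF c(1) d[OF t(1)]] d[OF t(1)] t(1) by (intro Q(4) d u M.smult_closed) auto
      then show ?thesis using c(1) by blast
    qed
    then show ?thesis using t by blast
  qed
  then obtain t where t: "t \<in> carrier R"
    "\<And>u. u \<in> carrier R \<Longrightarrow> \<exists>c\<in>carrier R. ?d u \<ominus>\<^bsub>?M\<^esub> c \<odot>\<^bsub>?M\<^esub> ?d t \<in> N" by blast
  define K where "K = (\<lambda>x. x [^] p) ` carrier R"
  have K: "subfield K R" unfolding K_def by (rule R.pth_powers_subfield)
  have Ks: "subring K R" "K \<subseteq> carrier R" using subfieldE(1)[OF K] subringE(1) by auto
  let ?L = "R.simple_extension K t"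
  have L: "subring ?L R" by (rule R.simple_extension_is_subring[OF Ks(1) t(1)])
  have KL: "K \<subseteq> ?L" by (rule R.simple_extension_incl[OF Ks(2) t(1)])
  have tL: "t \<in> ?L" by (rule R.simple_extension_mem[OF Ks(1) t(1)])
  have all: "u \<in> ?L" if u: "u \<in> carrier R" for u
  proof (rule ccontr)
    assume uL: "u \<notin> ?L"
    obtain D where D: "derivation R D" "D u = \<one>" "\<And>x. x \<in> ?L \<Longrightarrow> D x = \<zero>"
      using R.exists_derivation[OF L _ u uL] KL unfolding K_def by blast
    have DR: "D \<in> carrier R \<rightarrow> carrier R" using D(1) unfolding derivation_def by auto
    obtain c where c: "c \<in> carrier R" "?d u \<ominus>\<^bsub>?M\<^esub> c \<odot>\<^bsub>?M\<^esub> ?d t \<in> N" using t(2)[OF u] by blast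
    have "\<zero> = free_lift R (carrier R) D (?d u \<ominus>\<^bsub>?M\<^esub> c \<odot>\<^bsub>?M\<^esub> ?d t)"
      using lift0[OF D(1) c(2)] ..
    also have "\<dots> = D u \<ominus> c \<otimes> D t"
      using d[OF u] d[OF t(1)] c(1) u t(1)
      by (simp add: free_lift_diff[OF R.is_cring DR] free_lift_smult[OF R.is_cring DR] free_lift_gen[OF R.is_cring DR])
    also have "\<dots> = \<one>" using D(2) D(3)[OF tL] c(1) by (simp add: a_minus_def)
    finally show False by simp
  qed
  show thesis
  proof (rule that[OF t(1)])
    fix x assume x: "x \<in> carrier R"
    show "\<exists>c. (\<forall>i<p. c i \<in> carrier R) \<and> x = (\<Oplus>i\<in>{..<p}. c i [^] p \<otimes> t [^] i)"
    \<comment> \<open>If \<open>t\<close> is itself a \<open>p\<close>-th power, adjoining it gives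
      nothing new, every element is a \<open>p\<close>-th power, and a constant expansion suffices.
      Otherwise the powers of \<open>t\<close> below \<open>p\<close> form a basis over the
      \<open>p\<close>-th powers.\<close>
    proof (cases "t \<in> K")
      case True
      have "x \<in> K" using all[OF x] R.simple_extension_subring_incl[OF Ks(1) _ True, of K] by auto
      then obtain y where y: "y \<in> carrier R" "x = y [^] p" unfolding K_def by auto
      let ?c = "\<lambda>i :: nat. if i = 0 then y else \<zero>"
      have "(\<Oplus>i\<in>{..<p}. ?c i [^] p \<otimes> t [^] i) = (\<Oplus>i\<in>{0 :: nat}. ?c i [^] p \<otimes> t [^] i)"
        using y t R.frobenius_zero[of 1] R.p_pos
        by (intro R.add.finprod_mono_neutral_cong_right) auto
      also have "\<dots> = x" using y by simp
      finally show ?thesis using y by (intro exI[of _ ?c]) auto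
    next
      case False
      obtain m where m: "\<And>i. i < p \<Longrightarrow> m i \<in> K" "x = (\<Oplus>i\<in>{..<p}. m i \<otimes> t [^] i)"
        using R.simple_extension_eq_combinations[OF K _ t(1) False all[OF x]] unfolding K_def by blast
      have "\<forall>i. \<exists>c. i < p \<longrightarrow> c \<in> carrier R \<and> m i = c [^] p" using m(1) unfolding K_def by blast
      then obtain c where c: "\<And>i. i < p \<Longrightarrow> c i \<in> carrier R \<and> m i = c i [^] p" by metis
      have "x = (\<Oplus>i\<in>{..<p}. c i [^] p \<otimes> t [^] i)"
        unfolding m(2) using c t by (intro R.finsum_cong') auto
      then show ?thesis using c by blast
    qed
  qed
qed

section \<open>The perfect closure\<close>

text \<open>The set consists of the multiples of the additive order of the unit, so its
  \<open>Gcd\<close> is that order, also when the order is \<open>0\<close>.\<close>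

lemma (in field) ring_char_dvd_iff:
  fixes n :: nat
  shows "[n] \<cdot>\<^bsub>R\<^esub> \<one> = \<zero> \<longleftrightarrow> Gcd {n. [n] \<cdot>\<^bsub>R\<^esub> \<one> = \<zero>} dvd n"
proof -
  have iff: "[n] \<cdot>\<^bsub>R\<^esub> \<one> = \<zero> \<longleftrightarrow> add.ord \<one> dvd n" for n :: nat
    by (rule add.pow_eq_id) simp
  have "Gcd {n. add.ord \<one> dvd n} = add.ord \<one>"
    by (intro dvd_antisym Gcd_dvd Gcd_greatest) auto
  then show ?thesis unfolding iff by simp
qed

text \<open>Fixes the record type to \<open>'f ring\<close>, on which \<open>ring_char\<close> and
  \<open>perf_closure\<close> are defined.\<close>

locale char_p_field_ring = char_p_field F p for F :: "'f ring" (structure) and p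
begin

lemma ring_char: "ring_char F = p"
proof -
  have "ring_char F dvd p"
    using ring_char_dvd_iff[of p] char_p unfolding ring_char_def by simp
  moreover have "ring_char F \<noteq> 1"
    using ring_char_dvd_iff[of 1] unfolding ring_char_def by simp
  ultimately show ?thesis using prime_p by (auto simp: prime_nat_iff)
qed

end

lemma char_p_field_ringI:
  fixes F :: "'f ring"
  assumes "field F" and p: "ring_char F = p" "p > 0"
  shows "char_p_field_ring F p"
proof -
  interpret field F by fact
  have iff: "[n] \<cdot>\<^bsub>F\<^esub> \<one>\<^bsub>F\<^esub> = \<zero>\<^bsub>F\<^esub> \<longleftrightarrow> p dvd n" for n :: nat
    using ring_char_dvd_iff p unfolding ring_char_def by simp
  have "Factorial_Ring.prime p"
  proof (unfold prime_nat_iff, intro conjI allI impI)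
    have "p \<noteq> 1" using iff[of 1] by auto
    then show "1 < p" using p by simp
    fix m assume "m dvd p"
    then obtain k where k: "p = m * k" by auto
    have "([m] \<cdot>\<^bsub>F\<^esub> \<one>\<^bsub>F\<^esub>) \<otimes>\<^bsub>F\<^esub> ([k] \<cdot>\<^bsub>F\<^esub> \<one>\<^bsub>F\<^esub>) = [p] \<cdot>\<^bsub>F\<^esub> \<one>\<^bsub>F\<^esub>"
      unfolding k by (simp add: add_pow_ldistr add.nat_pow_pow mult.commute)
    then have "([m] \<cdot>\<^bsub>F\<^esub> \<one>\<^bsub>F\<^esub>) \<otimes>\<^bsub>F\<^esub> ([k] \<cdot>\<^bsub>F\<^esub> \<one>\<^bsub>F\<^esub>) = \<zero>\<^bsub>F\<^esub>" using iff[of p] by simp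
    then have "[m] \<cdot>\<^bsub>F\<^esub> \<one>\<^bsub>F\<^esub> = \<zero>\<^bsub>F\<^esub> \<or> [k] \<cdot>\<^bsub>F\<^esub> \<one>\<^bsub>F\<^esub> = \<zero>\<^bsub>F\<^esub>"
      by (rule integral) auto
    then have "p dvd m \<or> p dvd k" using iff by simp
    then show "m = 1 \<or> m = p" using k p(2) by (auto dest!: dvd_imp_le elim!: dvdE)
  qed
  then show ?thesis
    using iff[of p] by unfold_locales auto
qed

context char_p_field_ring
begin

lemma mem_perf_elem: "(y, m) \<in> perf_elem F x n \<longleftrightarrow> y \<in> carrier F \<and> x [^] (p ^ m) = y [^] (p ^ n)"
  unfolding perf_elem_def ring_char by auto

lemma pow_pow_commute: "x \<in> carrier F \<Longrightarrow> (x [^] (a :: nat)) [^] (b :: nat) = (x [^] b) [^] a"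
  by (simp add: nat_pow_pow mult.commute)

text \<open>Transitivity of the relation behind \<open>perf_elem\<close> requires cancelling a
  \<open>p^n\<close>-th power, which is injectivity of the Frobenius.\<close>

lemma perf_elem_eq_iff:
  assumes x: "x \<in> carrier F" and y: "y \<in> carrier F"
  shows "perf_elem F x n = perf_elem F y m \<longleftrightarrow> x [^] (p ^ m) = y [^] (p ^ n)"
proof
  assume "perf_elem F x n = perf_elem F y m"
  moreover have "(y, m) \<in> perf_elem F y m" using y by (simp add: mem_perf_elem)
  ultimately have "(y, m) \<in> perf_elem F x n" by simp
  then show "x [^] (p ^ m) = y [^] (p ^ n)" by (simp add: mem_perf_elem)
next
  assume *: "x [^] (p ^ m) = y [^] (p ^ n)"
  have sub: "perf_elem F x n \<subseteq> perf_elem F y m"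
    if x: "x \<in> carrier F" and y: "y \<in> carrier F" and *: "x [^] (p ^ m) = y [^] (p ^ n)" for x y n m
  proof
    fix w assume "w \<in> perf_elem F x n"
    then obtain z k where w: "w = (z, k)" "z \<in> carrier F" "x [^] (p ^ k) = z [^] (p ^ n)"
      by (cases w) (auto simp: mem_perf_elem)
    have "(y [^] (p ^ k)) [^] (p ^ n) = (x [^] (p ^ m)) [^] (p ^ k)"
      unfolding * using y by (rule pow_pow_commute)
    also have "\<dots> = (z [^] (p ^ n)) [^] (p ^ m)"
      unfolding w(3)[symmetric] using x by (rule pow_pow_commute)
    also have "\<dots> = (z [^] (p ^ m)) [^] (p ^ n)" using w(2) by (rule pow_pow_commute)
    finally have "y [^] (p ^ k) = z [^] (p ^ m)"
      using frobenius_inj y w(2) by (metis nat_pow_closed)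
    then show "w \<in> perf_elem F y m" using w by (simp add: mem_perf_elem)
  qed
  show "perf_elem F x n = perf_elem F y m"
    using sub[OF x y *] sub[OF y x *[symmetric]] by auto
qed

lemma perf_elem_shift:
  assumes "x \<in> carrier F" shows "perf_elem F x n = perf_elem F (x [^] (p ^ k)) (n + k)"
  using assms by (subst perf_elem_eq_iff) (auto simp: nat_pow_pow power_add mult.commute)

lemma perf_closure_carrier: "carrier (perf_closure F) = {perf_elem F x n | x n. x \<in> carrier F}"
  unfolding perf_closure_def Let_def by simp

lemma perf_elem_closed: "x \<in> carrier F \<Longrightarrow> perf_elem F x n \<in> carrier (perf_closure F)"
  unfolding perf_closure_carrier by auto

lemma Union_perf_elem:
  assumes x: "x \<in> carrier F" and y: "y \<in> carrier F"
    and eq: "\<And>x' n' y' m'. \<lbrakk>(x', n') \<in> perf_elem F x n; (y', m') \<in> perf_elem F y m\<rbrakk> \<Longrightarrow> f x' n' y' m' = c"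
  shows "(\<Union>(x', n')\<in>perf_elem F x n. \<Union>(y', m')\<in>perf_elem F y m. f x' n' y' m') = c"
proof -
  have "(x, n) \<in> perf_elem F x n" "(y, m) \<in> perf_elem F y m" using x y by (auto simp: mem_perf_elem)
  then show ?thesis using eq by (auto split: prod.splits) blast+
qed

text \<open>Sum and product are treated together: independence of representatives only uses that the
  operation \<open>g\<close> commutes with \<open>p^k\<close>-th powers. A single level
  \<open>n\<close> for both arguments suffices, since finitely many elements can be brought to a
  common level.\<close>

lemma Union_perf_elem_op:
  assumes x: "x \<in> carrier F" and y: "y \<in> carrier F"
    and g: "\<And>a b. \<lbrakk>a \<in> carrier F; b \<in> carrier F\<rbrakk> \<Longrightarrow> g a b \<in> carrier F"
    and gp: "\<And>a b k. \<lbrakk>a \<in> carrier F; b \<in> carrier F\<rbrakk> \<Longrightarrow> g a b [^] (p ^ k) = g (a [^] (p ^ k)) (b [^] (p ^ k))"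
  shows "(\<Union>(x', n')\<in>perf_elem F x n. \<Union>(y', m')\<in>perf_elem F y n.
    perf_elem F (g (x' [^] (p ^ m')) (y' [^] (p ^ n'))) (n' + m')) = perf_elem F (g x y) n"
proof (rule Union_perf_elem[OF x y])
  fix x' n' y' m' assume "(x', n') \<in> perf_elem F x n" "(y', m') \<in> perf_elem F y n"
  then have x': "x' \<in> carrier F" "x [^] (p ^ n') = x' [^] (p ^ n)"
    and y': "y' \<in> carrier F" "y [^] (p ^ m') = y' [^] (p ^ n)" by (auto simp: mem_perf_elem)
  have "g (x' [^] (p ^ m')) (y' [^] (p ^ n')) [^] (p ^ n)
    = g ((x' [^] (p ^ n)) [^] (p ^ m')) ((y' [^] (p ^ n)) [^] (p ^ n'))"
    using x'(1) y'(1) by (simp add: gp pow_pow_commute[of _ "p ^ n"])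
  also have "\<dots> = g x y [^] (p ^ (n' + m'))"
    unfolding x'(2)[symmetric] y'(2)[symmetric]
    using x y by (simp add: gp nat_pow_pow power_add[symmetric] add.commute)
  finally show "perf_elem F (g (x' [^] (p ^ m')) (y' [^] (p ^ n'))) (n' + m') = perf_elem F (g x y) n"
    using x y x'(1) y'(1) g by (subst perf_elem_eq_iff) auto
qed

lemma perf_mult:
  "\<lbrakk>x \<in> carrier F; y \<in> carrier F\<rbrakk> \<Longrightarrow>
    perf_elem F x n \<otimes>\<^bsub>perf_closure F\<^esub> perf_elem F y n = perf_elem F (x \<otimes> y) n"
  unfolding perf_closure_def Let_def ring_char monoid.simps
  by (rule Union_perf_elem_op) (auto simp: nat_pow_distrib)

lemma perf_add:
  "\<lbrakk>x \<in> carrier F; y \<in> carrier F\<rbrakk> \<Longrightarrow>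
    perf_elem F x n \<oplus>\<^bsub>perf_closure F\<^esub> perf_elem F y n = perf_elem F (x \<oplus> y) n"
  unfolding perf_closure_def Let_def ring_char ring.simps
  by (rule Union_perf_elem_op) (auto simp: frobenius_add)

lemma perf_zero: "\<zero>\<^bsub>perf_closure F\<^esub> = perf_elem F \<zero> n"
proof -
  have "\<zero>\<^bsub>perf_closure F\<^esub> = perf_elem F \<zero> 0" unfolding perf_closure_def Let_def by simp
  then show ?thesis using perf_elem_shift[of \<zero> 0 n] frobenius_zero by simp
qed

lemma perf_one: "\<one>\<^bsub>perf_closure F\<^esub> = perf_elem F \<one> n"
proof -
  have "\<one>\<^bsub>perf_closure F\<^esub> = perf_elem F \<one> 0" unfolding perf_closure_def Let_def by simp
  then show ?thesis using perf_elem_shift[of \<one> 0 n] by simp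
qed

lemma perf_elemE:
  assumes "U \<in> carrier (perf_closure F)"
  obtains x n where "x \<in> carrier F" "U = perf_elem F x n"
  using assms unfolding perf_closure_carrier by auto

lemma perf_elem_common:
  assumes "U \<in> carrier (perf_closure F)" "V \<in> carrier (perf_closure F)" "W \<in> carrier (perf_closure F)"
  obtains n x y z where "x \<in> carrier F" "y \<in> carrier F" "z \<in> carrier F"
    "U = perf_elem F x n" "V = perf_elem F y n" "W = perf_elem F z n"
proof -
  obtain x y z a b c where *: "x \<in> carrier F" "y \<in> carrier F" "z \<in> carrier F"
    "U = perf_elem F x a" "V = perf_elem F y b" "W = perf_elem F z c"
    using assms perf_elemE by metis
  show thesis
    using * perf_elem_shift[of x a "b + c"] perf_elem_shift[of y b "a + c"] perf_elem_shift[of z c "a + b"]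
    by (intro that[of "x [^] (p ^ (b + c))" "y [^] (p ^ (a + c))" "z [^] (p ^ (a + b))" "a + b + c"])
      (auto simp: ac_simps)
qed

lemma perf_closure_cring: "cring (perf_closure F)"
proof (rule cringI)
  let ?E = "perf_closure F"
  show "abelian_group ?E"
  proof (rule abelian_groupI)
    fix U V assume U: "U \<in> carrier ?E" and V: "V \<in> carrier ?E"
    obtain n x y where *: "x \<in> carrier F" "y \<in> carrier F" "U = perf_elem F x n" "V = perf_elem F y n"
      using perf_elem_common[OF U V V] by metis
    show "U \<oplus>\<^bsub>?E\<^esub> V \<in> carrier ?E" using * by (simp add: perf_add perf_elem_closed)
    show "U \<oplus>\<^bsub>?E\<^esub> V = V \<oplus>\<^bsub>?E\<^esub> U" using * by (simp add: perf_add a_comm)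
    fix W assume W: "W \<in> carrier ?E"
    obtain n x y z where *: "x \<in> carrier F" "y \<in> carrier F" "z \<in> carrier F"
      "U = perf_elem F x n" "V = perf_elem F y n" "W = perf_elem F z n"
      using perf_elem_common[OF U V W] by metis
    show "U \<oplus>\<^bsub>?E\<^esub> V \<oplus>\<^bsub>?E\<^esub> W = U \<oplus>\<^bsub>?E\<^esub> (V \<oplus>\<^bsub>?E\<^esub> W)" using * by (simp add: perf_add a_assoc)
  next
    show "\<zero>\<^bsub>?E\<^esub> \<in> carrier ?E" unfolding perf_zero[of 0] by (simp add: perf_elem_closed)
  next
    fix U assume "U \<in> carrier ?E"
    then obtain x n where *: "x \<in> carrier F" "U = perf_elem F x n" by (rule perf_elemE)
    show "\<zero>\<^bsub>?E\<^esub> \<oplus>\<^bsub>?E\<^esub> U = U" using * by (simp add: perf_add perf_zero[of n])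
    show "\<exists>V\<in>carrier ?E. V \<oplus>\<^bsub>?E\<^esub> U = \<zero>\<^bsub>?E\<^esub>"
      using * by (intro bexI[of _ "perf_elem F (\<ominus> x) n"])
        (auto simp: perf_add perf_zero[of n] l_neg perf_elem_closed)
  qed
  show "Group.comm_monoid ?E"
  proof (rule comm_monoidI)
    fix U V assume U: "U \<in> carrier ?E" and V: "V \<in> carrier ?E"
    obtain n x y where *: "x \<in> carrier F" "y \<in> carrier F" "U = perf_elem F x n" "V = perf_elem F y n"
      using perf_elem_common[OF U V V] by metis
    show "U \<otimes>\<^bsub>?E\<^esub> V \<in> carrier ?E" using * by (simp add: perf_mult perf_elem_closed)
    show "U \<otimes>\<^bsub>?E\<^esub> V = V \<otimes>\<^bsub>?E\<^esub> U" using * by (simp add: perf_mult m_comm)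
    fix W assume W: "W \<in> carrier ?E"
    obtain n x y z where *: "x \<in> carrier F" "y \<in> carrier F" "z \<in> carrier F"
      "U = perf_elem F x n" "V = perf_elem F y n" "W = perf_elem F z n"
      using perf_elem_common[OF U V W] by metis
    show "U \<otimes>\<^bsub>?E\<^esub> V \<otimes>\<^bsub>?E\<^esub> W = U \<otimes>\<^bsub>?E\<^esub> (V \<otimes>\<^bsub>?E\<^esub> W)" using * by (simp add: perf_mult m_assoc)
  next
    show "\<one>\<^bsub>?E\<^esub> \<in> carrier ?E" unfolding perf_one[of 0] by (simp add: perf_elem_closed)
  next
    fix U assume "U \<in> carrier ?E"
    then obtain x n where *: "x \<in> carrier F" "U = perf_elem F x n" by (rule perf_elemE)
    show "\<one>\<^bsub>?E\<^esub> \<otimes>\<^bsub>?E\<^esub> U = U" using * by (simp add: perf_mult perf_one[of n])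
  qed
next
  let ?E = "perf_closure F"
  fix U V W assume U: "U \<in> carrier ?E" and V: "V \<in> carrier ?E" and W: "W \<in> carrier ?E"
  obtain n x y z where *: "x \<in> carrier F" "y \<in> carrier F" "z \<in> carrier F"
      "U = perf_elem F x n" "V = perf_elem F y n" "W = perf_elem F z n"
    using perf_elem_common[OF U V W] by metis
  show "(U \<oplus>\<^bsub>?E\<^esub> V) \<otimes>\<^bsub>?E\<^esub> W = U \<otimes>\<^bsub>?E\<^esub> W \<oplus>\<^bsub>?E\<^esub> V \<otimes>\<^bsub>?E\<^esub> W"
    using * by (simp add: perf_mult perf_add l_distr)
qed

lemma perf_embed_hom: "perf_embed F \<in> ring_hom F (perf_closure F)"
  unfolding perf_embed_def
  by (rule ring_hom_memI) (auto simp: perf_elem_closed perf_mult perf_add perf_one[of 0])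

lemma perf_closure_field: "field (perf_closure F)"
proof -
  let ?E = "perf_closure F"
  interpret E: cring ?E by (rule perf_closure_cring)
  show ?thesis
  proof (rule E.cring_fieldI2)
    show "\<zero>\<^bsub>?E\<^esub> \<noteq> \<one>\<^bsub>?E\<^esub>"
      unfolding perf_one[of 0] perf_zero[of 0] by (subst perf_elem_eq_iff) auto
    fix U assume "U \<in> carrier ?E" and X0: "U \<noteq> \<zero>\<^bsub>?E\<^esub>"
    then obtain x n where x: "x \<in> carrier F" "U = perf_elem F x n" using perf_elemE by blast
    have "x \<noteq> \<zero>" using X0 x perf_zero[of n] by auto
    then have xU: "x \<in> Units F" using x field_Units by auto
    then show "\<exists>V\<in>carrier ?E. U \<otimes>\<^bsub>?E\<^esub> V = \<one>\<^bsub>?E\<^esub>"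
      using x by (intro bexI[of _ "perf_elem F (inv x) n"])
        (auto simp: perf_mult perf_one[of n] perf_elem_closed)
  qed
qed

lemma perf_closure_char_p: "char_p_field_ring (perf_closure F) p"
  by (intro char_p_field_ring.intro char_p_field.intro perf_closure_field
      char_p_ring_hom[OF char_p_ring_axioms perf_closure_cring perf_embed_hom])

lemma perf_pow:
  assumes "x \<in> carrier F"
  shows "perf_elem F x n [^]\<^bsub>perf_closure F\<^esub> (k :: nat) = perf_elem F (x [^] k) n"
proof -
  interpret E: cring "perf_closure F" by (rule perf_closure_cring)
  show ?thesis using assms by (induction k) (auto simp: perf_mult perf_one[of n])
qed

lemma perf_elem_pow_p: "x \<in> carrier F \<Longrightarrow> perf_elem F x n [^]\<^bsub>perf_closure F\<^esub> (p ^ n) = perf_embed F x"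
  unfolding perf_embed_def using perf_elem_shift[of x 0 n] by (simp add: perf_pow)

end

text \<open>Functoriality of the perfect closure. It provides a map from the perfect closure of
  \<open>F\<close> to that of \<open>K\<close>, and with it a nonzero ring that receives both tensor
  factors.\<close>

definition perf_map :: "'k ring \<Rightarrow> ('f \<Rightarrow> 'k) \<Rightarrow> ('f \<times> nat) set \<Rightarrow> ('k \<times> nat) set" where
  "perf_map K \<alpha> U = (\<Union>(x, n)\<in>U. perf_elem K (\<alpha> x) n)"

lemma perf_map:
  fixes F :: "'f ring" and K :: "'k ring"
  assumes F: "char_p_field_ring F p" and K: "char_p_field_ring K p" and \<alpha>: "\<alpha> \<in> ring_hom F K"
  shows "x \<in> carrier F \<Longrightarrow> perf_map K \<alpha> (perf_elem F x n) = perf_elem K (\<alpha> x) n"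
    and "perf_map K \<alpha> \<in> ring_hom (perf_closure F) (perf_closure K)"
proof -
  interpret F: char_p_field_ring F p by (rule F)
  interpret K: char_p_field_ring K p by (rule K)
  interpret \<alpha>: ring_hom_ring F K \<alpha> by (intro ring_hom_ringI2 F.ring_axioms K.ring_axioms \<alpha>)
  show elem: "perf_map K \<alpha> (perf_elem F x n) = perf_elem K (\<alpha> x) n" if x: "x \<in> carrier F" for x n
  proof -
    have *: "perf_elem K (\<alpha> y) m = perf_elem K (\<alpha> x) n" if "(y, m) \<in> perf_elem F x n" for y m
    proof -
      have y: "y \<in> carrier F" "x [^]\<^bsub>F\<^esub> (p ^ m) = y [^]\<^bsub>F\<^esub> (p ^ n)"
        using that by (auto simp: F.mem_perf_elem)
      then show ?thesis using x
        by (subst K.perf_elem_eq_iff) (auto simp: \<alpha>.hom_nat_pow[symmetric])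
    qed
    have "(x, n) \<in> perf_elem F x n" using x by (simp add: F.mem_perf_elem)
    moreover have "\<forall>w\<in>perf_elem F x n. (case w of (y, m) \<Rightarrow> perf_elem K (\<alpha> y) m) = perf_elem K (\<alpha> x) n"
      using * by (simp only: split_paired_Ball_Sigma split_paired_all prod.case Ball_def split: prod.split) blast
    ultimately show ?thesis unfolding perf_map_def by (rule UN_constant_eq)
  qed
  show "perf_map K \<alpha> \<in> ring_hom (perf_closure F) (perf_closure K)"
  proof (rule ring_hom_memI)
    fix U assume U: "U \<in> carrier (perf_closure F)"
    then obtain x n where "x \<in> carrier F" "U = perf_elem F x n" by (rule F.perf_elemE)
    then show "perf_map K \<alpha> U \<in> carrier (perf_closure K)" using elem K.perf_elem_closed by simp
    fix V assume V: "V \<in> carrier (perf_closure F)"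
    obtain n x y where *: "x \<in> carrier F" "y \<in> carrier F" "U = perf_elem F x n" "V = perf_elem F y n"
      using F.perf_elem_common[OF U V V] by metis
    show "perf_map K \<alpha> (U \<otimes>\<^bsub>perf_closure F\<^esub> V) = perf_map K \<alpha> U \<otimes>\<^bsub>perf_closure K\<^esub> perf_map K \<alpha> V"
      using * by (simp add: elem F.perf_mult K.perf_mult)
    show "perf_map K \<alpha> (U \<oplus>\<^bsub>perf_closure F\<^esub> V) = perf_map K \<alpha> U \<oplus>\<^bsub>perf_closure K\<^esub> perf_map K \<alpha> V"
      using * by (simp add: elem F.perf_add K.perf_add)
  next
    show "perf_map K \<alpha> \<one>\<^bsub>perf_closure F\<^esub> = \<one>\<^bsub>perf_closure K\<^esub>"
      by (simp add: F.perf_one[of 0] K.perf_one[of 0] elem)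
  qed
qed

section \<open>Tensor products of rings\<close>

lemma frag_extend_add_fun:
  "frag_extend (\<lambda>x. f x + g x) c = frag_extend f c + frag_extend g c"
  by (rule frag_induction[of c UNIV]) (auto simp: frag_extend_diff)

lemma frag_extend_diff_fun:
  "frag_extend (\<lambda>x. f x - g x) c = frag_extend f c - frag_extend g c"
  by (rule frag_induction[of c UNIV]) (auto simp: frag_extend_diff)

lemma frag_extend_zero_fun: "frag_extend (\<lambda>x. 0) c = 0"
  by (rule frag_induction[of c UNIV]) (auto simp: frag_extend_diff)

locale tensor_product = A: cring A + B: cring B
  for A :: "'a ring" and B :: "'b ring" +
  fixes C :: "'c ring" and \<alpha> :: "'c \<Rightarrow> 'a" and \<beta> :: "'c \<Rightarrow> 'b"
  assumes \<alpha>: "\<alpha> \<in> ring_hom C A" and \<beta>: "\<beta> \<in> ring_hom C B"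
begin

abbreviation "FT \<equiv> formal_tensors A B"

lemma FT_carrier: "carrier FT = {c. Poly_Mapping.keys c \<subseteq> carrier A \<times> carrier B}"
  unfolding formal_tensors_def by simp

lemma FT_simps [simp]: "c \<oplus>\<^bsub>FT\<^esub> d = c + d" "\<zero>\<^bsub>FT\<^esub> = 0" "\<one>\<^bsub>FT\<^esub> = frag_of (\<one>\<^bsub>A\<^esub>, \<one>\<^bsub>B\<^esub>)"
  unfolding formal_tensors_def by simp_all

lemma FT_closed:
  "0 \<in> carrier FT" "c \<in> carrier FT \<Longrightarrow> d \<in> carrier FT \<Longrightarrow> c + d \<in> carrier FT"
  "c \<in> carrier FT \<Longrightarrow> d \<in> carrier FT \<Longrightarrow> c - d \<in> carrier FT"
  "c \<in> carrier FT \<Longrightarrow> - c \<in> carrier FT"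
  "a \<in> carrier A \<Longrightarrow> b \<in> carrier B \<Longrightarrow> frag_of (a, b) \<in> carrier FT"
  unfolding FT_carrier using keys_add[of c d] keys_diff[of c d] by (auto simp: keys_frag_of)

lemma FT_induct [consumes 1, case_names zero frag diff]:
  assumes "c \<in> carrier FT" and "P 0"
    and "\<And>a b. \<lbrakk>a \<in> carrier A; b \<in> carrier B\<rbrakk> \<Longrightarrow> P (frag_of (a, b))"
    and "\<And>c d. \<lbrakk>P c; P d\<rbrakk> \<Longrightarrow> P (c - d)"
  shows "P c"
  using assms by (intro frag_induction[of c "carrier A \<times> carrier B" P]) (auto simp: FT_carrier)

lemma FT_mult:
  "c \<otimes>\<^bsub>FT\<^esub> d = frag_extend (\<lambda>(a, b). frag_extend (\<lambda>(a', b'). frag_of (a \<otimes>\<^bsub>A\<^esub> a', b \<otimes>\<^bsub>B\<^esub> b')) d) c"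
  unfolding formal_tensors_def by simp

lemma FT_mult_simps [simp]:
  "frag_of (a, b) \<otimes>\<^bsub>FT\<^esub> frag_of (a', b') = frag_of (a \<otimes>\<^bsub>A\<^esub> a', b \<otimes>\<^bsub>B\<^esub> b')"
  "0 \<otimes>\<^bsub>FT\<^esub> c = 0" "c \<otimes>\<^bsub>FT\<^esub> 0 = 0"
  "(c - d) \<otimes>\<^bsub>FT\<^esub> e = c \<otimes>\<^bsub>FT\<^esub> e - d \<otimes>\<^bsub>FT\<^esub> e" "c \<otimes>\<^bsub>FT\<^esub> (d - e) = c \<otimes>\<^bsub>FT\<^esub> d - c \<otimes>\<^bsub>FT\<^esub> e"
  "(c + d) \<otimes>\<^bsub>FT\<^esub> e = c \<otimes>\<^bsub>FT\<^esub> e + d \<otimes>\<^bsub>FT\<^esub> e" "c \<otimes>\<^bsub>FT\<^esub> (d + e) = c \<otimes>\<^bsub>FT\<^esub> d + c \<otimes>\<^bsub>FT\<^esub> e"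
  unfolding FT_mult
  by (simp_all add: frag_extend_diff frag_extend_add frag_extend_zero_fun
      frag_extend_diff_fun[symmetric] frag_extend_add_fun[symmetric] case_prod_unfold)

lemma FT_mult_closed:
  assumes "c \<in> carrier FT" "d \<in> carrier FT" shows "c \<otimes>\<^bsub>FT\<^esub> d \<in> carrier FT"
  using assms(1)
proof (induction c rule: FT_induct)
  case (frag a b)
  show ?case using assms(2) by (induction d rule: FT_induct) (auto simp: frag FT_closed)
qed (auto simp: FT_closed)

lemma FT_comm:
  assumes "c \<in> carrier FT" "d \<in> carrier FT" shows "c \<otimes>\<^bsub>FT\<^esub> d = d \<otimes>\<^bsub>FT\<^esub> c"
  using assms(1)
proof (induction c rule: FT_induct)
  case (frag a b)
  show ?case using assms(2)
    by (induction d rule: FT_induct) (auto simp: frag A.m_comm B.m_comm)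
qed auto

lemma FT_assoc:
  assumes "c \<in> carrier FT" "d \<in> carrier FT" "e \<in> carrier FT"
  shows "c \<otimes>\<^bsub>FT\<^esub> d \<otimes>\<^bsub>FT\<^esub> e = c \<otimes>\<^bsub>FT\<^esub> (d \<otimes>\<^bsub>FT\<^esub> e)"
  using assms(1)
proof (induction c rule: FT_induct)
  case (frag a b)
  note ab = frag
  show ?case using assms(2)
  proof (induction d rule: FT_induct)
    case (frag a' b')
    show ?case using assms(3)
      by (induction e rule: FT_induct) (auto simp: ab frag A.m_assoc B.m_assoc)
  qed auto
qed auto

lemma FT_one_left:
  assumes "c \<in> carrier FT" shows "frag_of (\<one>\<^bsub>A\<^esub>, \<one>\<^bsub>B\<^esub>) \<otimes>\<^bsub>FT\<^esub> c = c"
  using assms by (induction c rule: FT_induct) auto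

lemma FT_cring: "cring FT"
proof (rule cringI)
  show "abelian_group FT"
    by (rule abelian_groupI) (auto simp: FT_closed ac_simps intro!: bexI[of _ "- c" for c])
  show "Group.comm_monoid FT"
    by (rule comm_monoidI) (auto simp: FT_closed FT_mult_closed FT_assoc FT_one_left intro: FT_comm)
qed simp

lemma FT_minus: "c \<in> carrier FT \<Longrightarrow> \<ominus>\<^bsub>FT\<^esub> c = - c"
  using FT_cring by (metis FT_closed(4) FT_simps(1,2) abelian_group.minus_equality add.left_inverse cring.axioms(1) ring_def)

definition lift_sum :: "'l ring \<Rightarrow> ('a \<times> 'b \<Rightarrow> 'l) \<Rightarrow> (('a \<times> 'b) \<Rightarrow>\<^sub>0 int) \<Rightarrow> 'l" where
  "lift_sum L \<phi> c = (\<Oplus>\<^bsub>L\<^esub>x\<in>Poly_Mapping.keys c. [Poly_Mapping.lookup c x] \<cdot>\<^bsub>L\<^esub> \<phi> x)"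

text \<open>Universal property of the monoid ring of pairs: a multiplicative map extends additively
  to a ring homomorphism. Multiplicativity of the extension is additive in each argument, so it
  suffices to check it on single pairs.\<close>

lemma lift_sum_hom:
  fixes L :: "'l ring" (structure)
  assumes L: "cring L" and \<phi>: "\<phi> \<in> carrier A \<times> carrier B \<rightarrow> carrier L"
    and one: "\<phi> (\<one>\<^bsub>A\<^esub>, \<one>\<^bsub>B\<^esub>) = \<one>"
    and mult: "\<And>a b a' b'. \<lbrakk>a \<in> carrier A; b \<in> carrier B; a' \<in> carrier A; b' \<in> carrier B\<rbrakk> \<Longrightarrow>
      \<phi> (a \<otimes>\<^bsub>A\<^esub> a', b \<otimes>\<^bsub>B\<^esub> b') = \<phi> (a, b) \<otimes> \<phi> (a', b')"
  shows "lift_sum L \<phi> \<in> ring_hom FT L"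
    and "\<And>a b. \<lbrakk>a \<in> carrier A; b \<in> carrier B\<rbrakk> \<Longrightarrow> lift_sum L \<phi> (frag_of (a, b)) = \<phi> (a, b)"
    and "\<And>c d. \<lbrakk>c \<in> carrier FT; d \<in> carrier FT\<rbrakk> \<Longrightarrow> lift_sum L \<phi> (c - d) = lift_sum L \<phi> c \<ominus> lift_sum L \<phi> d"
proof -
  interpret L: cring L by fact
  let ?\<psi> = "lift_sum L \<phi>"
  have super: "?\<psi> c = (\<Oplus>x\<in>T. [Poly_Mapping.lookup c x] \<cdot>\<^bsub>L\<^esub> \<phi> x)"
    if "finite T" "Poly_Mapping.keys c \<subseteq> T" "T \<subseteq> carrier A \<times> carrier B" for c T
    unfolding lift_sum_def using that \<phi>
    by (intro L.add.finprod_mono_neutral_cong_left) (auto simp: in_keys_iff add_pow_int_ge)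
  have closed: "?\<psi> c \<in> carrier L" if "c \<in> carrier FT" for c
    unfolding lift_sum_def using that \<phi> by (intro L.finsum_closed) (auto simp: FT_carrier)
  have add: "?\<psi> (c + d) = ?\<psi> c \<oplus> ?\<psi> d" if "c \<in> carrier FT" "d \<in> carrier FT" for c d
  proof -
    let ?T = "Poly_Mapping.keys c \<union> Poly_Mapping.keys d"
    have T: "finite ?T" "?T \<subseteq> carrier A \<times> carrier B" using that by (auto simp: FT_carrier)
    have \<phi>T: "\<phi> x \<in> carrier L" if "x \<in> ?T" for x using that T \<phi> by auto
    have "?\<psi> (c + d) = (\<Oplus>x\<in>?T. [Poly_Mapping.lookup (c + d) x] \<cdot>\<^bsub>L\<^esub> \<phi> x)"
      by (rule super[OF T(1) keys_add T(2)])
    also have "\<dots> = (\<Oplus>x\<in>?T. [Poly_Mapping.lookup c x] \<cdot>\<^bsub>L\<^esub> \<phi> x \<oplus> [Poly_Mapping.lookup d x] \<cdot>\<^bsub>L\<^esub> \<phi> x)"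
      using \<phi>T by (intro L.finsum_cong') (auto simp: lookup_add L.add.int_pow_mult)
    also have "\<dots> = (\<Oplus>x\<in>?T. [Poly_Mapping.lookup c x] \<cdot>\<^bsub>L\<^esub> \<phi> x) \<oplus> (\<Oplus>x\<in>?T. [Poly_Mapping.lookup d x] \<cdot>\<^bsub>L\<^esub> \<phi> x)"
      using \<phi>T by (intro L.finsum_addf) auto
    also have "\<dots> = ?\<psi> c \<oplus> ?\<psi> d"
      using super[OF T(1) _ T(2), of c] super[OF T(1) _ T(2), of d] by simp
    finally show ?thesis .
  qed
  have \<psi>zero: "?\<psi> 0 = \<zero>" unfolding lift_sum_def by simp
  show \<psi>frag: "?\<psi> (frag_of (a, b)) = \<phi> (a, b)" if "a \<in> carrier A" "b \<in> carrier B" for a b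
  proof -
    have "\<phi> (a, b) \<in> carrier L" using that \<phi> by auto
    then show ?thesis unfolding lift_sum_def by (simp add: keys_frag_of)
  qed
  show \<psi>diff: "?\<psi> (c - d) = ?\<psi> c \<ominus> ?\<psi> d" if "c \<in> carrier FT" "d \<in> carrier FT" for c d
  proof -
    have "?\<psi> c = ?\<psi> (c - d) \<oplus> ?\<psi> d" using add[of "c - d" d] that FT_closed by simp
    then show ?thesis using closed that FT_closed(3) by (simp add: a_minus_def L.a_assoc L.r_neg)
  qed
  have \<psi>mult: "?\<psi> (c \<otimes>\<^bsub>FT\<^esub> d) = ?\<psi> c \<otimes> ?\<psi> d" if c: "c \<in> carrier FT" and d: "d \<in> carrier FT" for c d
  proof -
    \<comment> \<open>Membership is carried through the induction because the rule does not provide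
      it for the two terms of a difference.\<close>
    have "c \<in> carrier FT \<and> ?\<psi> (c \<otimes>\<^bsub>FT\<^esub> d) = ?\<psi> c \<otimes> ?\<psi> d"
      using c
    proof (induction c rule: FT_induct)
      case zero
      then show ?case using closed[OF d] by (simp add: \<psi>zero FT_closed)
    next
      case (diff c c')
      then show ?case using d closed
        by (simp add: \<psi>diff FT_closed FT_mult_closed
            a_minus_def L.l_distr L.l_minus)
    next
      case (frag a b)
      note ab = frag
      have \<phi>ab: "\<phi> (a, b) \<in> carrier L" using ab \<phi> by auto
      have "d \<in> carrier FT \<and> ?\<psi> (frag_of (a, b) \<otimes>\<^bsub>FT\<^esub> d) = \<phi> (a, b) \<otimes> ?\<psi> d"
        using d
      proof (induction d rule: FT_induct)
        case zero
        then show ?case using \<phi>ab by (simp add: \<psi>zero FT_closed)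
      next
        case (diff c d)
        then show ?case using ab \<phi>ab closed
          by (simp add: \<psi>diff FT_closed FT_mult_closed
              a_minus_def L.r_distr L.r_minus)
      next
        case (frag a' b')
        then show ?case using ab mult by (simp add: \<psi>frag FT_closed)
      qed
      then show ?case using ab by (simp add: \<psi>frag FT_closed)
    qed
    then show ?thesis by simp
  qed
  show "?\<psi> \<in> ring_hom FT L"
    by (rule ring_hom_memI) (use closed \<psi>mult add \<psi>frag one in auto)
qed

section \<open>The quotient by the bilinearity relations\<close>

abbreviation "I \<equiv> tensor_ideal C \<alpha> A \<beta> B"
abbreviation "T \<equiv> tensor_ring C \<alpha> A \<beta> B"

lemma relations_closed: "tensor_relations C \<alpha> A \<beta> B \<subseteq> carrier FT"
proof -
  have "\<alpha> c \<in> carrier A" "\<beta> c \<in> carrier B" if "c \<in> carrier C" for c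
    using that \<alpha> \<beta> ring_hom_closed by metis+
  then show ?thesis unfolding tensor_relations_def by (auto intro!: FT_closed)
qed

lemma ideal_I: "ideal I FT"
proof -
  interpret F: cring FT by (rule FT_cring)
  show ?thesis unfolding tensor_ideal_def by (rule F.genideal_ideal[OF relations_closed])
qed

lemma T_cring: "cring T"
  unfolding tensor_ring_def by (rule ideal.quotient_is_cring[OF ideal_I FT_cring])

lemma class_hom: "(\<lambda>c. I +>\<^bsub>FT\<^esub> c) \<in> ring_hom FT T"
  unfolding tensor_ring_def by (rule ideal.rcos_ring_hom[OF ideal_I])

lemma class_eq:
  assumes c: "c \<in> carrier FT" and d: "d \<in> carrier FT" and cd: "c - d \<in> I"
  shows "I +>\<^bsub>FT\<^esub> c = I +>\<^bsub>FT\<^esub> d"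
proof -
  interpret I: ideal I FT by (rule ideal_I)
  have "c \<in> I +>\<^bsub>FT\<^esub> d" unfolding a_r_coset_def' using cd by (auto intro!: bexI[of _ "c - d"])
  then show ?thesis using I.a_repr_independence' d by metis
qed

definition pure :: "'a \<Rightarrow> 'b \<Rightarrow> (('a \<times> 'b) \<Rightarrow>\<^sub>0 int) set" where
  "pure a b = I +>\<^bsub>FT\<^esub> frag_of (a, b)"

lemma pure_closed: "\<lbrakk>a \<in> carrier A; b \<in> carrier B\<rbrakk> \<Longrightarrow> pure a b \<in> carrier T"
  unfolding pure_def using ring_hom_closed[OF class_hom] FT_closed(5) by blast

lemma pure_mult:
  "\<lbrakk>a \<in> carrier A; b \<in> carrier B; a' \<in> carrier A; b' \<in> carrier B\<rbrakk> \<Longrightarrow>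
    pure a b \<otimes>\<^bsub>T\<^esub> pure a' b' = pure (a \<otimes>\<^bsub>A\<^esub> a') (b \<otimes>\<^bsub>B\<^esub> b')"
  unfolding pure_def by (subst ring_hom_mult[OF class_hom, symmetric]) (auto simp: FT_closed)

lemma pure_one: "\<one>\<^bsub>T\<^esub> = pure \<one>\<^bsub>A\<^esub> \<one>\<^bsub>B\<^esub>"
  unfolding pure_def using ring_hom_one[OF class_hom] by simp

lemma relation_in_I: "r \<in> tensor_relations C \<alpha> A \<beta> B \<Longrightarrow> r \<in> I"
proof -
  interpret F: cring FT by (rule FT_cring)
  show "r \<in> tensor_relations C \<alpha> A \<beta> B \<Longrightarrow> r \<in> I"
    unfolding tensor_ideal_def using F.genideal_self[OF relations_closed] by auto
qed

lemma pure_add_left: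
  assumes "a \<in> carrier A" "a' \<in> carrier A" "b \<in> carrier B"
  shows "pure (a \<oplus>\<^bsub>A\<^esub> a') b = pure a b \<oplus>\<^bsub>T\<^esub> pure a' b"
proof -
  have "frag_of (a \<oplus>\<^bsub>A\<^esub> a', b) - (frag_of (a, b) + frag_of (a', b)) \<in> I"
    unfolding diff_diff_eq[symmetric]
    by (rule relation_in_I) (use assms in \<open>auto simp: tensor_relations_def\<close>)
  then have "pure (a \<oplus>\<^bsub>A\<^esub> a') b = I +>\<^bsub>FT\<^esub> (frag_of (a, b) \<oplus>\<^bsub>FT\<^esub> frag_of (a', b))"
    unfolding pure_def using assms by (intro class_eq) (auto simp: FT_closed)
  also have "\<dots> = pure a b \<oplus>\<^bsub>T\<^esub> pure a' b"
    unfolding pure_def using assms by (intro ring_hom_add[OF class_hom]) (auto simp: FT_closed)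
  finally show ?thesis .
qed

lemma pure_add_right:
  assumes "a \<in> carrier A" "b \<in> carrier B" "b' \<in> carrier B"
  shows "pure a (b \<oplus>\<^bsub>B\<^esub> b') = pure a b \<oplus>\<^bsub>T\<^esub> pure a b'"
proof -
  have "frag_of (a, b \<oplus>\<^bsub>B\<^esub> b') - (frag_of (a, b) + frag_of (a, b')) \<in> I"
    unfolding diff_diff_eq[symmetric]
    by (rule relation_in_I) (use assms in \<open>auto simp: tensor_relations_def\<close>)
  then have "pure a (b \<oplus>\<^bsub>B\<^esub> b') = I +>\<^bsub>FT\<^esub> (frag_of (a, b) \<oplus>\<^bsub>FT\<^esub> frag_of (a, b'))"
    unfolding pure_def using assms by (intro class_eq) (auto simp: FT_closed)
  also have "\<dots> = pure a b \<oplus>\<^bsub>T\<^esub> pure a b'"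
    unfolding pure_def using assms by (intro ring_hom_add[OF class_hom]) (auto simp: FT_closed)
  finally show ?thesis .
qed

definition inl :: "'a \<Rightarrow> (('a \<times> 'b) \<Rightarrow>\<^sub>0 int) set" where "inl a = pure a \<one>\<^bsub>B\<^esub>"
definition inr :: "'b \<Rightarrow> (('a \<times> 'b) \<Rightarrow>\<^sub>0 int) set" where "inr b = pure \<one>\<^bsub>A\<^esub> b"

lemma inl_hom: "inl \<in> ring_hom A T"
  unfolding inl_def
  by (rule ring_hom_memI) (auto simp: pure_closed pure_mult pure_add_left pure_one)

lemma inr_hom: "inr \<in> ring_hom B T"
  unfolding inr_def
  by (rule ring_hom_memI) (auto simp: pure_closed pure_mult pure_add_right pure_one)

lemma inl_inr: "\<lbrakk>a \<in> carrier A; b \<in> carrier B\<rbrakk> \<Longrightarrow> pure a b = inl a \<otimes>\<^bsub>T\<^esub> inr b"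
  unfolding inl_def inr_def by (simp add: pure_mult)

lemma balanced: assumes "c \<in> carrier C" shows "inl (\<alpha> c) = inr (\<beta> c)"
proof -
  have c: "\<alpha> c \<in> carrier A" "\<beta> c \<in> carrier B"
    using assms \<alpha> \<beta> ring_hom_closed by metis+
  have "frag_of (\<alpha> c \<otimes>\<^bsub>A\<^esub> \<one>\<^bsub>A\<^esub>, \<one>\<^bsub>B\<^esub>) - frag_of (\<one>\<^bsub>A\<^esub>, \<beta> c \<otimes>\<^bsub>B\<^esub> \<one>\<^bsub>B\<^esub>) \<in> I"
    by (rule relation_in_I) (use assms in \<open>auto simp: tensor_relations_def\<close>)
  then show ?thesis unfolding inl_def inr_def pure_def using c
    by (intro class_eq) (auto simp: FT_closed)
qed

lemma T_induct [consumes 1, case_names zero pure diff]: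
  assumes x: "x \<in> carrier T" and "P \<zero>\<^bsub>T\<^esub>"
    and pure: "\<And>a b. \<lbrakk>a \<in> carrier A; b \<in> carrier B\<rbrakk> \<Longrightarrow> P (inl a \<otimes>\<^bsub>T\<^esub> inr b)"
    and diff: "\<And>x y. \<lbrakk>x \<in> carrier T; y \<in> carrier T; P x; P y\<rbrakk> \<Longrightarrow> P (x \<ominus>\<^bsub>T\<^esub> y)"
  shows "P x"
proof -
  interpret F: cring FT by (rule FT_cring)
  interpret T: cring T by (rule T_cring)
  interpret h: ring_hom_ring FT T "\<lambda>c. I +>\<^bsub>FT\<^esub> c"
    by (intro ring_hom_ringI2 F.ring_axioms T.ring_axioms class_hom)
  obtain c where c: "c \<in> carrier FT" "x = I +>\<^bsub>FT\<^esub> c"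
    using x unfolding tensor_ring_def FactRing_def A_RCOSETS_def' by auto
  have "c \<in> carrier FT \<and> P (I +>\<^bsub>FT\<^esub> c)" using c(1)
  proof (induction c rule: FT_induct)
    case zero
    then show ?case using h.hom_zero \<open>P \<zero>\<^bsub>T\<^esub>\<close> by (simp add: FT_closed)
  next
    case (frag a b)
    then show ?case using pure inl_inr unfolding pure_def by (simp add: FT_closed)
  next
    case (diff c d)
    have "I +>\<^bsub>FT\<^esub> (c - d) = (I +>\<^bsub>FT\<^esub> c) \<ominus>\<^bsub>T\<^esub> (I +>\<^bsub>FT\<^esub> d)"
      using diff h.hom_add[of c "\<ominus>\<^bsub>FT\<^esub> d"] h.hom_a_inv[of d] by (simp add: FT_minus FT_closed a_minus_def)
    then show ?case using diff assms(4) h.hom_closed by (simp add: FT_closed)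
  qed
  then show ?thesis using c by simp
qed

text \<open>The compatible pair \<open>f\<close>, \<open>g\<close> extends to a ring homomorphism on
  formal sums. It kills the relations and hence the tensor ideal; if the quotient were zero, the
  unit would lie in that ideal and be sent to zero.\<close>

lemma T_nontrivial:
  fixes L :: "'l ring"
  assumes L: "cring L" "\<one>\<^bsub>L\<^esub> \<noteq> \<zero>\<^bsub>L\<^esub>" and f: "f \<in> ring_hom A L" and g: "g \<in> ring_hom B L"
    and fg: "\<And>c. c \<in> carrier C \<Longrightarrow> f (\<alpha> c) = g (\<beta> c)"
  shows "\<one>\<^bsub>T\<^esub> \<noteq> \<zero>\<^bsub>T\<^esub>"
proof
  interpret L: cring L by (rule L)
  interpret F: cring FT by (rule FT_cring)
  interpret I: ideal I FT by (rule ideal_I)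
  define \<phi> where "\<phi> = (\<lambda>(a, b). f a \<otimes>\<^bsub>L\<^esub> g b)"
  have fc: "f a \<in> carrier L" if "a \<in> carrier A" for a using that f ring_hom_closed by metis
  have gc: "g b \<in> carrier L" if "b \<in> carrier B" for b using that g ring_hom_closed by metis
  have \<phi>: "\<phi> \<in> carrier A \<times> carrier B \<rightarrow> carrier L" unfolding \<phi>_def using fc gc by auto
  have one: "\<phi> (\<one>\<^bsub>A\<^esub>, \<one>\<^bsub>B\<^esub>) = \<one>\<^bsub>L\<^esub>"
    unfolding \<phi>_def using ring_hom_one[OF f] ring_hom_one[OF g] by simp
  have mult: "\<phi> (a \<otimes>\<^bsub>A\<^esub> a', b \<otimes>\<^bsub>B\<^esub> b') = \<phi> (a, b) \<otimes>\<^bsub>L\<^esub> \<phi> (a', b')"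
    if "a \<in> carrier A" "b \<in> carrier B" "a' \<in> carrier A" "b' \<in> carrier B" for a b a' b'
    unfolding \<phi>_def using that fc gc ring_hom_mult[OF f] ring_hom_mult[OF g] by (simp add: L.m_ac)
  note lift = lift_sum_hom[OF L(1) \<phi> one mult]
  interpret h: ring_hom_ring FT L "lift_sum L \<phi>"
    by (intro ring_hom_ringI2 F.ring_axioms L.ring_axioms lift(1))
  have \<alpha>\<beta>: "\<alpha> c \<in> carrier A" "\<beta> c \<in> carrier B" if "c \<in> carrier C" for c
    using that \<alpha> \<beta> ring_hom_closed by metis+
  have \<phi>': "\<phi> (a, b) = f a \<otimes>\<^bsub>L\<^esub> g b" for a b unfolding \<phi>_def by simp
  have "lift_sum L \<phi> r = \<zero>\<^bsub>L\<^esub>" if "r \<in> tensor_relations C \<alpha> A \<beta> B" for r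
    using that unfolding tensor_relations_def
  proof (elim UnE CollectE exE conjE)
    fix a a' b assume *: "a \<in> carrier A" "a' \<in> carrier A" "b \<in> carrier B"
      and r: "r = frag_of (a \<oplus>\<^bsub>A\<^esub> a', b) - frag_of (a, b) - frag_of (a', b)"
    show ?thesis unfolding r diff_diff_eq
      using * h.hom_add[of "frag_of (a, b)" "frag_of (a', b)"] fc gc
      by (simp add: lift FT_closed \<phi>' ring_hom_add[OF f] L.l_distr)
  next
    fix a b b' assume *: "a \<in> carrier A" "b \<in> carrier B" "b' \<in> carrier B"
      and r: "r = frag_of (a, b \<oplus>\<^bsub>B\<^esub> b') - frag_of (a, b) - frag_of (a, b')"
    show ?thesis unfolding r diff_diff_eq
      using * h.hom_add[of "frag_of (a, b)" "frag_of (a, b')"] fc gc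
      by (simp add: lift FT_closed \<phi>' ring_hom_add[OF g] L.r_distr)
  next
    fix a b c assume *: "a \<in> carrier A" "b \<in> carrier B" "c \<in> carrier C"
      and r: "r = frag_of (\<alpha> c \<otimes>\<^bsub>A\<^esub> a, b) - frag_of (a, \<beta> c \<otimes>\<^bsub>B\<^esub> b)"
    show ?thesis unfolding r using * fc gc \<alpha>\<beta>
      by (simp add: lift FT_closed \<phi>' ring_hom_mult[OF f] ring_hom_mult[OF g] fg L.m_ac)
  qed
  then have "tensor_relations C \<alpha> A \<beta> B \<subseteq> a_kernel FT L (lift_sum L \<phi>)"
    using relations_closed unfolding a_kernel_def' by blast
  then have "I \<subseteq> a_kernel FT L (lift_sum L \<phi>)"
    unfolding tensor_ideal_def by (rule F.genideal_minimal[OF h.kernel_is_ideal])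
  moreover assume "\<one>\<^bsub>T\<^esub> = \<zero>\<^bsub>T\<^esub>"
  then have "I +>\<^bsub>FT\<^esub> \<one>\<^bsub>FT\<^esub> = I" unfolding tensor_ring_def FactRing_def by simp
  then have "\<one>\<^bsub>FT\<^esub> \<in> I" using I.a_rcos_self[OF F.one_closed] by simp
  ultimately have "lift_sum L \<phi> \<one>\<^bsub>FT\<^esub> = \<zero>\<^bsub>L\<^esub>" unfolding a_kernel_def' by blast
  then show False using h.hom_one L(2) by simp
qed

end

section \<open>Base change to the perfect closure\<close>

lemma (in ring_hom_ring) hom_diff:
  "\<lbrakk>x \<in> carrier R; y \<in> carrier R\<rbrakk> \<Longrightarrow> h (x \<ominus>\<^bsub>R\<^esub> y) = h x \<ominus>\<^bsub>S\<^esub> h y"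
  by (simp add: a_minus_def)

text \<open>Here \<open>E\<close> stands for the perfect closure of \<open>F\<close>, \<open>T\<close> for \<open>K \<otimes>\<^sub>F E\<close> and \<open>r n\<close> for \<open>t\<^bsup>1/p\<^sup>n\<^esup>\<close>.\<close>

locale perf_base_change =
  F: char_p_field F p + K: char_p_field K p + E: char_p_field E p + T: char_p_ring T p +
  \<alpha>: ring_hom_ring F K \<alpha> + \<epsilon>: ring_hom_ring F E \<epsilon> +
  inl: ring_hom_ring K T inl + inr: ring_hom_ring E T inr
  for F :: "('f, 'fs) ring_scheme" and K :: "('k, 'ks) ring_scheme" and E :: "('e, 'es) ring_scheme"
    and T :: "'t ring" (structure) and p \<alpha> \<epsilon> inl inr +
  fixes t :: 'f and r :: "nat \<Rightarrow> 'e"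
  assumes t: "t \<in> carrier F"
    and span: "\<And>x. x \<in> carrier F \<Longrightarrow>
      \<exists>c. (\<forall>i<p. c i \<in> carrier F) \<and> x = (\<Oplus>\<^bsub>F\<^esub>i\<in>{..<p}. c i [^]\<^bsub>F\<^esub> p \<otimes>\<^bsub>F\<^esub> t [^]\<^bsub>F\<^esub> i)"
    and r: "\<And>n. r n \<in> carrier E" "\<And>n. r n [^]\<^bsub>E\<^esub> (p ^ n) = \<epsilon> t"
    and radical: "\<And>e. e \<in> carrier E \<Longrightarrow> \<exists>n. \<exists>y\<in>carrier F. e [^]\<^bsub>E\<^esub> (p ^ n) = \<epsilon> y"
    and balanced: "\<And>c. c \<in> carrier F \<Longrightarrow> inl (\<alpha> c) = inr (\<epsilon> c)"
    and tensor_induct: "\<And>P x. \<lbrakk>x \<in> carrier T; P \<zero>;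
      \<And>a b. \<lbrakk>a \<in> carrier K; b \<in> carrier E\<rbrakk> \<Longrightarrow> P (inl a \<otimes> inr b);
      \<And>x y. \<lbrakk>x \<in> carrier T; y \<in> carrier T; P x; P y\<rbrakk> \<Longrightarrow> P (x \<ominus> y)\<rbrakk> \<Longrightarrow> P x"
    and nontrivial: "\<one> \<noteq> \<zero>"
begin

lemmas T_induct = tensor_induct [consumes 1, case_names zero pure diff]

lemma inl_eq_zero_iff: assumes "k \<in> carrier K" shows "inl k = \<zero> \<longleftrightarrow> k = \<zero>\<^bsub>K\<^esub>"
proof
  assume z: "inl k = \<zero>"
  show "k = \<zero>\<^bsub>K\<^esub>"
  proof (rule ccontr)
    assume "k \<noteq> \<zero>\<^bsub>K\<^esub>"
    then have k: "k \<in> Units K" using assms K.field_Units by auto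
    have "\<one> = inl (k \<otimes>\<^bsub>K\<^esub> inv\<^bsub>K\<^esub> k)" using k by simp
    also have "\<dots> = \<zero>" using k assms z by (subst inl.hom_mult) auto
    finally show False using nontrivial by simp
  qed
qed simp

text \<open>Restricting the exponents to powers of \<open>p\<close> gives the same elements and
  makes closure under differences a consequence of the Frobenius.\<close>

definition nilp :: "'t set" where
  "nilp = {x \<in> carrier T. \<exists>n. x [^] (p ^ n) = \<zero>}"

lemma pow_p_mono:
  assumes "x \<in> carrier T" "x [^] (p ^ n) = y" shows "x [^] (p ^ (n + k)) = y [^] (p ^ k)"
  using assms by (auto simp: power_add T.nat_pow_pow)

text \<open>For a pure tensor, a high \<open>p\<close>-power of the right factor comes from
  \<open>F\<close> and moves to the left by balancing. Differences are handled by raising both terms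
  to a common \<open>p\<close>-power.\<close>

lemma pow_in_image:
  assumes "x \<in> carrier T"
  shows "\<exists>n. \<exists>k\<in>carrier K. x [^] (p ^ n) = inl k"
  using assms
proof (induction x rule: T_induct)
  case zero
  then show ?case by (intro exI[of _ 0] bexI[of _ "\<zero>\<^bsub>K\<^esub>"]) auto
next
  case (pure a b)
  obtain y n where y: "y \<in> carrier F" "b [^]\<^bsub>E\<^esub> (p ^ n) = \<epsilon> y" using radical[OF pure(2)] by blast
  have "(inl a \<otimes> inr b) [^] (p ^ n) = inl (a [^]\<^bsub>K\<^esub> (p ^ n)) \<otimes> inr (b [^]\<^bsub>E\<^esub> (p ^ n))"
    using pure by (simp add: T.nat_pow_distrib inl.hom_nat_pow inr.hom_nat_pow)
  also have "\<dots> = inl (a [^]\<^bsub>K\<^esub> (p ^ n) \<otimes>\<^bsub>K\<^esub> \<alpha> y)"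
    using pure y balanced[OF y(1)] by simp
  finally show ?case using pure y by (intro exI[of _ n] bexI[of _ "a [^]\<^bsub>K\<^esub> (p ^ n) \<otimes>\<^bsub>K\<^esub> \<alpha> y"]) auto
next
  case (diff x y)
  obtain n k m l where *: "k \<in> carrier K" "x [^] (p ^ n) = inl k" "l \<in> carrier K" "y [^] (p ^ m) = inl l"
    using diff by blast
  have "(x \<ominus> y) [^] (p ^ (n + m)) = inl k [^] (p ^ m) \<ominus> inl l [^] (p ^ n)"
    using diff(1,2) pow_p_mono[OF diff(1) *(2), of m] pow_p_mono[OF diff(2) *(4), of n]
    by (simp add: T.frobenius_diff add.commute[of m])
  also have "\<dots> = inl (k [^]\<^bsub>K\<^esub> (p ^ m) \<ominus>\<^bsub>K\<^esub> l [^]\<^bsub>K\<^esub> (p ^ n))"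
    using * by (simp only: inl.hom_diff K.nat_pow_closed inl.hom_nat_pow)
  finally show ?case
    using * by (intro exI[of _ "n + m"] bexI[of _ "k [^]\<^bsub>K\<^esub> (p ^ m) \<ominus>\<^bsub>K\<^esub> l [^]\<^bsub>K\<^esub> (p ^ n)"]) auto
qed

lemma inl_nilp: assumes "k \<in> carrier K" "inl k \<in> nilp" shows "k = \<zero>\<^bsub>K\<^esub>"
proof -
  obtain n where "inl k [^] (p ^ n) = \<zero>" using assms unfolding nilp_def by auto
  then have "inl (k [^]\<^bsub>K\<^esub> (p ^ n)) = \<zero>" using assms by (simp add: inl.hom_nat_pow)
  then have "k [^]\<^bsub>K\<^esub> (p ^ n) = \<zero>\<^bsub>K\<^esub>" using inl_eq_zero_iff assms by blast
  then show ?thesis using K.frobenius_eq_zero_iff assms by blast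
qed

text \<open>Some \<open>p^n\<close>-th power of \<open>x\<close> is a nonzero element of the field
  \<open>K\<close>; the remaining \<open>p^n - 1\<close> factors times its inverse invert
  \<open>x\<close>.\<close>

lemma not_nilp_unit:
  assumes x: "x \<in> carrier T" "x \<notin> nilp" shows "x \<in> Units T"
proof -
  obtain n k where k: "k \<in> carrier K" "x [^] (p ^ n) = inl k" using pow_in_image[OF x(1)] by blast
  have "k \<noteq> \<zero>\<^bsub>K\<^esub>" using x k unfolding nilp_def by auto
  then have kU: "k \<in> Units K" using k K.field_Units by auto
  obtain N where N: "p ^ n = Suc N" using F.p_pos by (metis gr0_implies_Suc zero_less_power)
  have "x \<otimes> (x [^] N \<otimes> inl (inv\<^bsub>K\<^esub> k)) = x [^] (p ^ n) \<otimes> inl (inv\<^bsub>K\<^esub> k)"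
    unfolding N using x kU by (simp add: T.m_ac)
  also have "\<dots> = inl (k \<otimes>\<^bsub>K\<^esub> inv\<^bsub>K\<^esub> k)"
    unfolding k(2) using k(1) kU by (subst inl.hom_mult) auto
  also have "\<dots> = \<one>" using kU by simp
  finally have "x \<otimes> (x [^] N \<otimes> inl (inv\<^bsub>K\<^esub> k)) = \<one>" .
  moreover have "x [^] N \<otimes> inl (inv\<^bsub>K\<^esub> k) \<in> carrier T" using x kU by simp
  ultimately show ?thesis using x(1) T.m_comm[OF _ x(1)] unfolding Units_def by auto
qed

lemma nilp_diff: assumes "x \<in> nilp" "y \<in> nilp" shows "x \<ominus> y \<in> nilp"
proof -
  obtain n m where *: "x \<in> carrier T" "y \<in> carrier T" "x [^] (p ^ n) = \<zero>" "y [^] (p ^ m) = \<zero>"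
    using assms unfolding nilp_def by auto
  have x: "x [^] (p ^ (n + m)) = \<zero>"
    unfolding pow_p_mono[OF *(1,3), of m] by (rule T.frobenius_zero)
  have y: "y [^] (p ^ (n + m)) = \<zero>"
    unfolding add.commute[of n] pow_p_mono[OF *(2,4), of n] by (rule T.frobenius_zero)
  have "(x \<ominus> y) [^] (p ^ (n + m)) = \<zero>"
    unfolding T.frobenius_diff[OF *(1,2)] x y by (simp add: a_minus_def)
  then show ?thesis using * unfolding nilp_def by auto
qed

lemma nilp_mult: assumes "x \<in> nilp" "z \<in> carrier T" shows "z \<otimes> x \<in> nilp"
proof -
  obtain n where "x \<in> carrier T" "x [^] (p ^ n) = \<zero>" using assms(1) unfolding nilp_def by auto
  then have "(z \<otimes> x) [^] (p ^ n) = \<zero>" using assms(2) by (simp add: T.nat_pow_distrib)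
  then show ?thesis using assms unfolding nilp_def by auto
qed

lemma nilp_ideal: "ideal nilp T"
proof (rule idealI[OF T.ring_axioms])
  have z: "\<zero> \<in> nilp" unfolding nilp_def by (auto simp: T.frobenius_zero)
  have neg: "\<ominus> x \<in> nilp" if "x \<in> nilp" for x
    using nilp_diff[OF z that] that by (simp add: nilp_def a_minus_def)
  show "subgroup nilp (add_monoid T)"
  proof (rule T.add.subgroupI)
    show "nilp \<subseteq> carrier T" unfolding nilp_def by auto
    show "nilp \<noteq> {}" using z by auto
    show "\<ominus> x \<in> nilp" if "x \<in> nilp" for x using neg[OF that] .
    show "x \<oplus> y \<in> nilp" if "x \<in> nilp" "y \<in> nilp" for x y
      using nilp_diff[OF that(1) neg[OF that(2)]] that by (simp add: nilp_def a_minus_def)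
  qed
  show "z \<otimes> x \<in> nilp" if "x \<in> nilp" "z \<in> carrier T" for x z by (rule nilp_mult[OF that])
  show "x \<otimes> z \<in> nilp" if "x \<in> nilp" "z \<in> carrier T" for x z
    using nilp_mult[OF that] that T.m_comm by (simp add: nilp_def)
qed

lemma one_not_nilp: "\<one> \<notin> nilp"
  unfolding nilp_def using nontrivial by simp

lemma maximalideal_iff: "maximalideal M T \<longleftrightarrow> M = nilp"
proof -
  have sub: "J \<subseteq> nilp" if J: "ideal J T" "J \<noteq> carrier T" for J
  proof
    interpret J: ideal J T by (rule J(1))
    fix x assume x: "x \<in> J"
    show "x \<in> nilp"
    proof (rule ccontr)
      assume "x \<notin> nilp"
      then have xU: "x \<in> Units T" using not_nilp_unit x J.a_subset by blast
      then have "inv x \<otimes> x \<in> J" by (intro J.I_l_closed x) (rule T.Units_inv_closed)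
      then have "\<one> \<in> J" using T.Units_l_inv[OF xU] by simp
      then show False using J.one_imp_carrier J(2) by blast
    qed
  qed
  have ne: "nilp \<noteq> carrier T" using one_not_nilp T.one_closed by blast
  have max: "maximalideal nilp T"
    by (rule maximalidealI[OF nilp_ideal]) (use ne sub in auto)
  show ?thesis
  proof
    assume M: "maximalideal M T"
    then interpret M: maximalideal M T .
    have "M \<subseteq> nilp" using sub[OF M.ideal_axioms] M.I_notcarr by blast
    then show "M = nilp"
      using M.I_maximal[OF nilp_ideal] ne unfolding nilp_def by blast
  qed (use max in simp)
qed

lemma max_ideal_eq: "max_ideal T = nilp"
  unfolding max_ideal_def maximalideal_iff by simp

section \<open>Roots of \<open>t\<close> and the layers they generate\<close>

definition root :: "nat \<Rightarrow> 't" where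
  "root n = inr (r n)"

lemma root_closed [simp]: "root n \<in> carrier T"
  unfolding root_def using r by simp

text \<open>The chosen roots are only required to be roots of \<open>t\<close> one by one. They are
  compatible with each other because \<open>p\<close>-power roots in a field are unique.\<close>

lemma r_pow: "r (j + k) [^]\<^bsub>E\<^esub> (p ^ k) = r j"
proof (rule E.frobenius_inj[of _ _ j])
  have "(r (j + k) [^]\<^bsub>E\<^esub> (p ^ k)) [^]\<^bsub>E\<^esub> (p ^ j) = r (j + k) [^]\<^bsub>E\<^esub> (p ^ (j + k))"
    using r(1) by (simp add: E.nat_pow_pow power_add mult.commute)
  then show "(r (j + k) [^]\<^bsub>E\<^esub> (p ^ k)) [^]\<^bsub>E\<^esub> (p ^ j) = r j [^]\<^bsub>E\<^esub> (p ^ j)" using r(2) by simp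
qed (use r in auto)

lemma root_pow: "root (j + k) [^] (p ^ k) = root j"
  unfolding root_def inr.hom_nat_pow[OF r(1), symmetric] r_pow ..

lemma root_pow_p: "root j [^] (p ^ j) = inl (\<alpha> t)"
  unfolding root_def inr.hom_nat_pow[OF r(1), symmetric] r(2) using balanced[OF t] by simp

text \<open>The image of \<open>K \<otimes>\<^sub>F F(t\<^bsup>1/p\<^sup>n\<^esup>)\<close> in \<open>T\<close>.\<close>

inductive_set layer for n where
  zero: "\<zero> \<in> layer n"
| monom: "k \<in> carrier K \<Longrightarrow> inl k \<otimes> root n [^] (i :: nat) \<in> layer n"
| add: "\<lbrakk>x \<in> layer n; y \<in> layer n\<rbrakk> \<Longrightarrow> x \<oplus> y \<in> layer n"

lemma layer_closed: "x \<in> layer n \<Longrightarrow> x \<in> carrier T"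
  by (induction rule: layer.induct) auto

lemma layer_mono: "x \<in> layer n \<Longrightarrow> x \<in> layer (n + k)"
proof (induction rule: layer.induct)
  case (monom a i)
  have "root n [^] i = root (n + k) [^] (p ^ k * i)"
    unfolding root_pow[of n k, symmetric] by (simp add: T.nat_pow_pow)
  then show ?case using layer.monom[OF monom] by metis
qed (auto intro: layer.intros)

lemma layer_minus: "x \<in> layer n \<Longrightarrow> \<ominus> x \<in> layer n"
proof (induction rule: layer.induct)
  case (monom k i)
  have "\<ominus> (inl k \<otimes> root n [^] i) = inl (\<ominus>\<^bsub>K\<^esub> k) \<otimes> root n [^] i"
    using monom by (simp add: T.l_minus)
  then show ?case using layer.monom[of "\<ominus>\<^bsub>K\<^esub> k" n i] monom by (simp only: K.a_inv_closed)
next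
  case (add x y)
  then show ?case using layer.add layer_closed by (simp add: T.minus_add)
qed (use layer.zero in simp)

lemma layer_sum:
  assumes "finite A" "\<And>i. i \<in> A \<Longrightarrow> f i \<in> layer n" shows "(\<Oplus>i\<in>A. f i) \<in> layer n"
  using assms layer_closed layer.zero layer.add
  by (intro T.finsum_induct[where P = "\<lambda>x. x \<in> layer n"]) auto

text \<open>A \<open>p^n\<close>-th power of \<open>e\<close> comes from some \<open>y\<close> in
  \<open>F\<close>. Expanding \<open>y\<close> with \<open>p^n\<close>-th powers as coefficients
  makes a root visible term by term, and injectivity of the Frobenius identifies that root with
  \<open>e\<close>.\<close>

lemma expansion:
  assumes e: "e \<in> carrier E"
  obtains n c where "\<And>i. i < p ^ n \<Longrightarrow> c i \<in> carrier F"
    "e = (\<Oplus>\<^bsub>E\<^esub>i\<in>{..<p ^ n}. \<epsilon> (c i) \<otimes>\<^bsub>E\<^esub> r n [^]\<^bsub>E\<^esub> i)"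
proof -
  obtain n y where y: "y \<in> carrier F" "e [^]\<^bsub>E\<^esub> (p ^ n) = \<epsilon> y" using radical[OF e] by blast
  obtain c where c: "\<And>i. i < p ^ n \<Longrightarrow> c i \<in> carrier F"
    "y = (\<Oplus>\<^bsub>F\<^esub>i\<in>{..<p ^ n}. c i [^]\<^bsub>F\<^esub> (p ^ n) \<otimes>\<^bsub>F\<^esub> t [^]\<^bsub>F\<^esub> i)"
    using F.iterated_powers_span[OF t span y(1), of n] by auto
  let ?r = "\<Oplus>\<^bsub>E\<^esub>i\<in>{..<p ^ n}. \<epsilon> (c i) \<otimes>\<^bsub>E\<^esub> r n [^]\<^bsub>E\<^esub> i"
  interpret \<epsilon>: ring_hom_cring F E \<epsilon>
    by (intro ring_hom_cringI F.is_cring E.is_cring \<epsilon>.homh)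
  have "?r [^]\<^bsub>E\<^esub> (p ^ n) = (\<Oplus>\<^bsub>E\<^esub>i\<in>{..<p ^ n}. (\<epsilon> (c i) \<otimes>\<^bsub>E\<^esub> r n [^]\<^bsub>E\<^esub> i) [^]\<^bsub>E\<^esub> (p ^ n))"
    using c(1) r(1) by (intro E.frobenius_finsum) auto
  also have "\<dots> = (\<Oplus>\<^bsub>E\<^esub>i\<in>{..<p ^ n}. \<epsilon> (c i [^]\<^bsub>F\<^esub> (p ^ n) \<otimes>\<^bsub>F\<^esub> t [^]\<^bsub>F\<^esub> i))"
  proof (intro E.finsum_cong')
    fix i assume "i \<in> {..<p ^ n}"
    then have ci: "c i \<in> carrier F" using c by simp
    have "(r n [^]\<^bsub>E\<^esub> i) [^]\<^bsub>E\<^esub> (p ^ n) = (r n [^]\<^bsub>E\<^esub> (p ^ n)) [^]\<^bsub>E\<^esub> i"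
      using r(1)[of n] by (simp add: E.nat_pow_pow mult.commute)
    then have "(r n [^]\<^bsub>E\<^esub> i) [^]\<^bsub>E\<^esub> (p ^ n) = \<epsilon> t [^]\<^bsub>E\<^esub> i" unfolding r(2) .
    then show "(\<epsilon> (c i) \<otimes>\<^bsub>E\<^esub> r n [^]\<^bsub>E\<^esub> i) [^]\<^bsub>E\<^esub> (p ^ n) = \<epsilon> (c i [^]\<^bsub>F\<^esub> (p ^ n) \<otimes>\<^bsub>F\<^esub> t [^]\<^bsub>F\<^esub> i)"
      using ci t r(1)[of n] by (simp add: E.nat_pow_distrib \<epsilon>.hom_nat_pow)
  qed (use c t in auto)
  also have "\<dots> = \<epsilon> y"
    unfolding c(2) using c(1) t
    by (intro \<epsilon>.hom_finsum[symmetric, unfolded comp_def]) auto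
  also have "\<dots> = e [^]\<^bsub>E\<^esub> (p ^ n)" using y by simp
  finally have eq: "?r [^]\<^bsub>E\<^esub> (p ^ n) = e [^]\<^bsub>E\<^esub> (p ^ n)" .
  have "?r \<in> carrier E" using c(1) r(1)[of n] by (intro E.finsum_closed) auto
  then have "?r = e" using e eq by (rule E.frobenius_inj)
  then have "e = ?r" ..
  with c(1) show thesis by (rule that)
qed

lemma exists_layer:
  assumes "x \<in> carrier T" shows "\<exists>n. x \<in> layer n"
  using assms
proof (induction x rule: T_induct)
  case (pure a b)
  obtain n c where c: "\<And>i. i < p ^ n \<Longrightarrow> c i \<in> carrier F"
    "b = (\<Oplus>\<^bsub>E\<^esub>i\<in>{..<p ^ n}. \<epsilon> (c i) \<otimes>\<^bsub>E\<^esub> r n [^]\<^bsub>E\<^esub> i)"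
    using expansion[OF pure(2)] by blast
  interpret rc: ring_hom_cring E T inr
    by (intro ring_hom_cringI E.is_cring T.is_cring inr.homh)
  have "inr b = (\<Oplus>i\<in>{..<p ^ n}. inr (\<epsilon> (c i) \<otimes>\<^bsub>E\<^esub> r n [^]\<^bsub>E\<^esub> i))"
    unfolding c(2) using c(1) r(1)[of n]
    by (intro rc.hom_finsum[unfolded comp_def]) auto
  also have "\<dots> = (\<Oplus>i\<in>{..<p ^ n}. inl (\<alpha> (c i)) \<otimes> root n [^] i)"
    using c(1) r(1)[of n] by (intro T.finsum_cong') (auto simp: balanced root_def inr.hom_nat_pow)
  finally have "inl a \<otimes> inr b = (\<Oplus>i\<in>{..<p ^ n}. inl a \<otimes> (inl (\<alpha> (c i)) \<otimes> root n [^] i))"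
    using pure c(1) by (simp add: T.finsum_rdistr Pi_iff)
  also have "\<dots> \<in> layer n"
  proof (rule layer_sum)
    fix i assume "i \<in> {..<p ^ n}"
    then have ci: "\<alpha> (c i) \<in> carrier K" using c by simp
    have "inl a \<otimes> (inl (\<alpha> (c i)) \<otimes> root n [^] i) = inl (a \<otimes>\<^bsub>K\<^esub> \<alpha> (c i)) \<otimes> root n [^] i"
      using pure ci by (simp add: T.m_assoc)
    then show "inl a \<otimes> (inl (\<alpha> (c i)) \<otimes> root n [^] i) \<in> layer n"
      using layer.monom[of "a \<otimes>\<^bsub>K\<^esub> \<alpha> (c i)" n i] pure ci by (simp only: K.m_closed)
  qed simp
  finally show ?case by blast
next
  case (diff x y)
  then obtain n m where nm: "x \<in> layer n" "y \<in> layer m" by blast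
  have "x \<in> layer (n + m)" "y \<in> layer (n + m)"
    using layer_mono[OF nm(1), of m] layer_mono[OF nm(2), of n] by (auto simp: add.commute)
  then show ?case unfolding a_minus_def using layer.add layer_minus by blast
qed (use layer.zero in blast)

lemma pow_diff_in_ideal:
  assumes J: "ideal J T" and a: "a \<in> carrier T" and b: "b \<in> carrier T" and ab: "a \<ominus> b \<in> J"
  shows "a [^] (l :: nat) \<ominus> b [^] l \<in> J"
proof (induction l)
  case 0
  interpret J: ideal J T by (rule J)
  show ?case using J.additive_subgroup_axioms by (simp add: T.r_neg a_minus_def additive_subgroup.zero_closed)
next
  case (Suc l)
  interpret J: ideal J T by (rule J)
  have "a [^] Suc l \<ominus> b [^] Suc l
    = (a [^] l \<ominus> b [^] l) \<otimes> a \<oplus> b [^] l \<otimes> (a \<ominus> b)"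
  proof -
    have "(x \<ominus> y) \<otimes> a \<oplus> y \<otimes> (a \<ominus> b) = x \<otimes> a \<ominus> y \<otimes> b"
      if "x \<in> carrier T" "y \<in> carrier T" for x y
      using that a b by algebra
    then show ?thesis using a b by simp
  qed
  then show ?case using Suc ab a b J.I_r_closed J.I_l_closed J.a_closed by simp
qed

text \<open>Modulo \<open>t\<^bsup>1/p\<^sup>j\<^esup> - s\<close>, every power \<open>t\<^bsup>i/p\<^sup>n\<^esup>\<close> with \<open>n = j + d\<close> reduces to an exponent \<open>i < p\<^sup>d\<close>.\<close>

lemma layer_reduce:
  assumes s: "s \<in> carrier K" and q: "q = p ^ d"
    and J: "ideal J T" "root j \<ominus> inl s \<in> J" and x: "x \<in> layer (j + d)"
  shows "\<exists>b y. (\<forall>i. b i \<in> carrier K) \<and> y \<in> J \<and>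
    x = (\<Oplus>i\<in>{..<q}. inl (b i) \<otimes> root (j + d) [^] i) \<oplus> y"
  using x
proof (induction rule: layer.induct)
  interpret J: ideal J T by (rule J(1))
  let ?\<tau> = "root (j + d)"
  let ?S = "\<lambda>b. \<Oplus>i\<in>{..<q}. inl (b i) \<otimes> ?\<tau> [^] i"
  {
    case zero
    have "\<zero> = ?S (\<lambda>i. \<zero>\<^bsub>K\<^esub>) \<oplus> \<zero>" by simp
    then show ?case using J.zero_closed by (intro exI[of _ "\<lambda>i. \<zero>\<^bsub>K\<^esub>"] exI[of _ "\<zero>"]) auto
  next
    case (monom k i)
    have q0: "0 < q" using F.p_pos q by simp
    \<comment> \<open>Division of the exponent by \<open>q\<close>: the \<open>q\<close>-th power of
      \<open>root (j + d)\<close> is \<open>root j\<close>, so the quotient \<open>l1\<close>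
      becomes an exponent of \<open>root j\<close>, which may be replaced by \<open>s\<close> modulo
      \<open>J\<close>.\<close>
    define l0 l1 where "l0 = i mod q" and "l1 = i div q"
    have l0: "l0 < q" unfolding l0_def using q0 by simp
    let ?k = "k \<otimes>\<^bsub>K\<^esub> s [^]\<^bsub>K\<^esub> l1"
    define b where "b m = (if m = l0 then ?k else \<zero>\<^bsub>K\<^esub>)" for m
    let ?y = "(inl k \<otimes> ?\<tau> [^] l0) \<otimes> (root j [^] l1 \<ominus> inl s [^] l1)"
    have y: "?y \<in> J"
      using pow_diff_in_ideal[OF J(1) root_closed _ J(2), of l1] s monom
      by (intro J.I_l_closed) auto
    have "?S b = (\<Oplus>m\<in>{l0}. inl (b m) \<otimes> ?\<tau> [^] m)"
      using l0 monom s unfolding b_def by (intro T.add.finprod_mono_neutral_cong_right) auto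
    then have Sb: "?S b = inl ?k \<otimes> ?\<tau> [^] l0" unfolding b_def using monom s by simp
    have i: "i = l0 + q * l1" unfolding l0_def l1_def by simp
    have "?\<tau> [^] i = ?\<tau> [^] l0 \<otimes> root j [^] l1"
      unfolding i using root_pow[of j d] q by (simp add: T.nat_pow_mult[symmetric] T.nat_pow_pow[symmetric])
    moreover have "inl k \<otimes> (u \<otimes> v) = (inl k \<otimes> w) \<otimes> u \<oplus> (inl k \<otimes> u) \<otimes> (v \<ominus> w)"
      if "u \<in> carrier T" "v \<in> carrier T" "w \<in> carrier T" for u v w
    proof -
      have "inl k \<in> carrier T" using monom by simp
      then show ?thesis using that by algebra
    qed
    ultimately have "inl k \<otimes> ?\<tau> [^] i = (inl k \<otimes> inl s [^] l1) \<otimes> ?\<tau> [^] l0 \<oplus> ?y"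
      using s by simp
    also have "\<dots> = ?S b \<oplus> ?y" unfolding Sb using s monom by (simp add: inl.hom_nat_pow)
    finally have "inl k \<otimes> ?\<tau> [^] i = ?S b \<oplus> ?y" .
    moreover have "\<forall>i. b i \<in> carrier K" unfolding b_def using monom s by simp
    ultimately show ?case using y by blast
  next
    case (add x x')
    obtain b y where b: "\<And>i. b i \<in> carrier K" "y \<in> J" "x = ?S b \<oplus> y" using add by blast
    obtain b' y' where b': "\<And>i. b' i \<in> carrier K" "y' \<in> J" "x' = ?S b' \<oplus> y'" using add by blast
    have "?S (\<lambda>i. b i \<oplus>\<^bsub>K\<^esub> b' i) = (\<Oplus>i\<in>{..<q}. inl (b i) \<otimes> ?\<tau> [^] i \<oplus> inl (b' i) \<otimes> ?\<tau> [^] i)"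
      using b b' by (intro T.finsum_cong') (auto simp: T.l_distr)
    also have "\<dots> = ?S b \<oplus> ?S b'" using b b' by (intro T.finsum_addf) auto
    finally have S: "?S (\<lambda>i. b i \<oplus>\<^bsub>K\<^esub> b' i) = ?S b \<oplus> ?S b'" .
    have c: "?S b \<in> carrier T" "?S b' \<in> carrier T" "y \<in> carrier T" "y' \<in> carrier T"
      using b b' J.a_subset by (auto intro!: T.finsum_closed)
    have "x \<oplus> x' = ?S (\<lambda>i. b i \<oplus>\<^bsub>K\<^esub> b' i) \<oplus> (y \<oplus> y')"
      unfolding S b(3) b'(3) using c by (simp add: T.a_ac)
    moreover have "y \<oplus> y' \<in> J" using b b' by simp
    ultimately show ?case using b(1) b'(1)
      by (intro exI[of _ "\<lambda>i. b i \<oplus>\<^bsub>K\<^esub> b' i"] exI[of _ "y \<oplus> y'"]) auto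
  }
qed

lemma root_diff_nilp:
  assumes "s \<in> carrier K" "s [^]\<^bsub>K\<^esub> (p ^ j) = \<alpha> t"
  shows "root j \<ominus> inl s \<in> nilp"
proof -
  have "(root j \<ominus> inl s) [^] (p ^ j) = root j [^] (p ^ j) \<ominus> inl s [^] (p ^ j)"
    using assms by (intro T.frobenius_diff) auto
  also have "\<dots> = inl (\<alpha> t) \<ominus> inl (\<alpha> t)"
    unfolding root_pow_p inl.hom_nat_pow[OF assms(1), symmetric] assms(2) ..
  also have "\<dots> = \<zero>" using t by (simp add: a_minus_def T.r_neg)
  finally show ?thesis using assms(1) unfolding nilp_def by auto
qed

text \<open>The power with exponent \<open>p^(j+d)\<close> turns \<open>root (j + d)\<close> into
  \<open>t\<close>, which is \<open>s^(p^j)\<close> in \<open>K\<close>. The combination thereby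
  becomes the \<open>p^j\<close>-th power of the sum of the \<open>b i^(p^d) * s^i\<close>, an
  element of \<open>K\<close>. Being nilpotent it is zero, and the independence of the powers of
  \<open>s\<close> applies. For \<open>d = 0\<close> there is only one term, so \<open>s\<close> may
  be a \<open>p\<close>-th power.\<close>

lemma nilpotent_combination_trivial:
  assumes s: "s \<in> carrier K" "s [^]\<^bsub>K\<^esub> (p ^ j) = \<alpha> t"
    and d: "d = 0 \<or> s \<notin> (\<lambda>x. x [^]\<^bsub>K\<^esub> p) ` carrier K"
    and b: "\<And>i. b i \<in> carrier K"
    and w: "(\<Oplus>i\<in>{..<p ^ d}. inl (b i) \<otimes> root (j + d) [^] i) \<in> nilp" (is "?w \<in> nilp")
    and i: "i < p ^ d"
  shows "b i = \<zero>\<^bsub>K\<^esub>"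
proof -
  interpret il: ring_hom_cring K T inl
    by (intro ring_hom_cringI K.is_cring T.is_cring inl.homh)
  let ?z = "\<Oplus>\<^bsub>K\<^esub>i\<in>{..<p ^ d}. b i [^]\<^bsub>K\<^esub> (p ^ d) \<otimes>\<^bsub>K\<^esub> s [^]\<^bsub>K\<^esub> i"
  have z: "?z \<in> carrier K" using b s by (intro K.finsum_closed) auto
  have "?w [^] (p ^ (j + d)) = (\<Oplus>i\<in>{..<p ^ d}. (inl (b i) \<otimes> root (j + d) [^] i) [^] (p ^ (j + d)))"
    using b by (intro T.frobenius_finsum) auto
  also have "\<dots> = (\<Oplus>i\<in>{..<p ^ d}. inl ((b i [^]\<^bsub>K\<^esub> (p ^ d) \<otimes>\<^bsub>K\<^esub> s [^]\<^bsub>K\<^esub> i) [^]\<^bsub>K\<^esub> (p ^ j)))"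
  proof (intro T.finsum_cong')
    fix i :: nat
    have "(root (j + d) [^] i) [^] (p ^ (j + d)) = (root (j + d) [^] (p ^ (j + d))) [^] i"
      by (simp add: T.nat_pow_pow mult.commute)
    also have "\<dots> = inl (s [^]\<^bsub>K\<^esub> (p ^ j)) [^] i" unfolding root_pow_p s(2) ..
    also have "\<dots> = inl ((s [^]\<^bsub>K\<^esub> i) [^]\<^bsub>K\<^esub> (p ^ j))"
      using s(1) by (simp add: inl.hom_nat_pow[symmetric] K.nat_pow_pow mult.commute del: inl.hom_nat_pow)
    finally have e: "(root (j + d) [^] i) [^] (p ^ (j + d)) = inl ((s [^]\<^bsub>K\<^esub> i) [^]\<^bsub>K\<^esub> (p ^ j))" .
    have "inl (b i) [^] (p ^ (j + d)) = inl ((b i [^]\<^bsub>K\<^esub> (p ^ d)) [^]\<^bsub>K\<^esub> (p ^ j))"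
      using b by (simp add: inl.hom_nat_pow[symmetric] K.nat_pow_pow power_add mult.commute del: inl.hom_nat_pow)
    then show "(inl (b i) \<otimes> root (j + d) [^] i) [^] (p ^ (j + d))
        = inl ((b i [^]\<^bsub>K\<^esub> (p ^ d) \<otimes>\<^bsub>K\<^esub> s [^]\<^bsub>K\<^esub> i) [^]\<^bsub>K\<^esub> (p ^ j))"
      using b s e by (simp add: T.nat_pow_distrib K.nat_pow_distrib del: inl.hom_nat_pow)
  qed (use b s in auto)
  also have "\<dots> = inl (\<Oplus>\<^bsub>K\<^esub>i\<in>{..<p ^ d}. (b i [^]\<^bsub>K\<^esub> (p ^ d) \<otimes>\<^bsub>K\<^esub> s [^]\<^bsub>K\<^esub> i) [^]\<^bsub>K\<^esub> (p ^ j))"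
    using b s by (intro il.hom_finsum[symmetric, unfolded comp_def]) auto
  also have "\<dots> = inl (?z [^]\<^bsub>K\<^esub> (p ^ j))"
    using b s by (intro arg_cong[of _ _ inl] K.frobenius_finsum[symmetric]) auto
  finally have wz: "?w [^] (p ^ (j + d)) = inl (?z [^]\<^bsub>K\<^esub> (p ^ j))" .
  obtain m where m: "?w \<in> carrier T" "?w [^] (p ^ m) = \<zero>" using w unfolding nilp_def by auto
  have "(?w [^] (p ^ (j + d))) [^] (p ^ m) = (?w [^] (p ^ m)) [^] (p ^ (j + d))"
    using m(1) by (simp only: T.nat_pow_pow mult.commute)
  also have "\<dots> = \<zero>" unfolding m(2) by (rule T.frobenius_zero)
  finally have "inl (?z [^]\<^bsub>K\<^esub> (p ^ j)) [^] (p ^ m) = \<zero>" unfolding wz .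
  then have "inl (?z [^]\<^bsub>K\<^esub> (p ^ j)) \<in> nilp" unfolding nilp_def using z by auto
  then have "?z [^]\<^bsub>K\<^esub> (p ^ j) = \<zero>\<^bsub>K\<^esub>" using z by (intro inl_nilp) auto
  then have z0: "?z = \<zero>\<^bsub>K\<^esub>" using K.frobenius_eq_zero_iff[OF z] by blast
  show ?thesis
  proof (cases "d = 0")
    case True
    have "?z = b 0" using b[of 0] unfolding True by (simp add: lessThan_Suc)
    then show ?thesis using z0 i True by simp
  next
    case False
    then show ?thesis
      using d b by (intro K.iterated_powers_independent[OF s(1) _ _ z0 i]) auto
  qed
qed

text \<open>Modulo the principal ideal of \<open>root j - s\<close>, the element reduces to a
  combination of finitely many powers of \<open>root (j + d)\<close>. That combination is still
  nilpotent, hence trivial. The alternative \<open>d = 0\<close> serves the case where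
  \<open>s\<close> has further roots.\<close>

lemma nilpotent_multiple:
  assumes s: "s \<in> carrier K" "s [^]\<^bsub>K\<^esub> (p ^ j) = \<alpha> t"
    and d: "d = 0 \<or> s \<notin> (\<lambda>x. x [^]\<^bsub>K\<^esub> p) ` carrier K"
    and x: "x \<in> layer (j + d)" "x \<in> nilp"
  shows "\<exists>z\<in>carrier T. x = z \<otimes> (root j \<ominus> inl s)"
proof -
  let ?g = "root j \<ominus> inl s"
  have g: "?g \<in> carrier T" "?g \<in> nilp" using s root_diff_nilp[OF s] by auto
  have J: "ideal (PIdl ?g) T" using g by (intro T.cgenideal_ideal) auto
  obtain b y where b: "\<And>i. b i \<in> carrier K" and y: "y \<in> PIdl ?g"
    and x_eq: "x = (\<Oplus>i\<in>{..<p ^ d}. inl (b i) \<otimes> root (j + d) [^] i) \<oplus> y"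
    using layer_reduce[OF s(1) refl J T.cgenideal_self[OF g(1)] x(1)] by auto
  let ?w = "\<Oplus>i\<in>{..<p ^ d}. inl (b i) \<otimes> root (j + d) [^] i"
  obtain z where z: "z \<in> carrier T" "y = z \<otimes> ?g" using y unfolding cgenideal_def by auto
  have yn: "y \<in> nilp" unfolding z(2) by (rule nilp_mult[OF g(2) z(1)])
  have wc: "?w \<in> carrier T" using b by (intro T.finsum_closed) auto
  have yc: "y \<in> carrier T" using yn unfolding nilp_def by simp
  have "?w = x \<ominus> y" unfolding x_eq using wc yc by (simp add: a_minus_def T.a_assoc T.r_neg)
  then have "?w \<in> nilp" using nilp_diff[OF x(2) yn] by simp
  then have "b i = \<zero>\<^bsub>K\<^esub>" if "i < p ^ d" for i
    using nilpotent_combination_trivial[OF s d, of b i] b that by blast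
  then have "?w = (\<Oplus>i\<in>{..<p ^ d}. \<zero>)" by (intro T.finsum_cong') auto
  then have "?w = \<zero>" by simp
  then have "x = y" using x_eq yc by simp
  then show ?thesis using z by blast
qed

text \<open>Either \<open>t\<close> has a last \<open>p\<close>-power root \<open>s = t\<^bsup>1/p\<^sup>j\<^esup>\<close> in \<open>K\<close>, and the nilradical is generated by
  \<open>t\<^bsup>1/p\<^sup>j\<^esup> \<otimes> 1 - 1 \<otimes> s\<close>, or the nilradical is generated by such differences for all \<open>j\<close>, each of
  which is the \<open>p\<close>-th power of the next one.\<close>

lemma nilp_generator:
  "\<exists>g\<in>nilp. \<forall>x\<in>nilp. \<exists>z\<in>carrier T. \<exists>w\<in>ideal_prod T nilp nilp. x = z \<otimes> g \<oplus> w"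
proof -
  interpret N2: ideal "ideal_prod T nilp nilp" T
    by (rule T.ideal_prod_is_ideal[OF nilp_ideal nilp_ideal])
  have nilpc: "x \<in> carrier T" if "x \<in> nilp" for x using that unfolding nilp_def by simp
  show ?thesis
  proof (cases "\<exists>j s. s \<in> carrier K \<and> s [^]\<^bsub>K\<^esub> (p ^ j) = \<alpha> t \<and> s \<notin> (\<lambda>x. x [^]\<^bsub>K\<^esub> p) ` carrier K")
    case True
    then obtain j s where s: "s \<in> carrier K" "s [^]\<^bsub>K\<^esub> (p ^ j) = \<alpha> t" "s \<notin> (\<lambda>x. x [^]\<^bsub>K\<^esub> p) ` carrier K"
      by blast
    have "\<exists>z\<in>carrier T. x = z \<otimes> (root j \<ominus> inl s) \<oplus> \<zero>" if x: "x \<in> nilp" for x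
    proof -
      obtain n where "x \<in> layer n" using exists_layer[OF nilpc[OF x]] by blast
      then have "x \<in> layer (j + n)" using layer_mono[of x n j] by (simp add: add.commute)
      then obtain z where "z \<in> carrier T" "x = z \<otimes> (root j \<ominus> inl s)"
        using nilpotent_multiple[OF s(1,2) _ _ x] s(3) by blast
      then show ?thesis using s(1) by auto
    qed
    then show ?thesis
      using root_diff_nilp[OF s(1,2)] N2.zero_closed by blast
  next
    case False
    \<comment> \<open>Without a last root every \<open>p\<close>-power root of \<open>t\<close> in
      \<open>K\<close> is again a \<open>p\<close>-th power, so roots exist at all levels.\<close>
    have root: "\<exists>s\<in>carrier K. s [^]\<^bsub>K\<^esub> (p ^ n) = \<alpha> t" for n
    proof (induction n)
      case 0
      then show ?case using t by (intro bexI[of _ "\<alpha> t"]) auto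
    next
      case (Suc n)
      then obtain s where s: "s \<in> carrier K" "s [^]\<^bsub>K\<^esub> (p ^ n) = \<alpha> t" by blast
      then obtain u where u: "u \<in> carrier K" "s = u [^]\<^bsub>K\<^esub> p" using False by blast
      then have "u [^]\<^bsub>K\<^esub> (p ^ Suc n) = \<alpha> t" using s by (simp add: K.nat_pow_pow)
      then show ?case using u by blast
    qed
    \<comment> \<open>In this case every nilpotent element lies in the square of the ideal, so zero
      serves as the generator.\<close>
    have "\<exists>z\<in>carrier T. \<exists>w\<in>ideal_prod T nilp nilp. x = z \<otimes> \<zero> \<oplus> w" if x: "x \<in> nilp" for x
    proof -
      obtain n where n: "x \<in> layer n" using exists_layer[OF nilpc[OF x]] by blast
      \<comment> \<open>A root one level above the layer of \<open>x\<close>: the difference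
        \<open>root n - s\<close> is then the \<open>p\<close>-th power of the nilpotent element
        \<open>?h\<close>.\<close>
      obtain u where u: "u \<in> carrier K" "u [^]\<^bsub>K\<^esub> (p ^ (n + 1)) = \<alpha> t" using root by blast
      define s where "s = u [^]\<^bsub>K\<^esub> p"
      have s: "s \<in> carrier K" "s [^]\<^bsub>K\<^esub> (p ^ n) = \<alpha> t"
        unfolding s_def using u by (auto simp: K.nat_pow_pow)
      let ?h = "root (n + 1) \<ominus> inl u"
      have h: "?h \<in> nilp" by (rule root_diff_nilp[OF u])
      have hc: "?h \<in> carrier T" by (rule nilpc[OF h])
      have "?h [^] (p ^ 1) = root (n + 1) [^] (p ^ 1) \<ominus> inl u [^] (p ^ 1)"
        using u by (intro T.frobenius_diff) auto
      also have "\<dots> = root n \<ominus> inl s"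
        unfolding root_pow s_def using u(1) by (simp add: inl.hom_nat_pow)
      finally have hp: "root n \<ominus> inl s = ?h [^] p" by simp
      obtain z where z: "z \<in> carrier T" "x = z \<otimes> (root n \<ominus> inl s)"
        using nilpotent_multiple[OF s, of 0] n x by auto
      \<comment> \<open>As \<open>p\<close> is at least two, two factors \<open>?h\<close> can be
        split off, one for each factor of the ideal product.\<close>
      obtain k where k: "p = k + 1 + 1"
        using F.prime_p prime_ge_2_nat[of p] by (metis add.assoc add.commute le_Suc_ex one_add_one)
      have "x = (z \<otimes> ?h [^] k \<otimes> ?h) \<otimes> ?h"
        unfolding z(2) hp using z(1) hc by (subst k) (simp add: T.m_assoc)
      moreover have "(z \<otimes> ?h [^] k \<otimes> ?h) \<otimes> ?h \<in> ideal_prod T nilp nilp"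
        using z(1) hc h by (intro ideal_prod.prod nilp_mult) auto
      ultimately have "x \<in> ideal_prod T nilp nilp" by simp
      then show ?thesis using nilpc[OF x] by (intro bexI[of _ "\<zero>"] bexI[of _ x]) auto
    qed
    moreover have "\<zero> \<in> nilp" unfolding nilp_def using T.frobenius_zero by auto
    ultimately show ?thesis by blast
  qed
qed

end

section \<open>Embedding dimension\<close>

lemma edim_le_1I:
  fixes A :: "'a ring" (structure)
  assumes A: "cring A" and m: "maximalideal m A" "max_ideal A = m"
    and g: "g \<in> m"
    and gen: "\<And>x. x \<in> m \<Longrightarrow> \<exists>z\<in>carrier A. \<exists>w\<in>ideal_prod A m m. x = z \<otimes> g \<oplus> w"
  shows "edim A \<le> 1"
proof -
  interpret A: cring A by (rule A)
  interpret m: maximalideal m A by (rule m(1))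
  interpret m2: ideal "ideal_prod A m m" A by (rule A.ideal_prod_is_ideal[OF m.ideal_axioms m.ideal_axioms])
  interpret k: field "A Quot m" by (rule m.quotient_is_field[OF A])
  define I2 where "I2 = ideal_prod A m m"
  let ?k = "A Quot m" and ?V = "cotangent_space A" and ?q = "\<lambda>x. I2 +> x" and ?h = "\<lambda>a. m +> a"
  interpret I2: ideal I2 A unfolding I2_def by (rule m2.ideal_axioms)
  have V: "carrier ?V = ?q ` m" "\<zero>\<^bsub>?V\<^esub> = I2" "add ?V = set_add A"
    "C \<odot>\<^bsub>?V\<^esub> U = (\<Union>a\<in>C. \<Union>x\<in>U. I2 +> (a \<otimes> x))" for C U
    unfolding cotangent_space_def Let_def m(2) I2_def by simp_all
  have mc: "x \<in> carrier A" if "x \<in> m" for x using that m.a_subset by auto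
  have I2m: "x \<in> m" if "x \<in> I2" for x
    using that unfolding I2_def
    using A.ideal_prod_inter[OF m.ideal_axioms m.ideal_axioms] by auto
  have coset: "?q x = ?q y" if x: "x \<in> carrier A" and y: "y \<in> carrier A" and xy: "x \<ominus> y \<in> I2" for x y
  proof -
    have "x = (x \<ominus> y) \<oplus> y" using x y by (simp add: a_minus_def A.a_assoc A.l_neg)
    then have "x \<in> ?q y" using xy unfolding a_r_coset_def' by blast
    then show ?thesis using I2.a_repr_independence' y by metis
  qed
  have smult: "?h a \<odot>\<^bsub>?V\<^esub> ?q x = ?q (a \<otimes> x)" if a: "a \<in> carrier A" and x: "x \<in> m" for a x
  proof -
    \<comment> \<open>Scalar multiplication in \<open>cotangent_space\<close> is a union over
      representatives of both the scalar and the vector. Changing the scalar by an element of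
      \<open>m\<close> or the vector by one of \<open>I2\<close> changes the product by an element
      of \<open>I2\<close>.\<close>
    have eq: "?q (a' \<otimes> x') = ?q (a \<otimes> x)" if a': "a' \<in> ?h a" and x': "x' \<in> ?q x" for a' x'
    proof -
      obtain u where u: "u \<in> m" "a' = u \<oplus> a" using a' unfolding a_r_coset_def' by auto
      obtain v where v: "v \<in> I2" "x' = v \<oplus> x" using x' unfolding a_r_coset_def' by auto
      have c: "u \<in> carrier A" "v \<in> carrier A" "x \<in> carrier A" using u v x mc I2m by auto
      have "a' \<otimes> x' \<ominus> a \<otimes> x = (u \<oplus> a) \<otimes> v \<oplus> u \<otimes> x"
        unfolding u(2) v(2) using c a by algebra
      moreover have "(u \<oplus> a) \<otimes> v \<in> I2" using c a v by (intro I2.I_l_closed) auto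
      moreover have "u \<otimes> x \<in> I2" unfolding I2_def by (rule ideal_prod.prod[OF u(1) x])
      ultimately show ?thesis unfolding u(2) v(2) using c a by (intro coset) (auto intro: I2.a_closed)
    qed
    have "a \<in> ?h a" using m.a_rcos_self a by auto
    moreover have "x \<in> ?q x" using I2.a_rcos_self mc[OF x] by auto
    ultimately have "(\<Union>a'\<in>?h a. \<Union>x'\<in>?q x. ?q (a' \<otimes> x')) = ?q (a \<otimes> x)"
      using eq by (intro UN_constant_eq[of a] ballI UN_constant_eq[of x])
    then show ?thesis unfolding V(4) .
  qed
  \<comment> \<open>The maximal ideal as a module over \<open>A\<close>. The cotangent space is its
    image under the coset map, with scalars passing from \<open>A\<close> to the residue
    field.\<close>
  let ?M = "\<lparr>carrier = m, mult = mult A, one = one A, zero = zero A, add = add A, smult = mult A\<rparr> :: ('a, 'a) module"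
  have M: "module A ?M"
  proof (rule moduleI[OF A abelian_groupI])
    fix x assume "x \<in> carrier ?M"
    then show "\<exists>y\<in>carrier ?M. y \<oplus>\<^bsub>?M\<^esub> x = \<zero>\<^bsub>?M\<^esub>"
      using mc A.l_neg by (intro bexI[of _ "\<ominus> x"]) auto
  qed (use mc in \<open>auto simp: A.a_ac A.l_distr A.r_distr A.m_assoc intro: m.I_l_closed\<close>)
  have mod: "module ?k ?V"
  proof (rule module_of_surjection[OF M k.is_cring, of ?h ?q])
    show "?h ` carrier A = carrier ?k" unfolding FactRing_def A_RCOSETS_def' by auto
    show "?h \<in> ring_hom A ?k" by (rule m.rcos_ring_hom)
    show "?q ` carrier ?M = carrier ?V" unfolding V by simp
    show "?q \<zero>\<^bsub>?M\<^esub> = \<zero>\<^bsub>?V\<^esub>" unfolding V using I2.a_rcos_const[OF I2.zero_closed] by simp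
    show "?q (x \<oplus>\<^bsub>?M\<^esub> y) = ?q x \<oplus>\<^bsub>?V\<^esub> ?q y" if "x \<in> carrier ?M" "y \<in> carrier ?M" for x y
      using I2.a_rcos_sum[of x y] that mc unfolding V by simp
    show "?q (a \<odot>\<^bsub>?M\<^esub> x) = ?h a \<odot>\<^bsub>?V\<^esub> ?q x" if "a \<in> carrier A" "x \<in> carrier ?M" for a x
      using smult that by simp
  qed
  have vs: "vectorspace ?k ?V" using mod k.field_axioms by (intro vectorspace.intro)
  show ?thesis unfolding edim_def m(2)
  proof (rule vdim_le_1I[OF vs])
    show "?q g \<in> carrier ?V" unfolding V using g by auto
    fix v assume "v \<in> carrier ?V"
    then obtain x where x: "x \<in> m" "v = ?q x" unfolding V by auto
    obtain z w where zw: "z \<in> carrier A" "w \<in> I2" "x = z \<otimes> g \<oplus> w" using gen[OF x(1)] unfolding I2_def by blast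
    have c: "z \<otimes> g \<in> carrier A" "w \<in> carrier A" using zw mc[OF g] I2m mc by auto
    have "x \<ominus> z \<otimes> g = w" unfolding zw(3) using c by (simp add: a_minus_def A.a_ac A.r_neg)
    then have "v = ?q (z \<otimes> g)" unfolding x(2) using zw c mc[OF x(1)] by (intro coset) auto
    also have "\<dots> = ?h z \<odot>\<^bsub>?V\<^esub> ?q g" using smult zw g by simp
    finally show "\<exists>c\<in>carrier ?k. v = c \<odot>\<^bsub>?V\<^esub> ?q g"
      using zw(1) ring_hom_closed[OF m.rcos_ring_hom] by blast
  qed
qed

section \<open>The stalk at the generic point\<close>

lemma Union_pair_const:
  assumes "(a, b) \<in> A" "(c, d) \<in> B"
    and "\<And>a b c d. \<lbrakk>(a, b) \<in> A; (c, d) \<in> B\<rbrakk> \<Longrightarrow> f a b c d = z"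
  shows "(\<Union>(a, b)\<in>A. \<Union>(c, d)\<in>B. f a b c d) = z"
  using assms by fast

section \<open>Arithmetic of fractions\<close>

locale fractions = cring R for R :: "'a ring" (structure) +
  fixes S :: "'a set"
  assumes S: "S \<subseteq> carrier R" "\<one> \<in> S" "\<And>s t. \<lbrakk>s \<in> S; t \<in> S\<rbrakk> \<Longrightarrow> s \<otimes> t \<in> S"
begin

lemma S_carrier: "s \<in> S \<Longrightarrow> s \<in> carrier R" using S by auto

lemma mem_frac: "(b, t) \<in> frac R S a s \<longleftrightarrow> b \<in> carrier R \<and> t \<in> S \<and> (\<exists>u\<in>S. u \<otimes> (a \<otimes> t) = u \<otimes> (b \<otimes> s))"
  unfolding frac_def by simp

lemma frac_self: "\<lbrakk>a \<in> carrier R; s \<in> S\<rbrakk> \<Longrightarrow> (a, s) \<in> frac R S a s"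
  unfolding mem_frac using S(2) by auto

lemma frac_eqI:
  assumes a: "a \<in> carrier R" "s \<in> S" and b: "b \<in> carrier R" "t \<in> S"
    and u: "u \<in> S" "u \<otimes> (a \<otimes> t) = u \<otimes> (b \<otimes> s)"
  shows "frac R S a s = frac R S b t"
proof -
  have sub: "frac R S a s \<subseteq> frac R S b t"
    if a: "a \<in> carrier R" "s \<in> S" and b: "b \<in> carrier R" "t \<in> S"
      and u: "u \<in> S" "u \<otimes> (a \<otimes> t) = u \<otimes> (b \<otimes> s)" for a s b t u
  proof (rule subrelI)
    fix c w assume "(c, w) \<in> frac R S a s"
    then obtain v where c: "c \<in> carrier R" "w \<in> S" and v: "v \<in> S" "v \<otimes> (a \<otimes> w) = v \<otimes> (c \<otimes> s)"
      unfolding mem_frac by auto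
    note R = a(1) b(1) c(1) S_carrier[OF a(2)] S_carrier[OF b(2)] S_carrier[OF c(2)]
      S_carrier[OF u(1)] S_carrier[OF v(1)]
    \<comment> \<open>Transitivity of equality of fractions: the auxiliary factor is the product of
      the two given ones with the denominator \<open>s\<close> of the middle fraction.\<close>
    have "(u \<otimes> v \<otimes> s) \<otimes> (b \<otimes> w) = (u \<otimes> (b \<otimes> s)) \<otimes> (v \<otimes> w)" using R by (simp add: m_ac)
    also have "\<dots> = (v \<otimes> (a \<otimes> w)) \<otimes> (u \<otimes> t)" unfolding u(2)[symmetric] using R by (simp add: m_ac)
    also have "\<dots> = (u \<otimes> v \<otimes> s) \<otimes> (c \<otimes> t)" unfolding v(2) using R by (simp add: m_ac)
    finally have "(u \<otimes> v \<otimes> s) \<otimes> (b \<otimes> w) = (u \<otimes> v \<otimes> s) \<otimes> (c \<otimes> t)" .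
    moreover have "u \<otimes> v \<otimes> s \<in> S" using S(3) u v a by simp
    ultimately show "(c, w) \<in> frac R S b t" unfolding mem_frac using c by blast
  qed
  show ?thesis using sub[OF a b u] sub[OF b a u(1) u(2)[symmetric]] by auto
qed

lemma frac_closed: "\<lbrakk>a \<in> carrier R; s \<in> S\<rbrakk> \<Longrightarrow> frac R S a s \<in> carrier (localization R S)"
  unfolding localization_def by auto

lemma frac_mult:
  assumes a: "a \<in> carrier R" "s \<in> S" and b: "b \<in> carrier R" "t \<in> S"
  shows "frac R S a s \<otimes>\<^bsub>localization R S\<^esub> frac R S b t = frac R S (a \<otimes> b) (s \<otimes> t)"
  unfolding localization_def monoid.simps
proof (rule Union_pair_const[OF frac_self[OF a] frac_self[OF b]])
  fix a' s' b' t' assume a': "(a', s') \<in> frac R S a s" and b': "(b', t') \<in> frac R S b t"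
  obtain u where u: "a' \<in> carrier R" "s' \<in> S" "u \<in> S" "u \<otimes> (a \<otimes> s') = u \<otimes> (a' \<otimes> s)" using a' unfolding mem_frac by auto
  obtain v where v: "b' \<in> carrier R" "t' \<in> S" "v \<in> S" "v \<otimes> (b \<otimes> t') = v \<otimes> (b' \<otimes> t)" using b' unfolding mem_frac by auto
  note R = a(1) b(1) u(1) v(1) S_carrier[OF a(2)] S_carrier[OF b(2)] S_carrier[OF u(2)] S_carrier[OF v(2)]
    S_carrier[OF u(3)] S_carrier[OF v(3)]
  have "(u \<otimes> v) \<otimes> ((a' \<otimes> b') \<otimes> (s \<otimes> t)) = (u \<otimes> (a' \<otimes> s)) \<otimes> (v \<otimes> (b' \<otimes> t))" using R by (simp add: m_ac)
  also have "\<dots> = (u \<otimes> v) \<otimes> ((a \<otimes> b) \<otimes> (s' \<otimes> t'))"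
    unfolding u(4)[symmetric] v(4)[symmetric] using R by (simp add: m_ac)
  finally show "frac R S (a' \<otimes> b') (s' \<otimes> t') = frac R S (a \<otimes> b) (s \<otimes> t)"
    using a b u v S(3) by (intro frac_eqI[of _ _ _ _ "u \<otimes> v"]) auto
qed

lemma frac_add:
  assumes a: "a \<in> carrier R" "s \<in> S" and b: "b \<in> carrier R" "t \<in> S"
  shows "frac R S a s \<oplus>\<^bsub>localization R S\<^esub> frac R S b t = frac R S (a \<otimes> t \<oplus> b \<otimes> s) (s \<otimes> t)"
  unfolding localization_def ring.simps
proof (rule Union_pair_const[OF frac_self[OF a] frac_self[OF b]])
  fix a' s' b' t' assume a': "(a', s') \<in> frac R S a s" and b': "(b', t') \<in> frac R S b t"
  obtain u where u: "a' \<in> carrier R" "s' \<in> S" "u \<in> S" "u \<otimes> (a \<otimes> s') = u \<otimes> (a' \<otimes> s)" using a' unfolding mem_frac by auto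
  obtain v where v: "b' \<in> carrier R" "t' \<in> S" "v \<in> S" "v \<otimes> (b \<otimes> t') = v \<otimes> (b' \<otimes> t)" using b' unfolding mem_frac by auto
  note R = a(1) b(1) u(1) v(1) S_carrier[OF a(2)] S_carrier[OF b(2)] S_carrier[OF u(2)] S_carrier[OF v(2)]
    S_carrier[OF u(3)] S_carrier[OF v(3)]
  have "(u \<otimes> v) \<otimes> ((a' \<otimes> t' \<oplus> b' \<otimes> s') \<otimes> (s \<otimes> t))
      = (u \<otimes> (a' \<otimes> s)) \<otimes> (v \<otimes> (t \<otimes> t')) \<oplus> (v \<otimes> (b' \<otimes> t)) \<otimes> (u \<otimes> (s \<otimes> s'))"
    using R by (simp add: l_distr r_distr m_ac)
  also have "\<dots> = (u \<otimes> v) \<otimes> ((a \<otimes> t \<oplus> b \<otimes> s) \<otimes> (s' \<otimes> t'))"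
    unfolding u(4)[symmetric] v(4)[symmetric] using R by (simp add: l_distr r_distr m_ac)
  finally show "frac R S (a' \<otimes> t' \<oplus> b' \<otimes> s') (s' \<otimes> t') = frac R S (a \<otimes> t \<oplus> b \<otimes> s) (s \<otimes> t)"
    using a b u v S(3) S_carrier by (intro frac_eqI[of _ _ _ _ "u \<otimes> v"]) auto
qed

lemma localization_one: "\<one>\<^bsub>localization R S\<^esub> = frac R S \<one> \<one>"
  unfolding localization_def by simp

end

lemma fractions_at_prime:
  assumes "cring R" "primeideal P R" shows "fractions R (carrier R - P)"
proof -
  interpret R: cring R by fact
  interpret P: primeideal P R by fact
  show ?thesis
  proof unfold_locales
    show "\<one>\<^bsub>R\<^esub> \<in> carrier R - P" using P.one_imp_carrier P.I_notcarr by auto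
    show "s \<otimes>\<^bsub>R\<^esub> t \<in> carrier R - P" if "s \<in> carrier R - P" "t \<in> carrier R - P" for s t
      using that P.I_prime by auto
  qed auto
qed

section \<open>Points, open sets and sections of a spectrum\<close>

lemma spec_points: "P \<in> topspace (spec_topology R) \<Longrightarrow> primeideal P R"
  unfolding spec_topology_def topology_generated_by_topspace by auto

lemma spec_basic_open: "a \<in> carrier R \<Longrightarrow> openin (spec_topology R) {P. primeideal P R \<and> a \<notin> P}"
  unfolding spec_topology_def by (rule topology_generated_by_Basis) auto

lemma spec_open_primes: "openin (spec_topology R) U \<Longrightarrow> P \<in> U \<Longrightarrow> primeideal P R"
  using openin_subset spec_points by blast

text \<open>Being empty or containing the zero ideal holds for the sets that generate the topology
  and is stable under intersections of two sets and arbitrary unions.\<close>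

lemma zero_ideal_mem_open:
  assumes R: "domain R" and U: "openin (spec_topology R) U" and ne: "U \<noteq> {}"
  shows "{\<zero>\<^bsub>R\<^esub>} \<in> U"
proof -
  interpret domain R by (rule R)
  have "generate_topology_on ((\<lambda>a. {P. primeideal P R \<and> a \<notin> P}) ` carrier R) U"
    using U unfolding spec_topology_def openin_topology_generated_by_iff .
  then have "U = {} \<or> {\<zero>\<^bsub>R\<^esub>} \<in> U"
  proof (induction rule: generate_topology_on.induct)
    case (Basis s)
    then obtain a where a: "a \<in> carrier R" "s = {P. primeideal P R \<and> a \<notin> P}" by auto
    show ?case
    proof (cases "a = \<zero>\<^bsub>R\<^esub>")
      case True
      have "\<zero>\<^bsub>R\<^esub> \<in> P" if "primeideal P R" for P
        using that by (simp add: primeideal_def ideal_def additive_subgroup.zero_closed)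
      then have "s = {}" using a True by auto
      then show ?thesis by simp
    next
      case False
      then show ?thesis using a zeroprimeideal by simp
    qed
  qed auto
  then show ?thesis using ne by simp
qed


lemma Spec_simps [simp]:
  "tops (Spec R) = spec_topology R" "sect (Spec R) U = fun_ring U (local_at R) (spec_sections R U)"
  "res (Spec R) U V \<sigma> = restrict \<sigma> V"
  unfolding Spec_def by simp_all

lemma fun_ring_simps [simp]:
  "carrier (fun_ring U A C) = C" "\<sigma> \<otimes>\<^bsub>fun_ring U A C\<^esub> \<tau> = (\<lambda>w\<in>U. \<sigma> w \<otimes>\<^bsub>A w\<^esub> \<tau> w)"
  "\<sigma> \<oplus>\<^bsub>fun_ring U A C\<^esub> \<tau> = (\<lambda>w\<in>U. \<sigma> w \<oplus>\<^bsub>A w\<^esub> \<tau> w)" "\<one>\<^bsub>fun_ring U A C\<^esub> = (\<lambda>w\<in>U. \<one>\<^bsub>A w\<^esub>)"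
  unfolding fun_ring_def by simp_all

context
  fixes R :: "'r ring"
  assumes R: "cring R"
begin

interpretation R: cring R by (rule R)

lemma frac_section:
  assumes "openin (spec_topology R) V" and a: "a \<in> carrier R" "b \<in> carrier R" and b: "\<And>Q. Q \<in> V \<Longrightarrow> b \<notin> Q"
  shows "(\<lambda>Q\<in>V. frac_at R Q a b) \<in> spec_sections R V"
proof -
  have "frac_at R Q a b \<in> carrier (local_at R Q)" if "Q \<in> V" for Q
    using fractions.frac_closed[OF fractions_at_prime[OF R spec_open_primes[OF assms(1) that]]] a b[OF that]
    by auto
  moreover have "\<exists>U c d. openin (spec_topology R) U \<and> P \<in> U \<and> U \<subseteq> V \<and> c \<in> carrier R \<and> d \<in> carrier R \<and>
      (\<forall>Q\<in>U. d \<notin> Q \<and> (\<lambda>Q\<in>V. frac_at R Q a b) Q = frac_at R Q c d)" if "P \<in> V" for P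
    using assms that by (intro exI[of _ V] exI[of _ a] exI[of _ b]) auto
  ultimately show ?thesis unfolding spec_sections_def by auto
qed

lemma spec_const_hom: "spec_const R \<in> ring_hom R (sect (Spec R) (points (Spec R)))"
proof -
  let ?U = "topspace (spec_topology R)"
  have one: "\<one>\<^bsub>R\<^esub> \<notin> Q" if "Q \<in> ?U" for Q
    using spec_points[OF that] by (metis ideal.one_imp_carrier primeideal.I_notcarr primeideal.axioms(1))
  have fr: "fractions R (carrier R - Q)" if "Q \<in> ?U" for Q
    using fractions_at_prime[OF R spec_points[OF that]] .
  have const: "spec_const R a = (\<lambda>Q\<in>?U. frac_at R Q a \<one>\<^bsub>R\<^esub>)" for a unfolding spec_const_def by simp
  show ?thesis
  proof (rule ring_hom_memI)
    fix a assume a: "a \<in> carrier R"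
    show "spec_const R a \<in> carrier (sect (Spec R) (points (Spec R)))"
      unfolding const using frac_section[of ?U a "\<one>\<^bsub>R\<^esub>"] a one by simp
    fix b assume b: "b \<in> carrier R"
    have "frac_at R Q a \<one>\<^bsub>R\<^esub> \<otimes>\<^bsub>local_at R Q\<^esub> frac_at R Q b \<one>\<^bsub>R\<^esub> = frac_at R Q (a \<otimes>\<^bsub>R\<^esub> b) \<one>\<^bsub>R\<^esub>"
      if Q: "Q \<in> ?U" for Q
      using fractions.frac_mult[OF fr[OF Q], of a "\<one>\<^bsub>R\<^esub>" b "\<one>\<^bsub>R\<^esub>"] a b one[OF Q] by simp
    then show "spec_const R (a \<otimes>\<^bsub>R\<^esub> b) = spec_const R a \<otimes>\<^bsub>sect (Spec R) (points (Spec R))\<^esub> spec_const R b"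
      unfolding const by (auto simp: restrict_def fun_eq_iff)
    have "frac_at R Q a \<one>\<^bsub>R\<^esub> \<oplus>\<^bsub>local_at R Q\<^esub> frac_at R Q b \<one>\<^bsub>R\<^esub> = frac_at R Q (a \<oplus>\<^bsub>R\<^esub> b) \<one>\<^bsub>R\<^esub>"
      if Q: "Q \<in> ?U" for Q
      using fractions.frac_add[OF fr[OF Q], of a "\<one>\<^bsub>R\<^esub>" b "\<one>\<^bsub>R\<^esub>"] a b one[OF Q] by simp
    then show "spec_const R (a \<oplus>\<^bsub>R\<^esub> b) = spec_const R a \<oplus>\<^bsub>sect (Spec R) (points (Spec R))\<^esub> spec_const R b"
      unfolding const by (auto simp: restrict_def fun_eq_iff)
  next
    show "spec_const R \<one>\<^bsub>R\<^esub> = \<one>\<^bsub>sect (Spec R) (points (Spec R))\<^esub>"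
      unfolding const using fractions.localization_one[OF fr] by (auto simp: restrict_def fun_eq_iff)
  qed
qed

end

section \<open>Germs and stalks\<close>

locale ringed = fixes Y :: "('a, 'b) rspace" and x :: 'a
  assumes Y: "ringed_space Y" and x: "x \<in> points Y"
begin

lemma sect_cring: "is_open Y U \<Longrightarrow> cring (sect Y U)"
  and res_hom: "\<lbrakk>is_open Y U; is_open Y V; V \<subseteq> U\<rbrakk> \<Longrightarrow> res Y U V \<in> ring_hom (sect Y U) (sect Y V)"
  and res_id: "\<lbrakk>is_open Y U; s \<in> carrier (sect Y U)\<rbrakk> \<Longrightarrow> res Y U U s = s"
  and res_res: "\<lbrakk>is_open Y U; is_open Y V; is_open Y W; W \<subseteq> V; V \<subseteq> U; s \<in> carrier (sect Y U)\<rbrakk> \<Longrightarrow>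
    res Y V W (res Y U V s) = res Y U W s"
  using Y unfolding ringed_space_def by auto

lemma res_closed: "\<lbrakk>is_open Y U; is_open Y V; V \<subseteq> U; s \<in> carrier (sect Y U)\<rbrakk> \<Longrightarrow> res Y U V s \<in> carrier (sect Y V)"
  using ring_hom_closed[OF res_hom] .

lemma mem_germ: "(V, t) \<in> germ Y x U s \<longleftrightarrow> is_open Y V \<and> x \<in> V \<and> t \<in> carrier (sect Y V) \<and>
     (\<exists>W. is_open Y W \<and> x \<in> W \<and> W \<subseteq> U \<inter> V \<and> res Y U W s = res Y V W t)"
  unfolding germ_def by simp

lemma germ_eqI:
  assumes U: "is_open Y U" "s \<in> carrier (sect Y U)" and V: "is_open Y V" "t \<in> carrier (sect Y V)"
    and W: "is_open Y W" "x \<in> W" "W \<subseteq> U" "W \<subseteq> V" "res Y U W s = res Y V W t"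
  shows "germ Y x U s = germ Y x V t"
proof -
  have sub: "germ Y x U s \<subseteq> germ Y x V t"
    if U: "is_open Y U" "s \<in> carrier (sect Y U)" and V: "is_open Y V" "t \<in> carrier (sect Y V)"
      and W: "is_open Y W" "x \<in> W" "W \<subseteq> U" "W \<subseteq> V" "res Y U W s = res Y V W t" for U s V t
  proof (rule subrelI)
    fix V' t' assume "(V', t') \<in> germ Y x U s"
    then obtain W' where V': "is_open Y V'" "x \<in> V'" "t' \<in> carrier (sect Y V')"
      and W': "is_open Y W'" "x \<in> W'" "W' \<subseteq> U" "W' \<subseteq> V'" "res Y U W' s = res Y V' W' t'"
      unfolding mem_germ by auto
    let ?N = "W \<inter> W'"
    have N: "is_open Y ?N" "x \<in> ?N" using W W' by auto
    have "res Y V ?N t = res Y W ?N (res Y U W s)" unfolding W(5) using V W N by (intro res_res[symmetric]) auto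
    also have "\<dots> = res Y U ?N s" using U W N by (intro res_res) auto
    also have "\<dots> = res Y W' ?N (res Y U W' s)" using U W' N by (intro res_res[symmetric]) auto
    also have "\<dots> = res Y V' ?N t'" unfolding W'(5) using V' W' N by (intro res_res) auto
    finally show "(V', t') \<in> germ Y x V t" unfolding mem_germ using V' N W W' by blast
  qed
  show ?thesis using sub[OF U V W] sub[OF V U W(1,2,4,3) W(5)[symmetric]] by auto
qed

lemma germ_res:
  assumes "is_open Y U" "s \<in> carrier (sect Y U)" "is_open Y V" "x \<in> V" "V \<subseteq> U"
  shows "germ Y x U s = germ Y x V (res Y U V s)"
  using assms res_closed by (intro germ_eqI[of _ _ _ _ V]) (auto simp: res_id)

lemma germ_self: "\<lbrakk>is_open Y U; x \<in> U; s \<in> carrier (sect Y U)\<rbrakk> \<Longrightarrow> (U, s) \<in> germ Y x U s"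
  unfolding mem_germ by auto

lemma germ_mem_eq:
  assumes "is_open Y U" "x \<in> U" "s \<in> carrier (sect Y U)" "(V, t) \<in> germ Y x U s"
  obtains W where "is_open Y V" "x \<in> V" "t \<in> carrier (sect Y V)"
    "is_open Y W" "x \<in> W" "W \<subseteq> U" "W \<subseteq> V" "res Y U W s = res Y V W t"
  using assms unfolding mem_germ by auto

text \<open>Sum and product of germs are treated together: an operation that commutes with
  restriction is independent of representatives, as one sees on a neighbourhood where both pairs of
  representatives agree.\<close>

lemma germ_binary:
  assumes U: "is_open Y U" "x \<in> U" and s: "s \<in> carrier (sect Y U)" and t: "t \<in> carrier (sect Y U)"
    and f_closed: "\<And>V a b. \<lbrakk>is_open Y V; a \<in> carrier (sect Y V); b \<in> carrier (sect Y V)\<rbrakk> \<Longrightarrow> f V a b \<in> carrier (sect Y V)"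
    and f_res: "\<And>V W a b. \<lbrakk>is_open Y V; is_open Y W; W \<subseteq> V; a \<in> carrier (sect Y V); b \<in> carrier (sect Y V)\<rbrakk> \<Longrightarrow>
      res Y V W (f V a b) = f W (res Y V W a) (res Y V W b)"
  shows "(\<Union>(V, s)\<in>germ Y x U s. \<Union>(W, t)\<in>germ Y x U t.
        germ Y x (V \<inter> W) (f (V \<inter> W) (res Y V (V \<inter> W) s) (res Y W (V \<inter> W) t))) = germ Y x U (f U s t)"
proof (rule Union_pair_const[OF germ_self[OF U s] germ_self[OF U t]])
  fix V s' W t' assume s': "(V, s') \<in> germ Y x U s" and t': "(W, t') \<in> germ Y x U t"
  obtain A where V: "is_open Y V" "x \<in> V" "s' \<in> carrier (sect Y V)"
    and A: "is_open Y A" "x \<in> A" "A \<subseteq> U" "A \<subseteq> V" "res Y U A s = res Y V A s'"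
    using germ_mem_eq[OF U s s'] by blast
  obtain B where W: "is_open Y W" "x \<in> W" "t' \<in> carrier (sect Y W)"
    and B: "is_open Y B" "x \<in> B" "B \<subseteq> U" "B \<subseteq> W" "res Y U B t = res Y W B t'"
    using germ_mem_eq[OF U t t'] by blast
  let ?N = "A \<inter> B" and ?M = "V \<inter> W"
  have N: "is_open Y ?N" "x \<in> ?N" "is_open Y ?M" using A B V W by auto
  have NM: "?N \<subseteq> ?M" and NU: "?N \<subseteq> U" using A B by auto
  have cl: "res Y V ?M s' \<in> carrier (sect Y ?M)" "res Y W ?M t' \<in> carrier (sect Y ?M)"
    using N V W by (auto intro!: res_closed)
  have "res Y ?M ?N (res Y V ?M s') = res Y V ?N s'" using N V A B by (intro res_res) auto
  also have "\<dots> = res Y A ?N (res Y V A s')" using N V A by (intro res_res[symmetric]) auto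
  also have "\<dots> = res Y U ?N s" unfolding A(5)[symmetric] using N U s A by (intro res_res) auto
  finally have 1: "res Y ?M ?N (res Y V ?M s') = res Y U ?N s" .
  have "res Y ?M ?N (res Y W ?M t') = res Y W ?N t'" using N W A B by (intro res_res) auto
  also have "\<dots> = res Y B ?N (res Y W B t')" using N W B by (intro res_res[symmetric]) auto
  also have "\<dots> = res Y U ?N t" unfolding B(5)[symmetric] using N U t B by (intro res_res) auto
  finally have 2: "res Y ?M ?N (res Y W ?M t') = res Y U ?N t" .
  show "germ Y x ?M (f ?M (res Y V ?M s') (res Y W ?M t')) = germ Y x U (f U s t)"
  proof (rule germ_eqI[where W = ?N])
    show "res Y ?M ?N (f ?M (res Y V ?M s') (res Y W ?M t')) = res Y U ?N (f U s t)"
      using f_res[OF N(3,1) NM cl] f_res[OF U(1) N(1) NU s t] unfolding 1 2 by simp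
  qed (use N U A B cl s t f_closed in auto)
qed

lemma germ_hom:
  assumes U: "is_open Y U" "x \<in> U"
  shows "germ Y x U \<in> ring_hom (sect Y U) (stalk Y x)"
proof (rule ring_hom_memI)
  fix s assume s: "s \<in> carrier (sect Y U)"
  show "germ Y x U s \<in> carrier (stalk Y x)" unfolding stalk_def using U s by auto
  fix t assume t: "t \<in> carrier (sect Y U)"
  have cr: "cring (sect Y V)" if "is_open Y V" for V using sect_cring[OF that] .
  have mc: "a \<otimes>\<^bsub>sect Y V\<^esub> b \<in> carrier (sect Y V)" "a \<oplus>\<^bsub>sect Y V\<^esub> b \<in> carrier (sect Y V)"
    if "is_open Y V" "a \<in> carrier (sect Y V)" "b \<in> carrier (sect Y V)" for V a b
  proof -
    interpret cring "sect Y V" by (rule cr[OF that(1)])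
    show "a \<otimes>\<^bsub>sect Y V\<^esub> b \<in> carrier (sect Y V)" "a \<oplus>\<^bsub>sect Y V\<^esub> b \<in> carrier (sect Y V)" using that by auto
  qed
  show "germ Y x U (s \<otimes>\<^bsub>sect Y U\<^esub> t) = germ Y x U s \<otimes>\<^bsub>stalk Y x\<^esub> germ Y x U t"
    unfolding stalk_def monoid.simps
  proof (rule germ_binary[OF U s t, symmetric, of "\<lambda>V. mult (sect Y V)"])
    fix V a b assume V: "is_open Y V" "a \<in> carrier (sect Y V)" "b \<in> carrier (sect Y V)"
    then show "a \<otimes>\<^bsub>sect Y V\<^esub> b \<in> carrier (sect Y V)" by (rule mc)
    fix W assume W: "is_open Y W" "W \<subseteq> V"
    show "res Y V W (a \<otimes>\<^bsub>sect Y V\<^esub> b) = res Y V W a \<otimes>\<^bsub>sect Y W\<^esub> res Y V W b"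
      by (rule ring_hom_mult[OF res_hom[OF V(1) W] V(2,3)])
  qed
  show "germ Y x U (s \<oplus>\<^bsub>sect Y U\<^esub> t) = germ Y x U s \<oplus>\<^bsub>stalk Y x\<^esub> germ Y x U t"
    unfolding stalk_def ring.simps
  proof (rule germ_binary[OF U s t, symmetric, of "\<lambda>V. add (sect Y V)"])
    fix V a b assume V: "is_open Y V" "a \<in> carrier (sect Y V)" "b \<in> carrier (sect Y V)"
    then show "a \<oplus>\<^bsub>sect Y V\<^esub> b \<in> carrier (sect Y V)" by (rule mc)
    fix W assume W: "is_open Y W" "W \<subseteq> V"
    show "res Y V W (a \<oplus>\<^bsub>sect Y V\<^esub> b) = res Y V W a \<oplus>\<^bsub>sect Y W\<^esub> res Y V W b"
      by (rule ring_hom_add[OF res_hom[OF V(1) W] V(2,3)])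
  qed
next
  have "is_open Y (points Y)" by simp
  then have "germ Y x (points Y) \<one>\<^bsub>sect Y (points Y)\<^esub> = germ Y x U (res Y (points Y) U \<one>\<^bsub>sect Y (points Y)\<^esub>)"
    using U openin_subset[of "tops Y" U] ring.ring_simprules(6)[OF cring.axioms(1)[OF sect_cring]]
    by (intro germ_res) auto
  also have "res Y (points Y) U \<one>\<^bsub>sect Y (points Y)\<^esub> = \<one>\<^bsub>sect Y U\<^esub>"
    using U openin_subset[of "tops Y" U] by (intro ring_hom_one[OF res_hom]) auto
  finally show "germ Y x U \<one>\<^bsub>sect Y U\<^esub> = \<one>\<^bsub>stalk Y x\<^esub>" unfolding stalk_def by simp
qed

lemma stalkE:
  assumes "g \<in> carrier (stalk Y x)"
  obtains U s where "is_open Y U" "x \<in> U" "s \<in> carrier (sect Y U)" "g = germ Y x U s"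
  using assms unfolding stalk_def by auto

end


lemma open_sub_simps:
  "sect (open_sub Y U) = sect Y" "res (open_sub Y U) = res Y" "tops (open_sub Y U) = subtopology (tops Y) U"
  unfolding open_sub_def by simp_all

lemma generic_point_mem:
  assumes "generic_point Y \<eta>" "is_open Y U" "U \<noteq> {}"
  shows "\<eta> \<in> U"
proof -
  obtain y where "y \<in> U" using assms(3) by auto
  then have "y \<in> tops Y closure_of {\<eta>}"
    using assms openin_subset[OF assms(2)] unfolding generic_point_def by auto
  then show ?thesis using \<open>y \<in> U\<close> assms(2) unfolding in_closure_of by auto
qed

text \<open>Near the generic point, a section of \<open>Spec R\<close> over a domain \<open>R\<close> is a fraction \<open>a/b\<close>: it
  vanishes if \<open>a = 0\<close>, and is invertible off the zero locus of \<open>a\<close> otherwise.\<close>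

lemma affine_section_zero_or_unit:
  fixes Y :: "('a, 'b) rspace"
  assumes int: "integral_scheme Y" and gen: "generic_point Y \<eta>"
    and W: "affine_open Y W" "\<eta> \<in> W"
    and U: "is_open Y U" "\<eta> \<in> U" "U \<subseteq> W" and s: "s \<in> carrier (sect Y U)"
  shows "\<exists>N. is_open Y N \<and> \<eta> \<in> N \<and> N \<subseteq> U \<and>
    (res Y U N s = \<zero>\<^bsub>sect Y N\<^esub> \<or> (\<exists>t\<in>carrier (sect Y N). res Y U N s \<otimes>\<^bsub>sect Y N\<^esub> t = \<one>\<^bsub>sect Y N\<^esub>))"
proof -
  define R where "R = sect Y W"
  let ?S = "Spec R" and ?A = "open_sub Y W"
  have Wo: "is_open Y W" using W(1) unfolding affine_open_def by simp
  have rs: "ringed_space Y"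
    using int unfolding integral_scheme_def scheme_def locally_ringed_space_def by simp
  have dom: "domain R"
    unfolding R_def using int Wo W(2) unfolding integral_scheme_def by auto
  interpret R: domain R by (rule dom)
  have rcr: "cring R" by (rule R.is_cring)
  have Ao: "is_open ?A V \<longleftrightarrow> is_open Y V \<and> V \<subseteq> W" for V
    unfolding open_sub_simps by (rule openin_open_subtopology[OF Wo])
  have Ap: "points ?A = W" unfolding open_sub_simps using openin_subset[OF Wo] by auto
  obtain f h where f: "lrs_morphism ?A ?S f" and h: "lrs_morphism ?S ?A h"
    and fh: "rmap_eq ?A ?A (rmap_comp ?S h f) rmap_id" and hf: "rmap_eq ?S ?S (rmap_comp ?A f h) rmap_id"
    using W(1) unfolding affine_open_def lrs_iso_def R_def by blast
  have fc: "continuous_map (tops ?A) (spec_topology R) (fst f)"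
    and hc: "continuous_map (spec_topology R) (tops ?A) (fst h)"
    using f h unfolding lrs_morphism_def by auto
  have fs: "snd f V \<in> ring_hom (sect ?S V) (sect Y (preim ?A f V))" if "openin (spec_topology R) V" for V
    using f that unfolding lrs_morphism_def open_sub_simps by simp
  have fres: "res Y (preim ?A f V) (preim ?A f V') (snd f V \<sigma>) = snd f V' (restrict \<sigma> V')"
    if "openin (spec_topology R) V" "openin (spec_topology R) V'" "V' \<subseteq> V" "\<sigma> \<in> spec_sections R V" for V V' \<sigma>
    using f that unfolding lrs_morphism_def open_sub_simps by simp
  have hfx: "fst h (fst f x) = x" if "x \<in> W" for x
    using fh that Ap unfolding rmap_eq_def rmap_comp_def rmap_id_def by simp
  have fhx: "fst f (fst h P) = P" if "P \<in> topspace (spec_topology R)" for P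
    using hf that unfolding rmap_eq_def rmap_comp_def rmap_id_def by simp
  have hfs: "snd f (preim ?S h V) (snd h V s) = s" if "is_open Y V" "V \<subseteq> W" "s \<in> carrier (sect Y V)" for V s
    using fh that Ao unfolding rmap_eq_def rmap_comp_def rmap_id_def open_sub_simps by simp
  \<comment> \<open>From here the argument lives on the spectrum: \<open>V0\<close> is the open set
    corresponding to \<open>U\<close> and \<sigma> the section corresponding to
    \<open>s\<close>.\<close>
  define V0 where "V0 = preim ?S h U"
  have V0: "openin (spec_topology R) V0"
    unfolding V0_def preim_def using openin_continuous_map_preimage[OF hc, of U] Ao U by simp
  have fpre: "is_open Y (preim ?A f V) \<and> preim ?A f V \<subseteq> W" if "openin (spec_topology R) V" for V
    using openin_continuous_map_preimage[OF fc that] Ao unfolding preim_def by simp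
  have fT: "fst f x \<in> topspace (spec_topology R)" if "x \<in> W" for x
    using fc that Ap unfolding continuous_map_def by auto
  have pre0: "preim ?A f V0 = U"
    unfolding V0_def preim_def Ap using hfx fT U(3) by auto
  define \<sigma> where "\<sigma> = snd h U s"
  have \<sigma>: "\<sigma> \<in> spec_sections R V0"
  proof -
    have "snd h U \<in> ring_hom (sect Y U) (sect ?S V0)"
      using h Ao U unfolding lrs_morphism_def V0_def open_sub_simps by simp
    then show ?thesis unfolding \<sigma>_def using ring_hom_closed[OF _ s] by fastforce
  qed
  have s_eq: "s = snd f V0 \<sigma>" unfolding \<sigma>_def V0_def using hfs[OF U(1,3) s] by simp
  have P: "fst f \<eta> \<in> V0" using pre0 U(2) unfolding preim_def by auto
  have "\<forall>P\<in>V0. \<exists>V a b. openin (spec_topology R) V \<and> P \<in> V \<and> V \<subseteq> V0 \<and> a \<in> carrier R \<and> b \<in> carrier R \<and>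
      (\<forall>Q\<in>V. b \<notin> Q \<and> \<sigma> Q = frac_at R Q a b)"
    using \<sigma> unfolding spec_sections_def by simp
  from bspec[OF this P] obtain V a b where V: "openin (spec_topology R) V" "fst f \<eta> \<in> V" "V \<subseteq> V0"
    and ab: "a \<in> carrier R" "b \<in> carrier R" "\<And>Q. Q \<in> V \<Longrightarrow> b \<notin> Q \<and> \<sigma> Q = frac_at R Q a b"
    by blast
  have fr: "fractions R (carrier R - Q)" if "openin (spec_topology R) V" "Q \<in> V" for V Q
    using fractions_at_prime[OF rcr spec_open_primes[OF that]] .
  have s_res: "res Y U (preim ?A f V') s = snd f V' (\<lambda>Q\<in>V'. frac_at R Q a b)"
    if "openin (spec_topology R) V'" "V' \<subseteq> V" for V'
  proof -
    have "res Y U (preim ?A f V') s = snd f V' (restrict \<sigma> V')"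
      using fres[OF V0 that(1) _ \<sigma>] that V(3) unfolding pre0 s_eq[symmetric] by auto
    also have "restrict \<sigma> V' = (\<lambda>Q\<in>V'. frac_at R Q a b)" using ab(3) that by (auto simp: restrict_def fun_eq_iff)
    finally show ?thesis .
  qed
  have preU: "preim ?A f V' \<subseteq> U" if "V' \<subseteq> V" for V' using that V(3) pre0 unfolding preim_def by auto
  show ?thesis
  proof (cases "a = \<zero>\<^bsub>R\<^esub>")
    case True
    let ?N = "preim ?A f V" and ?z = "\<lambda>Q\<in>V. frac_at R Q a b"
    have N: "is_open Y ?N" "\<eta> \<in> ?N" using fpre[OF V(1)] V(2) W(2) Ap unfolding preim_def by auto
    interpret N: cring "sect Y ?N" using rs N unfolding ringed_space_def by auto
    have z: "?z \<in> carrier (sect ?S V)" using frac_section[OF rcr V(1) ab(1,2)] ab(3) by simp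
    \<comment> \<open>The section \<open>?z\<close> is shown to equal its own double. This identity
      is carried to the ring of sections of \<open>Y\<close>, where it forces the image to be
      zero.\<close>
    have "frac_at R Q a b \<oplus>\<^bsub>local_at R Q\<^esub> frac_at R Q a b = frac_at R Q a b" if Q: "Q \<in> V" for Q
    proof -
      interpret Q: fractions R "carrier R - Q" by (rule fr[OF V(1) Q])
      have b: "b \<in> carrier R - Q" using ab Q by auto
      have "frac_at R Q a b \<oplus>\<^bsub>local_at R Q\<^esub> frac_at R Q a b
          = frac_at R Q (a \<otimes>\<^bsub>R\<^esub> b \<oplus>\<^bsub>R\<^esub> a \<otimes>\<^bsub>R\<^esub> b) (b \<otimes>\<^bsub>R\<^esub> b)"
        by (rule Q.frac_add[OF ab(1) b ab(1) b])
      also have "\<dots> = frac_at R Q a b"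
        using Q.S(2) Q.S(3)[OF b b] ab(1,2) b True by (intro Q.frac_eqI[of _ _ _ _ "\<one>\<^bsub>R\<^esub>"]) auto
      finally show ?thesis .
    qed
    then have "?z \<oplus>\<^bsub>sect ?S V\<^esub> ?z = ?z" by (auto simp: restrict_def fun_eq_iff)
    then have "snd f V ?z \<oplus>\<^bsub>sect Y ?N\<^esub> snd f V ?z = snd f V ?z"
      using ring_hom_add[OF fs[OF V(1)] z z] by simp
    then have "snd f V ?z = \<zero>\<^bsub>sect Y ?N\<^esub>"
      using ring_hom_closed[OF fs[OF V(1)] z] by simp
    then have "res Y U ?N s = \<zero>\<^bsub>sect Y ?N\<^esub>" using s_res[OF V(1) order_refl] by simp
    then show ?thesis using N preU[OF order_refl] by blast
  next
    case False
    \<comment> \<open>On this set the numerator avoids every prime, so the fraction can be inverted.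
      The set contains the zero ideal; hence its preimage in \<open>Y\<close> is a nonempty open set
      and contains the generic point, even if the point of \<open>V\<close> found above is
      lost.\<close>
    define V' where "V' = V \<inter> {P. primeideal P R \<and> a \<notin> P}"
    have V': "openin (spec_topology R) V'" "V' \<subseteq> V"
      unfolding V'_def using V(1) spec_basic_open[OF ab(1)] by auto
    have zV: "{\<zero>\<^bsub>R\<^esub>} \<in> V'"
      unfolding V'_def using zero_ideal_mem_open[OF dom V(1)] V(2) R.zeroprimeideal False by auto
    let ?N = "preim ?A f V'"
    have zT: "{\<zero>\<^bsub>R\<^esub>} \<in> topspace (spec_topology R)" using zV openin_subset[OF V'(1)] by auto
    have "fst h {\<zero>\<^bsub>R\<^esub>} \<in> ?N"
      using zV fhx[OF zT] hc zT Ap unfolding preim_def continuous_map_def by auto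
    then have N: "is_open Y ?N" "\<eta> \<in> ?N" using fpre[OF V'(1)] generic_point_mem[OF gen] by auto
    let ?x = "\<lambda>Q\<in>V'. frac_at R Q a b" and ?y = "\<lambda>Q\<in>V'. frac_at R Q b a"
    have x: "?x \<in> carrier (sect ?S V')" using frac_section[OF rcr V'(1) ab(1,2)] ab(3) V'(2) by auto
    have y: "?y \<in> carrier (sect ?S V')" using frac_section[OF rcr V'(1) ab(2,1)] unfolding V'_def by auto
    have "frac_at R Q a b \<otimes>\<^bsub>local_at R Q\<^esub> frac_at R Q b a = \<one>\<^bsub>local_at R Q\<^esub>" if Q: "Q \<in> V'" for Q
    proof -
      interpret Q: fractions R "carrier R - Q" by (rule fr[OF V'(1) Q])
      have b: "b \<in> carrier R - Q" and a: "a \<in> carrier R - Q" using ab Q V'_def by auto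
      have "frac_at R Q a b \<otimes>\<^bsub>local_at R Q\<^esub> frac_at R Q b a = frac_at R Q (a \<otimes>\<^bsub>R\<^esub> b) (b \<otimes>\<^bsub>R\<^esub> a)"
        by (rule Q.frac_mult[OF ab(1) b ab(2) a])
      also have "\<dots> = frac_at R Q \<one>\<^bsub>R\<^esub> \<one>\<^bsub>R\<^esub>"
        using ab Q.S(2) Q.S(3)[OF b a] R.m_comm[OF ab(1,2)] by (intro Q.frac_eqI[of _ _ _ _ "\<one>\<^bsub>R\<^esub>"]) auto
      finally show ?thesis unfolding Q.localization_one .
    qed
    then have "?x \<otimes>\<^bsub>sect ?S V'\<^esub> ?y = \<one>\<^bsub>sect ?S V'\<^esub>" by (auto simp: restrict_def fun_eq_iff)
    then have "snd f V' ?x \<otimes>\<^bsub>sect Y ?N\<^esub> snd f V' ?y = \<one>\<^bsub>sect Y ?N\<^esub>"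
      using ring_hom_mult[OF fs[OF V'(1)] x y] ring_hom_one[OF fs[OF V'(1)]] by simp
    then have "res Y U ?N s \<otimes>\<^bsub>sect Y ?N\<^esub> snd f V' ?y = \<one>\<^bsub>sect Y ?N\<^esub>" using s_res[OF V'] by simp
    then show ?thesis using N preU[OF V'(2)] ring_hom_closed[OF fs[OF V'(1)] y] by blast
  qed
qed

lemma stalk_generic_point_field:
  fixes Y :: "('a, 'b) rspace"
  assumes int: "integral_scheme Y" and gen: "generic_point Y \<eta>"
  shows "field (stalk Y \<eta>)"
proof -
  have sch: "scheme Y" using int unfolding integral_scheme_def by simp
  have lrs: "locally_ringed_space Y" using sch unfolding scheme_def by simp
  have \<eta>: "\<eta> \<in> points Y" using gen unfolding generic_point_def by simp
  interpret ringed Y \<eta>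
    using lrs \<eta> unfolding locally_ringed_space_def by unfold_locales auto
  have loc: "local_ring (stalk Y \<eta>)" using lrs \<eta> unfolding locally_ringed_space_def by simp
  then interpret A: cring "stalk Y \<eta>" unfolding local_ring_def by simp
  show ?thesis
  proof (rule A.cring_fieldI2)
    show "\<zero>\<^bsub>stalk Y \<eta>\<^esub> \<noteq> \<one>\<^bsub>stalk Y \<eta>\<^esub>"
    proof
      assume eq: "\<zero>\<^bsub>stalk Y \<eta>\<^esub> = \<one>\<^bsub>stalk Y \<eta>\<^esub>"
      obtain M where "maximalideal M (stalk Y \<eta>)" using loc unfolding local_ring_def by blast
      then interpret M: maximalideal M "stalk Y \<eta>" .
      have "\<one>\<^bsub>stalk Y \<eta>\<^esub> \<in> M" unfolding eq[symmetric] by (rule M.zero_closed)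
      then show False using M.one_imp_carrier M.I_notcarr by auto
    qed
    fix g assume g: "g \<in> carrier (stalk Y \<eta>)" "g \<noteq> \<zero>\<^bsub>stalk Y \<eta>\<^esub>"
    obtain U s where U: "is_open Y U" "\<eta> \<in> U" and s: "s \<in> carrier (sect Y U)" and g_eq: "g = germ Y \<eta> U s"
      using stalkE[OF g(1)] by blast
    obtain W where W: "affine_open Y W" "\<eta> \<in> W" using sch \<eta> unfolding scheme_def by blast
    have Wo: "is_open Y W" using W(1) unfolding affine_open_def by simp
    let ?U = "U \<inter> W" and ?s = "res Y U (U \<inter> W) s"
    have U': "is_open Y ?U" "\<eta> \<in> ?U" "?U \<subseteq> W" using U W Wo by auto
    have s': "?s \<in> carrier (sect Y ?U)" using U Wo s by (intro res_closed) auto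
    obtain N where N: "is_open Y N" "\<eta> \<in> N" "N \<subseteq> ?U"
      and alt: "res Y ?U N ?s = \<zero>\<^bsub>sect Y N\<^esub> \<or>
        (\<exists>t\<in>carrier (sect Y N). res Y ?U N ?s \<otimes>\<^bsub>sect Y N\<^esub> t = \<one>\<^bsub>sect Y N\<^esub>)"
      using affine_section_zero_or_unit[OF int gen W U' s'] by blast
    have "g = germ Y \<eta> ?U ?s" unfolding g_eq using U U' s by (intro germ_res) auto
    also have "\<dots> = germ Y \<eta> N (res Y ?U N ?s)" using U' N s' by (intro germ_res) auto
    finally have gN: "g = germ Y \<eta> N (res Y ?U N ?s)" .
    have sN: "res Y ?U N ?s \<in> carrier (sect Y N)" by (rule res_closed[OF U'(1) N(1,3) s'])
    interpret SN: cring "sect Y N" by (rule sect_cring[OF N(1)])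
    interpret h: ring_hom_ring "sect Y N" "stalk Y \<eta>" "germ Y \<eta> N"
      by (intro ring_hom_ringI2 SN.ring_axioms A.ring_axioms germ_hom N)
    have "res Y ?U N ?s \<noteq> \<zero>\<^bsub>sect Y N\<^esub>" using gN g(2) by auto
    then obtain t where t: "t \<in> carrier (sect Y N)" "res Y ?U N ?s \<otimes>\<^bsub>sect Y N\<^esub> t = \<one>\<^bsub>sect Y N\<^esub>" using alt by blast
    have "g \<otimes>\<^bsub>stalk Y \<eta>\<^esub> germ Y \<eta> N t = \<one>\<^bsub>stalk Y \<eta>\<^esub>"
      unfolding gN h.hom_mult[OF sN t(1), symmetric] t(2) by simp
    then show "\<exists>y\<in>carrier (stalk Y \<eta>). g \<otimes>\<^bsub>stalk Y \<eta>\<^esub> y = \<one>\<^bsub>stalk Y \<eta>\<^esub>"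
      using h.hom_closed[OF t(1)] by blast
  qed
qed

lemma stalk_structure_map_hom:
  fixes F :: "'f ring" and Y :: "('a, 'b) rspace" and \<pi> :: "('a, 'b, 'f set, 'f spec_sect) rmap"
  assumes F: "cring F" and Y: "ringed_space Y" "y \<in> points Y" and \<pi>: "lrs_morphism Y (Spec F) \<pi>"
  shows "stalk_structure_map F Y \<pi> y \<in> ring_hom F (stalk Y y)"
proof -
  interpret ringed Y y by unfold_locales (use Y in auto)
  have "\<And>x. x \<in> points Y \<Longrightarrow> fst \<pi> x \<in> topspace (spec_topology F)"
    using \<pi> unfolding lrs_morphism_def continuous_map_def by auto
  then have "preim Y \<pi> (points (Spec F)) = points Y" unfolding preim_def by auto
  then have p: "snd \<pi> (points (Spec F)) \<in> ring_hom (sect (Spec F) (points (Spec F))) (sect Y (points Y))"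
    using \<pi> unfolding lrs_morphism_def by (metis openin_topspace)
  have "germ Y y (points Y) \<circ> (snd \<pi> (points (Spec F)) \<circ> spec_const F) \<in> ring_hom F (stalk Y y)"
    by (intro ring_hom_trans[OF _ germ_hom] ring_hom_trans[OF spec_const_hom[OF F] p]) (use x in auto)
  then show ?thesis unfolding stalk_structure_map_def comp_def .
qed

section \<open>Extension fields of a field of \<open>p\<close>-degree at most one\<close>

lemma edim_over_le_1:
  fixes F :: "'f ring" and K :: "'k ring"
  assumes F: "char_p_field_ring F p" and pdeg: "pdeg F \<le> 1"
    and K: "field K" and \<alpha>: "\<alpha> \<in> ring_hom F K"
  shows "edim_over F \<alpha> K \<le> 1"
proof -
  interpret F: char_p_field_ring F p by (rule F)
  have Kp: "char_p_field_ring K p"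
    by (intro char_p_field_ring.intro char_p_field.intro K char_p_ring_hom[OF F.char_p_ring_axioms _ \<alpha>]
        fieldE(1))
  interpret K: char_p_field_ring K p by (rule Kp)
  let ?E = "perf_closure F" and ?\<epsilon> = "perf_embed F"
  interpret E: char_p_field_ring ?E p by (rule F.perf_closure_char_p)
  interpret T: tensor_product K ?E F \<alpha> ?\<epsilon>
    by (intro tensor_product.intro tensor_product_axioms.intro K.is_cring F.perf_closure_cring \<alpha>
        F.perf_embed_hom)
  interpret Tp: char_p_ring T.T p
    by (rule char_p_ring_hom[OF K.char_p_ring_axioms T.T_cring T.inl_hom])
  obtain t where t: "t \<in> carrier F" "\<And>x. x \<in> carrier F \<Longrightarrow>
      \<exists>c. (\<forall>i<p. c i \<in> carrier F) \<and> x = (\<Oplus>\<^bsub>F\<^esub>i\<in>{..<p}. c i [^]\<^bsub>F\<^esub> p \<otimes>\<^bsub>F\<^esub> t [^]\<^bsub>F\<^esub> i)"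
    using pdeg_le_1_generator[OF F.char_p_field_axioms pdeg] by blast
  have "\<one>\<^bsub>T.T\<^esub> \<noteq> \<zero>\<^bsub>T.T\<^esub>"
  \<comment> \<open>The perfect closure of \<open>K\<close> receives both \<open>K\<close> and the
    perfect closure of \<open>F\<close>, compatibly over \<open>F\<close>.\<close>
  proof (rule T.T_nontrivial)
    interpret K': field "perf_closure K" by (rule K.perf_closure_field)
    show "cring (perf_closure K)" by (rule K'.is_cring)
    show "\<one>\<^bsub>perf_closure K\<^esub> \<noteq> \<zero>\<^bsub>perf_closure K\<^esub>" by simp
    show "perf_embed K \<in> ring_hom K (perf_closure K)" by (rule K.perf_embed_hom)
    show "perf_map K \<alpha> \<in> ring_hom ?E (perf_closure K)" by (rule perf_map(2)[OF F Kp \<alpha>])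
    show "perf_embed K (\<alpha> c) = perf_map K \<alpha> (perf_embed F c)" if "c \<in> carrier F" for c
      unfolding perf_embed_def using perf_map(1)[OF F Kp \<alpha> that] by simp
  qed
  then interpret B: perf_base_change F K ?E T.T p \<alpha> ?\<epsilon> T.inl T.inr t "perf_elem F t"
  proof unfold_locales
    show "\<alpha> \<in> ring_hom F K" by (rule \<alpha>)
    show "?\<epsilon> \<in> ring_hom F ?E" by (rule F.perf_embed_hom)
    show "T.inl \<in> ring_hom K T.T" by (rule T.inl_hom)
    show "T.inr \<in> ring_hom ?E T.T" by (rule T.inr_hom)
    show "t \<in> carrier F" by (rule t(1))
    show "\<exists>c. (\<forall>i<p. c i \<in> carrier F) \<and> x = (\<Oplus>\<^bsub>F\<^esub>i\<in>{..<p}. c i [^]\<^bsub>F\<^esub> p \<otimes>\<^bsub>F\<^esub> t [^]\<^bsub>F\<^esub> i)"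
      if "x \<in> carrier F" for x by (rule t(2)[OF that])
    show "perf_elem F t n \<in> carrier ?E" for n by (rule F.perf_elem_closed[OF t(1)])
    show "perf_elem F t n [^]\<^bsub>?E\<^esub> (p ^ n) = ?\<epsilon> t" for n by (rule F.perf_elem_pow_p[OF t(1)])
    show "\<exists>n. \<exists>y\<in>carrier F. e [^]\<^bsub>?E\<^esub> (p ^ n) = ?\<epsilon> y" if "e \<in> carrier ?E" for e
      using F.perf_elemE[OF that] F.perf_elem_pow_p by metis
    show "T.inl (\<alpha> c) = T.inr (?\<epsilon> c)" if "c \<in> carrier F" for c by (rule T.balanced[OF that])
    show "P x" if "x \<in> carrier T.T" "P \<zero>\<^bsub>T.T\<^esub>"
      "\<And>a b. \<lbrakk>a \<in> carrier K; b \<in> carrier ?E\<rbrakk> \<Longrightarrow> P (T.inl a \<otimes>\<^bsub>T.T\<^esub> T.inr b)"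
      "\<And>x y. \<lbrakk>x \<in> carrier T.T; y \<in> carrier T.T; P x; P y\<rbrakk> \<Longrightarrow> P (x \<ominus>\<^bsub>T.T\<^esub> y)" for P x
      using that by (rule T.T_induct)
    assume "\<one>\<^bsub>T.T\<^esub> \<noteq> \<zero>\<^bsub>T.T\<^esub>"
    then show "\<one>\<^bsub>T.T\<^esub> \<noteq> \<zero>\<^bsub>T.T\<^esub>" .
  qed
  obtain g where g: "g \<in> B.nilp"
    "\<And>x. x \<in> B.nilp \<Longrightarrow> \<exists>z\<in>carrier T.T. \<exists>w\<in>ideal_prod T.T B.nilp B.nilp. x = z \<otimes>\<^bsub>T.T\<^esub> g \<oplus>\<^bsub>T.T\<^esub> w"
    using B.nilp_generator by blast
  have "maximalideal B.nilp T.T" using B.maximalideal_iff by simp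
  then show ?thesis
    unfolding edim_over_def by (rule edim_le_1I[OF T.T_cring _ B.max_ideal_eq g])
qed

theorem theorem1p4:
  fixes F :: "'f ring" and p :: nat
    and Y :: "('a, 'b) rspace" and \<pi> :: "('a, 'b, 'f set, 'f spec_sect) rmap" and \<eta> :: 'a
  assumes "field F" and "ring_char F = p" and "p > 0"
    and "pdeg F \<le> 1"
    and "integral_scheme Y"
    and "proper_morphism Y (Spec F) \<pi>"
    and "generic_point Y \<eta>"
  shows "edim_over F (stalk_structure_map F Y \<pi> \<eta>) (stalk Y \<eta>) \<le> 1"
proof (rule edim_over_le_1)
  show "char_p_field_ring F p" by (rule char_p_field_ringI[OF assms(1-3)])
  then interpret char_p_field_ring F p .
  show "pdeg F \<le> 1" by (rule assms(4))
  show "field (stalk Y \<eta>)" by (rule stalk_generic_point_field[OF assms(5,7)])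
  show "stalk_structure_map F Y \<pi> \<eta> \<in> ring_hom F (stalk Y \<eta>)"
  proof (rule stalk_structure_map_hom[OF is_cring])
    show "ringed_space Y"
      using assms(5) unfolding integral_scheme_def scheme_def locally_ringed_space_def by simp
    show "\<eta> \<in> points Y" using assms(7) unfolding generic_point_def by simp
    show "lrs_morphism Y (Spec F) \<pi>" using assms(6) unfolding proper_morphism_def by simp
  qed
qed

end
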